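(* Let $G\subset\mathbb R^3$ be a smooth bounded open set, and let $F_s\colon H^{1/2}(\partial G;\mathbb S^2)\to[0,\infty]$ be weakly lower semicontinuous with $\{F_s<\infty\}\ne\emptyset$. Let $$\hat E(n_0)=\min\left\{E(n)\colon n\in H^1_{loc}(\mathbb R^3\setminus G;\mathbb S^2),\ \int_{\mathbb R^3\setminus G}\frac{|n-n_0|^2}{1+r^2}+\int_{\mathbb R^3\setminus G}|\nabla n|^2<\infty\right\},\quad n_0\in\mathbb S^2,$$ where $E(n)=\int_{\mathbb R^3\setminus G}|\nabla n|^2+F_s(n_{\lfloor\partial G})$. (i) If the particle has an axis of symmetry $\mathbf u\in\mathbb S^2$, i.e. $\mathrm{Sym}(G,F_s)$ contains all rotations $R\in SO(3)^{\mathbf u}$ about the axis $\mathbf u$, then for almost all $n_0\in\mathbb S^2$ we have $$v_0(n_0)\cdot(\mathbf u\times n_0)=0,$$ where $v_0(n_0)=\lim_{r\to\infty}r(n-n_0)$ for any minimizing map $n$ achieving $\hat E(n_0)$. If in addition $\hat E$ is differentiable at $\mathbf u$, then $v_0(\mathbf u)=0$ (for any minimizing map achieving $\hat E(\mathbf u)$). (ii) If the particle is spherically symmetric, i.e. $\mathrm{Sym}(G,F_s)$ contains all rotations $SO(3)$, then $v_0(n_0)=0$ for all $n_0\in\mathbb S^2$ (for any minimizing map achieving $\hat E(n_0)$).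
   Context: $\mathbb S^2\subset\mathbb R^3$ is the unit sphere, $r=|x|$, and $n_{\lfloor\partial G}$ is the trace of $n$ on $\partial G$. Under the hypotheses on $F_s$, the minimum defining $\hat E(n_0)$ is attained and finite for every $n_0\in\mathbb S^2$; a minimizing map achieving $\hat E(n_0)$ means an admissible map $n$ in that problem with $E(n)=\hat E(n_0)$ (minimizers need not be unique). For any such minimizer the limit $v_0=\lim_{r\to\infty}r(n-n_0)$, as $|x|=r\to\infty$, exists in $\mathbb R^3$ and is orthogonal to $n_0$. The symmetry group of the particle (and its anchoring properties) $(G,F_s)$ is $$\mathrm{Sym}(G,F_s)=\left\{R\in O(3)\colon RG=G\text{ and }F_s(Rn\circ R^{-1})=F_s(n)\ \ \forall n\in H^{1/2}(\partial G;\mathbb S^2)\right\}.$$ $SO(3)^{\mathbf u}$ denotes the group of rotations about the axis $\mathbf u$, and "almost all" refers to the surface measure on $\mathbb S^2$. *)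

theory Defs
  imports "HOL-Analysis.Analysis"
begin

section \<open>Smooth functions and smooth open sets\<close>

type_synonym R3 = "real ^ 3"

definition partial :: "3 \<Rightarrow> (R3 \<Rightarrow> 'b::real_normed_vector) \<Rightarrow> R3 \<Rightarrow> 'b" where
  "partial i f x = frechet_derivative f (at x) (axis i 1)"

text \<open>Only meant for open \<open>U\<close>, where \<open>differentiable_on\<close> agrees with differentiability at each point.\<close>

primrec Ck_on :: "nat \<Rightarrow> (R3 \<Rightarrow> 'b::real_normed_vector) \<Rightarrow> R3 set \<Rightarrow> bool" where
  "Ck_on 0 f U \<longleftrightarrow> continuous_on U f"
| "Ck_on (Suc k) f U \<longleftrightarrow> f differentiable_on U \<and> (\<forall>i. Ck_on k (partial i f) U)"

definition smooth_on :: "(R3 \<Rightarrow> 'b::real_normed_vector) \<Rightarrow> R3 set \<Rightarrow> bool" where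
  "smooth_on f U \<longleftrightarrow> (\<forall>k. Ck_on k f U)"

definition test_functions :: "R3 set \<Rightarrow> (R3 \<Rightarrow> real) set" where
  "test_functions U = {\<phi>. smooth_on \<phi> UNIV \<and> compact (closure {x. \<phi> x \<noteq> 0}) \<and> closure {x. \<phi> x \<noteq> 0} \<subseteq> U}"

text \<open>Near each boundary point the set lies on one side of its boundary, which is the regular
  zero level set of a smooth function.\<close>

definition smooth_open_set :: "R3 set \<Rightarrow> bool" where
  "smooth_open_set G \<longleftrightarrow> open G \<and>
     (\<forall>p\<in>frontier G. \<exists>U (\<rho>::R3 \<Rightarrow> real). open U \<and> p \<in> U \<and> smooth_on \<rho> U \<and>
        (\<forall>x\<in>U. \<exists>i. partial i \<rho> x \<noteq> 0) \<and> G \<inter> U = {x\<in>U. \<rho> x < 0})"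


section \<open>Surface measure\<close>

text \<open>Surface measure is two-dimensional Hausdorff measure. The factor \<open>pi / 4\<close> is the normalization
  for which it agrees with surface area. The outer measure is a metric outer measure, hence countably
  additive on the Borel sets, so that \<open>measure_of\<close> does not fall back to the zero measure.\<close>

definition hausdorff2_pre :: "real \<Rightarrow> R3 set \<Rightarrow> ennreal" where
  "hausdorff2_pre \<delta> A =
     (INF C\<in>{C :: nat \<Rightarrow> R3 set. A \<subseteq> (\<Union>i. C i) \<and> (\<forall>i. bounded (C i) \<and> diameter (C i) \<le> \<delta>)}.
        \<Sum>i. ennreal (pi / 4 * (diameter (C i))\<^sup>2))"

definition hausdorff2_outer :: "R3 set \<Rightarrow> ennreal" where
  "hausdorff2_outer A = (SUP \<delta>\<in>{0<..}. hausdorff2_pre \<delta> A)"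

definition hausdorff2 :: "R3 measure" where
  "hausdorff2 = measure_of UNIV (sets borel) hausdorff2_outer"

definition surface_measure :: "R3 set \<Rightarrow> R3 measure" where
  "surface_measure S = restrict_space hausdorff2 S"


section \<open>The space \<open>H\<^sup>1\<^sup>/\<^sup>2(\<partial>G)\<close>\<close>

text \<open>All function spaces consist of representatives \<open>R3 \<Rightarrow> R3\<close>, whose values off the
  relevant set are irrelevant, and not of classes modulo null sets. The exponent 3 in the
  Gagliardo seminorm is \<open>d + 2 s\<close> with \<open>d = 2\<close>, \<open>s = 1/2\<close>.\<close>

definition H12_norm_sq :: "R3 set \<Rightarrow> (R3 \<Rightarrow> R3) \<Rightarrow> ennreal" where
  "H12_norm_sq G f =
     (\<integral>\<^sup>+x. ennreal ((norm (f x))\<^sup>2) \<partial>surface_measure (frontier G)) +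
     (\<integral>\<^sup>+x. (\<integral>\<^sup>+y. ennreal ((norm (f x - f y))\<^sup>2 / (dist x y) ^ 3)
        \<partial>surface_measure (frontier G)) \<partial>surface_measure (frontier G))"

definition H12 :: "R3 set \<Rightarrow> (R3 \<Rightarrow> R3) set" where
  "H12 G = {f \<in> borel_measurable (surface_measure (frontier G)). H12_norm_sq G f < \<infinity>}"

definition H12_norm :: "R3 set \<Rightarrow> (R3 \<Rightarrow> R3) \<Rightarrow> real" where
  "H12_norm G f = sqrt (enn2real (H12_norm_sq G f))"

definition H12_sphere :: "R3 set \<Rightarrow> (R3 \<Rightarrow> R3) set" where
  "H12_sphere G = {f \<in> H12 G. AE x in surface_measure (frontier G). norm (f x) = 1}"

definition H12_dual :: "R3 set \<Rightarrow> ((R3 \<Rightarrow> R3) \<Rightarrow> real) set" where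
  "H12_dual G = {\<Phi>.
     (\<forall>f\<in>H12 G. \<forall>g\<in>H12 G. \<forall>a b. \<Phi> (\<lambda>x. a *\<^sub>R f x + b *\<^sub>R g x) = a * \<Phi> f + b * \<Phi> g) \<and>
     (\<exists>C. \<forall>f\<in>H12 G. \<bar>\<Phi> f\<bar> \<le> C * H12_norm G f)}"

definition H12_weak_conv :: "R3 set \<Rightarrow> (nat \<Rightarrow> R3 \<Rightarrow> R3) \<Rightarrow> (R3 \<Rightarrow> R3) \<Rightarrow> bool" where
  "H12_weak_conv G f g \<longleftrightarrow> (\<forall>\<Phi>\<in>H12_dual G. (\<lambda>k. \<Phi> (f k)) \<longlonglongrightarrow> \<Phi> g)"

text \<open>Applied to constant sequences, this also says that \<open>F\<close> takes the same value on
  representatives that agree almost everywhere on \<open>\<partial>G\<close>, that is, \<open>F\<close> is a function on classes.\<close>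

definition weakly_lsc :: "R3 set \<Rightarrow> ((R3 \<Rightarrow> R3) \<Rightarrow> ennreal) \<Rightarrow> bool" where
  "weakly_lsc G F \<longleftrightarrow> (\<forall>f g. (\<forall>k. f k \<in> H12_sphere G) \<and> g \<in> H12_sphere G \<and> H12_weak_conv G f g
     \<longrightarrow> F g \<le> liminf (\<lambda>k. F (f k)))"


section \<open>Sobolev maps on the exterior domain\<close>

definition has_weak_gradient :: "R3 set \<Rightarrow> (R3 \<Rightarrow> R3) \<Rightarrow> (R3 \<Rightarrow> real ^ 3 ^ 3) \<Rightarrow> bool" where
  "has_weak_gradient U n D \<longleftrightarrow> (\<forall>\<phi>\<in>test_functions U. \<forall>i.
     (\<integral>x. partial i \<phi> x *\<^sub>R n x \<partial>lebesgue_on U) = - (\<integral>x. \<phi> x *\<^sub>R column i (D x) \<partial>lebesgue_on U))"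

text \<open>\<open>H1_loc G n D\<close>: \<open>n\<close> is in $H^1_{loc}(\mathbb{R}^3\setminus G)$ with weak Jacobian
  \<open>D\<close> (unique up to null sets). The complement of \<open>G\<close> is closed, so integrability on its bounded
  subsets includes integrability up to \<open>\<partial>G\<close>.\<close>

definition H1_loc :: "R3 set \<Rightarrow> (R3 \<Rightarrow> R3) \<Rightarrow> (R3 \<Rightarrow> real ^ 3 ^ 3) \<Rightarrow> bool" where
  "H1_loc G n D \<longleftrightarrow>
     n \<in> borel_measurable (lebesgue_on (- G)) \<and> D \<in> borel_measurable (lebesgue_on (- G)) \<and>
     (\<forall>r. (\<integral>\<^sup>+x. ennreal ((norm (n x))\<^sup>2 + (norm (D x))\<^sup>2) \<partial>lebesgue_on (- G \<inter> ball 0 r)) < \<infinity>) \<and>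
     has_weak_gradient (interior (- G)) n D"

definition H1_loc_sphere :: "R3 set \<Rightarrow> (R3 \<Rightarrow> R3) \<Rightarrow> (R3 \<Rightarrow> real ^ 3 ^ 3) \<Rightarrow> bool" where
  "H1_loc_sphere G n D \<longleftrightarrow> H1_loc G n D \<and> (AE x in lebesgue_on (- G). norm (n x) = 1)"

text \<open>The trace operator is the continuous extension of the restriction \<open>u \<mapsto> u|\<^sub>\<partial>\<^sub>G\<close> from smooth
  maps. The trace \<open>g\<close> is unique up to null sets.\<close>

definition has_trace :: "R3 set \<Rightarrow> (R3 \<Rightarrow> R3) \<Rightarrow> (R3 \<Rightarrow> R3) \<Rightarrow> bool" where
  "has_trace G n g \<longleftrightarrow> g \<in> H12 G \<and>
     (\<exists>D. H1_loc G n D \<and>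
       (\<exists>u :: nat \<Rightarrow> R3 \<Rightarrow> R3. (\<forall>k. smooth_on (u k) UNIV) \<and>
         (\<forall>r. (\<lambda>k. \<integral>\<^sup>+x. ennreal ((norm (u k x - n x))\<^sup>2 + (norm (jacobian (u k) (at x) - D x))\<^sup>2)
               \<partial>lebesgue_on (- G \<inter> ball 0 r)) \<longlonglongrightarrow> 0) \<and>
         (\<lambda>k. \<integral>\<^sup>+x. ennreal ((norm (u k x - g x))\<^sup>2) \<partial>surface_measure (frontier G)) \<longlonglongrightarrow> 0))"


section \<open>Energy, minimizers and symmetry\<close>

definition admissible :: "R3 set \<Rightarrow> R3 \<Rightarrow> (R3 \<Rightarrow> R3) \<Rightarrow> bool" where
  "admissible G n0 n \<longleftrightarrow> (\<exists>D. H1_loc_sphere G n D \<and>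
     (\<integral>\<^sup>+x. ennreal ((norm (n x - n0))\<^sup>2 / (1 + (norm x)\<^sup>2)) \<partial>lebesgue_on (- G)) +
     (\<integral>\<^sup>+x. ennreal ((norm (D x))\<^sup>2) \<partial>lebesgue_on (- G)) < \<infinity>)"

text \<open>\<open>E(n) = e\<close>. This is a relation since the weak gradient and the trace are determined only up to
  null sets; \<open>e\<close> is unique. The norm on matrices is the Frobenius norm.\<close>

definition has_energy :: "R3 set \<Rightarrow> ((R3 \<Rightarrow> R3) \<Rightarrow> ennreal) \<Rightarrow> (R3 \<Rightarrow> R3) \<Rightarrow> ennreal \<Rightarrow> bool" where
  "has_energy G F n e \<longleftrightarrow> (\<exists>D g. H1_loc_sphere G n D \<and> has_trace G n g \<and> g \<in> H12_sphere G \<and>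
     e = (\<integral>\<^sup>+x. ennreal ((norm (D x))\<^sup>2) \<partial>lebesgue_on (- G)) + F g)"

definition Ehat :: "R3 set \<Rightarrow> ((R3 \<Rightarrow> R3) \<Rightarrow> ennreal) \<Rightarrow> R3 \<Rightarrow> real" where
  "Ehat G F n0 = enn2real (Inf {e. \<exists>n. admissible G n0 n \<and> has_energy G F n e})"

text \<open>If the infimum above were infinite, \<open>Ehat\<close> would be 0 and there would be no minimizer.\<close>

definition is_minimizer :: "R3 set \<Rightarrow> ((R3 \<Rightarrow> R3) \<Rightarrow> ennreal) \<Rightarrow> R3 \<Rightarrow> (R3 \<Rightarrow> R3) \<Rightarrow> bool" where
  "is_minimizer G F n0 n \<longleftrightarrow> admissible G n0 n \<and> has_energy G F n (ennreal (Ehat G F n0))"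

text \<open>\<open>v0 = lim r (n - n0)\<close> as \<open>r = |x| \<rightarrow> \<infinity>\<close>, as an essential limit: since \<open>n\<close> is only
  defined up to null sets, an exceptional null set of points \<open>x\<close> is disregarded. For a continuous
  representative near infinity this is the ordinary limit.\<close>

definition has_far_field :: "(R3 \<Rightarrow> R3) \<Rightarrow> R3 \<Rightarrow> R3 \<Rightarrow> bool" where
  "has_far_field n n0 v0 \<longleftrightarrow>
     ((\<lambda>x. norm x *\<^sub>R (n x - n0)) \<longlongrightarrow> v0) (inf at_infinity (ae_filter lebesgue))"

definition Sym :: "R3 set \<Rightarrow> ((R3 \<Rightarrow> R3) \<Rightarrow> ennreal) \<Rightarrow> (real ^ 3 ^ 3) set" where
  "Sym G F = {R. orthogonal_matrix R \<and> (\<lambda>x. R *v x) ` G = G \<and>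
     (\<forall>n\<in>H12_sphere G. F (\<lambda>x. R *v n (matrix_inv R *v x)) = F n)}"

definition SO3 :: "(real ^ 3 ^ 3) set" where
  "SO3 = {R. rotation_matrix R}"

definition SO3_axis :: "R3 \<Rightarrow> (real ^ 3 ^ 3) set" where
  "SO3_axis u = {R \<in> SO3. R *v u = u}"

end

theory Submission
  imports Defs
begin

text \<open>
  Let \<open>n\<close> be a minimizer for \<open>n0\<close> with far field \<open>v0\<close>, let \<open>a\<close> be a unit vector and let
  \<open>\<phi>\<close> be a smooth cutoff that is 0 on the particle and 1 far away. Rotating \<open>n x\<close> about \<open>a\<close> by
  the angle \<open>t * \<phi> x\<close> leaves the trace unchanged and gives a competitor for \<open>rot a t n0\<close>, whose
  Dirichlet energy is exactly a quadratic polynomial in \<open>t\<close>. Its linear coefficient is \<open>2 L\<close>, where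
  \<open>L\<close> is the integral of \<open>\<nabla>\<phi>\<close> against the torque density \<open>\<nabla>n \<bullet> (a \<times> n)\<close>. Hence \<open>L = 0\<close> for every
  cutoff as soon as the energy \<open>Ehat\<close> is stationary along \<open>t \<mapsto> rot a t n0\<close> at \<open>t = 0\<close>.

  On the other hand, for cutoffs living at scale \<open>R\<close> one may replace \<open>a \<times> n\<close> by \<open>a \<times> n0\<close>, integrate
  by parts and insert \<open>n - n0 \<approx> v0 / r\<close>. In the limit \<open>R \<rightarrow> \<infinity>\<close> this gives \<open>L = - K (v0 \<bullet> (a \<times> n0))\<close>, where
  \<open>K\<close> is the integral of \<open>\<Delta>\<phi> / r\<close>, or equivalently that of \<open>x \<bullet> \<nabla>\<phi> / r\<^sup>3\<close>, so \<open>K > 0\<close> for a radially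
  increasing cutoff. Thus \<open>v0 \<bullet> (a \<times> n0) = 0\<close> without any regularity theory for harmonic maps.

  A symmetry \<open>R\<close> of the particle maps competitors for \<open>n0\<close> to competitors for \<open>R n0\<close> of equal
  energy, so that \<open>Ehat\<close> is constant along the orbits of the rotations that are symmetries. At the
  axis \<open>u\<close> itself, rotating by \<open>\<pi>\<close> about \<open>u\<close> shows that \<open>Ehat\<close> is even along great circles through
  \<open>u\<close>, hence stationary at \<open>u\<close> if it is differentiable there.
\<close>

section \<open>Rotations about an axis\<close>

text \<open>\<open>rot\<close> is Rodrigues' formula for the rotation by the angle t about a unit
  vector a. For a variable angle it combines linear images of the map with smooth coefficients, so
  it acts on Sobolev maps through the product rule. Rotations about a commute with the cross product
  by a, hence the rotation factors out of the whole gradient and drops out of its norm; this is why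
  the energy is a polynomial in t without remainder. A competitor bounds \<open>Ehat\<close> only
  from above. The first variation vanishes because both signs of t are used, and for this
  \<open>Ehat\<close> has to be stationary along the curve from both sides. The far field controls n
  - n0 but gives no decay rate for the gradient, which is merely square integrable. This is enough:
  the main term, the Laplacian of the cutoff integrated against 1/r, does not depend on the scale R,
  whereas replacing a x n by a x n0 costs only the order of R to the power -1/2. Here the gradient
  of the cutoff and n - n0 contribute 1/R each, and the volume contributes R to the power 3/2 by
  Cauchy-Schwarz.\<close>

definition rot :: "R3 \<Rightarrow> real \<Rightarrow> R3 \<Rightarrow> R3" where
  "rot a t x = x + sin t *\<^sub>R cross3 a x + (1 - cos t) *\<^sub>R cross3 a (cross3 a x)"

lemma cross3_add_scaleR: "cross3 a (x + c *\<^sub>R y) = cross3 a x + c *\<^sub>R cross3 a y"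
  by (simp add: cross_add_right cross_mult_right)

lemma linear_cross3: "linear (cross3 a)"
  by (rule linearI) (simp_all add: cross_add_right cross_mult_right)

lemma linear_rot: "linear (rot a t)"
  unfolding rot_def by (rule linearI) (simp_all add: cross_add_right cross_mult_right algebra_simps)

text \<open>Crossing with \<open>a\<close> kills \<open>a\<close> and is a quarter turn on the
  orthogonal plane, so its square is -1 there. Every polynomial in this operator therefore reduces
  to degree two, and composing rotations becomes the addition formulas for sine and cosine.\<close>

lemma cross3_cube:
  assumes "norm a = 1"
  shows "cross3 a (cross3 a (cross3 a x)) = - cross3 a x"
proof -
  have "a \<bullet> a = 1" using assms by (simp add: dot_square_norm)
  then have "cross3 a (cross3 a y) = (a \<bullet> y) *\<^sub>R a - y" for y
    by (simp add: Lagrange)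
  from this[of "cross3 a x"] show ?thesis by (simp add: dot_cross_self)
qed

lemma rot_add:
  assumes "norm a = 1"
  shows "rot a s (rot a t x) = rot a (s + t) x"
proof -
  have "cross3 a (rot a t x) = cos t *\<^sub>R cross3 a x + sin t *\<^sub>R cross3 a (cross3 a x)" for t x
    using cross3_cube[OF assms]
    by (simp add: rot_def cross_add_right cross_mult_right Cross3.right_diff_distrib algebra_simps)
  then have "rot a s (rot a t x) = rot a t x
     + sin s *\<^sub>R (cos t *\<^sub>R cross3 a x + sin t *\<^sub>R cross3 a (cross3 a x))
     + (1 - cos s) *\<^sub>R (cos t *\<^sub>R cross3 a (cross3 a x) + sin t *\<^sub>R - cross3 a x)"
    using cross3_cube[OF assms] by (simp add: rot_def[of a s] cross3_add_scaleR cross_mult_right)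
  then show ?thesis by (simp add: rot_def sin_add cos_add algebra_simps)
qed

lemma cross3_rot:
  assumes "norm a = 1"
  shows "cross3 a (rot a t x) = cos t *\<^sub>R cross3 a x + sin t *\<^sub>R cross3 a (cross3 a x)"
    and "rot a t (cross3 a x) = cos t *\<^sub>R cross3 a x + sin t *\<^sub>R cross3 a (cross3 a x)"
    using cross3_cube[OF assms]
    by (simp_all add: rot_def cross_add_right cross_mult_right Cross3.right_diff_distrib algebra_simps)

lemma rot_0 [simp]: "rot a 0 x = x" by (simp add: rot_def)

lemma rot_self [simp]: "rot a t a = a" by (simp add: rot_def)

lemma norm_rot [simp]:
  assumes "norm a = 1"
  shows "norm (rot a t x) = norm x"
proof -
  define b c where "b = cross3 a x" and "c = cross3 a b"
  have s: "x \<bullet> cross3 a (cross3 a y) = - (cross3 a x \<bullet> cross3 a y)" for x y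
    by (simp add: cross3_simps)
  \<comment> \<open>In the plane orthogonal to \<open>a\<close> the vectors \<open>b\<close> and
    \<open>c\<close> are orthogonal and of equal length, and \<open>c\<close> is minus the
    projection of \<open>x\<close>. All mixed inner products thus reduce to
    \<open>b \<bullet> b\<close>.\<close>
  have p: "x \<bullet> b = 0" "b \<bullet> c = 0" by (simp_all add: b_def c_def dot_cross_self)
  have q: "x \<bullet> c = - (b \<bullet> b)" by (simp add: b_def c_def s)
  have r: "c \<bullet> c = b \<bullet> b"
    using s[of b b] cross3_cube[OF assms, of x] by (simp add: b_def c_def)
  have e: "cos t * (cos t * z) + sin t * (sin t * z) = z" for z
  proof -
    have "cos t * (cos t * z) + sin t * (sin t * z) = ((sin t)\<^sup>2 + (cos t)\<^sup>2) * z"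
      by (simp only: power2_eq_square algebra_simps)
    then show ?thesis by simp
  qed
  have "rot a t x \<bullet> rot a t x = x \<bullet> x + ((sin t)\<^sup>2 + (1 - cos t)\<^sup>2 - 2 * (1 - cos t)) * (b \<bullet> b)"
    unfolding rot_def b_def[symmetric] c_def[symmetric]
    using p q r e[of "b \<bullet> b"]
    by (simp add: inner_add_left inner_add_right inner_commute power2_eq_square algebra_simps)
  also have "(sin t)\<^sup>2 + (1 - cos t)\<^sup>2 - 2 * (1 - cos t) = 0"
    using sin_cos_squared_add[of t] by (simp add: power2_eq_square algebra_simps)
  finally show ?thesis by (simp add: norm_eq_sqrt_inner)
qed

lemma rot_perp:
  assumes "norm a = 1" "a \<bullet> x = 0"
  shows "rot a t x = cos t *\<^sub>R x + sin t *\<^sub>R cross3 a x"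
proof -
  have "a \<bullet> a = 1" using assms by (simp add: dot_square_norm)
  then have "cross3 a (cross3 a x) = - x" using assms by (simp add: Lagrange)
  then show ?thesis by (simp add: rot_def algebra_simps)
qed

lemma orthogonal_matrix_rot:
  assumes "norm a = 1"
  shows "orthogonal_matrix (matrix (rot a t))"
  using assms linear_rot[of a t] orthogonal_transformation_matrix[of "rot a t"]
  by (simp add: orthogonal_transformation)

lemma matrix_rot_mult [simp]: "matrix (rot a t) *v x = rot a t x"
  by (simp add: linear_rot matrix_works)

lemma matrix_rot_in_SO3_axis:
  assumes "norm a = 1"
  shows "matrix (rot a t) \<in> SO3_axis a"
proof -
  \<comment> \<open>Halving the angle exhibits the determinant as the square of a number in {1,
    -1}.\<close>
  have "rot a t = rot a (t/2) \<circ> rot a (t/2)" by (auto simp: rot_add[OF assms])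
  then have "matrix (rot a t) = matrix (rot a (t/2)) ** matrix (rot a (t/2))"
    by (metis linear_rot matrix_compose)
  then have "det (matrix (rot a t)) = det (matrix (rot a (t/2))) * det (matrix (rot a (t/2)))"
    by (simp add: det_mul)
  moreover have "det (matrix (rot a (t/2))) \<in> {1,-1}"
    using det_orthogonal_matrix orthogonal_matrix_rot[OF assms] by blast
  ultimately have "det (matrix (rot a t)) = 1" by auto
  then show ?thesis using orthogonal_matrix_rot[OF assms]
    by (simp add: SO3_axis_def SO3_def rotation_matrix_def)
qed

section \<open>Calculus of smooth functions\<close>

lemma Ck_on_Suc_UNIV:
  "Ck_on (Suc k) f UNIV \<longleftrightarrow> (\<forall>x. f differentiable (at x)) \<and> (\<forall>i. Ck_on k (partial i f) UNIV)"
  by (simp add: Ck_on.simps differentiable_on_def)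

declare Ck_on.simps(2) [simp del]

lemma Ck_on_mono: "Ck_on (Suc k) f UNIV \<Longrightarrow> Ck_on k f UNIV"
proof (induction k arbitrary: f)
  case 0
  then show ?case
    by (simp add: Ck_on_Suc_UNIV continuous_on_eq_continuous_at differentiable_imp_continuous_within)
next
  case (Suc k)
  then show ?case by (simp add: Ck_on_Suc_UNIV[of "Suc k"] Ck_on_Suc_UNIV[of k])
qed

lemma partial_has_derivative: "(f has_derivative f') (at x) \<Longrightarrow> partial i f x = f' (axis i 1)"
  unfolding partial_def by (metis frechet_derivative_at)

lemma differentiable_has_derivative: 
  "f differentiable (at x) \<Longrightarrow> (f has_derivative frechet_derivative f (at x)) (at x)"
  by (simp add: frechet_derivative_works)

lemma partial_const [simp]: "partial i (\<lambda>x. c) = (\<lambda>x. 0)"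
  by (rule ext) (simp add: partial_has_derivative[where f'="\<lambda>_. 0"])

lemma Ck_on_const: "Ck_on k (\<lambda>x. c) UNIV"
  by (induction k arbitrary: c) (simp_all add: Ck_on_Suc_UNIV)

lemma partial_linear:
  assumes "bounded_linear L" "f differentiable (at x)"
  shows "partial i (\<lambda>x. L (f x)) x = L (partial i f x)"
proof -
  have "((\<lambda>x. L (f x)) has_derivative (\<lambda>h. L (frechet_derivative f (at x) h))) (at x)"
    using bounded_linear.has_derivative[OF assms(1)] differentiable_has_derivative[OF assms(2)] by blast
  then show ?thesis by (simp add: partial_def partial_has_derivative[unfolded partial_def])
qed

lemma Ck_on_linear:
  assumes "bounded_linear L"
  shows "Ck_on k f UNIV \<Longrightarrow> Ck_on k (\<lambda>x. L (f x)) UNIV"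
proof (induction k arbitrary: f)
  case 0
  then show ?case using bounded_linear.continuous_on[OF assms] by auto
next
  case (Suc k)
  then have d: "f differentiable (at x)" for x by (simp add: Ck_on_Suc_UNIV)
  have "partial i (\<lambda>x. L (f x)) = (\<lambda>x. L (partial i f x))" for i
    by (rule ext) (rule partial_linear[OF assms d])
  moreover have "(\<lambda>x. L (f x)) differentiable (at x)" for x
    using bounded_linear.has_derivative[OF assms differentiable_has_derivative[OF d]]
    unfolding differentiable_def by blast
  ultimately show ?case using Suc by (simp add: Ck_on_Suc_UNIV)
qed

lemma partial_add:
  assumes "f differentiable (at x)" "g differentiable (at x)"
  shows "partial i (\<lambda>x. f x + g x) x = partial i f x + partial i g x"
  using partial_has_derivative[OF has_derivative_add[OF assms[THEN differentiable_has_derivative]]]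
  by (simp add: partial_def)

lemma Ck_on_add:
  "Ck_on k f UNIV \<Longrightarrow> Ck_on k g UNIV \<Longrightarrow> Ck_on k (\<lambda>x. f x + g x) UNIV"
proof (induction k arbitrary: f g)
  case 0
  then show ?case by (auto intro: continuous_intros)
next
  case (Suc k)
  then have d: "f differentiable (at x)" "g differentiable (at x)" for x by (simp_all add: Ck_on_Suc_UNIV)
  have "partial i (\<lambda>x. f x + g x) = (\<lambda>x. partial i f x + partial i g x)" for i
    by (rule ext) (rule partial_add[OF d])
  then show ?case using Suc d by (simp add: Ck_on_Suc_UNIV)
qed

lemma partial_bilinear:
  assumes "bounded_bilinear B" "f differentiable (at x)" "g differentiable (at x)"
  shows "partial i (\<lambda>x. B (f x) (g x)) x = B (f x) (partial i g x) + B (partial i f x) (g x)"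
  using partial_has_derivative[OF bounded_bilinear.FDERIV[OF assms(1)
      assms(2,3)[THEN differentiable_has_derivative]]]
  by (simp add: partial_def)

lemma Ck_on_bilinear:
  assumes "bounded_bilinear B"
  shows "Ck_on k f UNIV \<Longrightarrow> Ck_on k g UNIV \<Longrightarrow> Ck_on k (\<lambda>x. B (f x) (g x)) UNIV"
proof (induction k arbitrary: f g)
  case 0
  then show ?case using bounded_bilinear.continuous_on[OF assms] by auto
next
  case (Suc k)
  then have d: "f differentiable (at x)" "g differentiable (at x)" for x by (simp_all add: Ck_on_Suc_UNIV)
  have e: "partial i (\<lambda>x. B (f x) (g x)) = (\<lambda>x. B (f x) (partial i g x) + B (partial i f x) (g x))" for i
    by (rule ext) (rule partial_bilinear[OF assms d])
  have "(\<lambda>x. B (f x) (g x)) differentiable (at x)" for x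
    using bounded_bilinear.FDERIV[OF assms d[THEN differentiable_has_derivative]]
    unfolding differentiable_def by blast
  \<comment> \<open>Each term of the product rule leaves one factor undifferentiated;
    \<open>Ck_on_mono\<close> lowers its order to the one of the induction hypothesis.\<close>
  moreover have "Ck_on k (partial i (\<lambda>x. B (f x) (g x))) UNIV" for i
    unfolding e using Suc.prems Suc.prems[THEN Ck_on_mono]
    by (intro Ck_on_add Suc.IH) (auto simp: Ck_on_Suc_UNIV)
  ultimately show ?case by (simp add: Ck_on_Suc_UNIV)
qed

lemma partial_compose_real:
  assumes "(h has_real_derivative h') (at (f x))" "f differentiable (at x)"
  shows "partial i (\<lambda>x. h (f x)) x = h' * partial i f x"
    and "(\<lambda>x. h (f x)) differentiable (at x)"
proof -
  have "((\<lambda>x. h (f x)) has_derivative (\<lambda>v. h' * frechet_derivative f (at x) v)) (at x)"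
    using has_derivative_compose[OF differentiable_has_derivative[OF assms(2)]
        assms(1)[unfolded has_field_derivative_def]] by (simp add: mult.commute)
  from partial_has_derivative[OF this, of i] this
  show "partial i (\<lambda>x. h (f x)) x = h' * partial i f x"
    "(\<lambda>x. h (f x)) differentiable (at x)"
    by (simp add: partial_def, auto simp: differentiable_def)
qed

text \<open>The outer function comes with the whole sequence \<open>hs\<close> of its derivatives:
  differentiating \<open>hs j\<close> after \<open>f\<close> produces \<open>hs (Suc j)\<close>, so
  the induction has to run for all \<open>j\<close> at once. The set \<open>S\<close> admits
  functions that are smooth only on part of the line, such as the reciprocal.\<close>

lemma Ck_on_compose_real:
  fixes f :: "R3 \<Rightarrow> real"
  assumes "\<And>k y. y \<in> S \<Longrightarrow> (hs k has_real_derivative hs (Suc k) y) (at y)" "\<And>x. f x \<in> S"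
  shows "Ck_on k f UNIV \<Longrightarrow> Ck_on k (\<lambda>x. hs j (f x)) UNIV"
proof (induction k arbitrary: j)
  case 0
  then have f: "continuous (at x) f" for x by (simp add: continuous_on_eq_continuous_at)
  have "continuous (at x) (\<lambda>x. hs j (f x))" for x
    using f assms by (metis DERIV_isCont isCont_o2)
  then show ?case by (simp add: continuous_on_eq_continuous_at)
next
  case (Suc k)
  then have d: "f differentiable (at x)" for x by (simp add: Ck_on_Suc_UNIV)
  have e: "partial i (\<lambda>x. hs j (f x)) = (\<lambda>x. hs (Suc j) (f x) * partial i f x)" for i
    by (rule ext) (rule partial_compose_real[where h="hs j", OF assms(1)[OF assms(2)] d])
  have "Ck_on k (partial i (\<lambda>x. hs j (f x))) UNIV" for i
    unfolding e using Suc.prems Suc.prems[THEN Ck_on_mono]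
    by (intro Ck_on_bilinear[OF bounded_bilinear_mult] Suc.IH) (auto simp: Ck_on_Suc_UNIV)
  then show ?case using partial_compose_real(2)[where h="hs j", OF assms(1)[OF assms(2)] d]
    by (simp add: Ck_on_Suc_UNIV)
qed

lemma partial_compose_linear:
  assumes "bounded_linear L" "f differentiable (at (L x))"
  shows "partial i (\<lambda>x. f (L x)) x = (\<Sum>j\<in>UNIV. (L (axis i 1) $ j) *\<^sub>R partial j f (L x))"
   and "(\<lambda>x. f (L x)) differentiable (at x)"
proof -
  interpret D: bounded_linear "frechet_derivative f (at (L x))"
    using assms(2) differentiable_has_derivative has_derivative_bounded_linear by blast
  have h: "((\<lambda>x. f (L x)) has_derivative (\<lambda>v. frechet_derivative f (at (L x)) (L v))) (at x)"
    using has_derivative_compose[OF bounded_linear.has_derivative[OF assms(1) has_derivative_ident]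
        differentiable_has_derivative[OF assms(2)]] .
  have linear_sum_aux: "frechet_derivative f (at (L x)) (\<Sum>j\<in>UNIV. v j *\<^sub>R axis j 1)
      = (\<Sum>j\<in>UNIV. v j *\<^sub>R frechet_derivative f (at (L x)) (axis j 1))" for v :: "3 \<Rightarrow> real"
    by (simp add: D.sum D.scaleR)
  have "L (axis i 1) = (\<Sum>j\<in>UNIV. (L (axis i 1) $ j) *\<^sub>R axis j 1)"
    using basis_expansion[of "L (axis i 1)"] by (simp add: scalar_mult_eq_scaleR)
  then have "frechet_derivative f (at (L x)) (L (axis i 1)) =
     (\<Sum>j\<in>UNIV. (L (axis i 1) $ j) *\<^sub>R frechet_derivative f (at (L x)) (axis j 1))"
    by (metis (no_types) linear_sum_aux)
  with h show "partial i (\<lambda>x. f (L x)) x = (\<Sum>j\<in>UNIV. (L (axis i 1) $ j) *\<^sub>R partial j f (L x))"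
   "(\<lambda>x. f (L x)) differentiable (at x)"
    using partial_has_derivative[OF h, of i] by (simp add: partial_def, auto simp: differentiable_def)
qed

lemma Ck_on_sum:
  "finite I \<Longrightarrow> (\<And>i. i \<in> I \<Longrightarrow> Ck_on k (f i) UNIV) \<Longrightarrow> Ck_on k (\<lambda>x. \<Sum>i\<in>I. f i x) UNIV"
  by (induction I rule: finite_induct) (auto intro: Ck_on_add Ck_on_const)

lemma Ck_on_compose_linear:
  assumes "bounded_linear L"
  shows "Ck_on k f UNIV \<Longrightarrow> Ck_on k (\<lambda>x. f (L x)) UNIV"
proof (induction k arbitrary: f)
  case 0
  then show ?case using assms
    by (auto intro: continuous_on_compose2 linear_continuous_on)
next
  case (Suc k)
  then have d: "f differentiable (at x)" for x by (simp add: Ck_on_Suc_UNIV)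
  have e: "partial i (\<lambda>x. f (L x)) = (\<lambda>x. \<Sum>j\<in>UNIV. (L (axis i 1) $ j) *\<^sub>R partial j f (L x))" for i
    by (rule ext) (rule partial_compose_linear[OF assms d])
  have "Ck_on k (partial i (\<lambda>x. f (L x))) UNIV" for i
    unfolding e using Suc.prems
    by (intro Ck_on_sum Ck_on_linear[OF bounded_linear_scaleR_right] Suc.IH) (auto simp: Ck_on_Suc_UNIV)
  then show ?case using partial_compose_linear(2)[OF assms d] by (simp add: Ck_on_Suc_UNIV)
qed

abbreviation smooth :: "(R3 \<Rightarrow> 'b::real_normed_vector) \<Rightarrow> bool" where
  "smooth f \<equiv> smooth_on f UNIV"

lemma smooth_const: "smooth (\<lambda>x. c)"
  and smooth_linear: "bounded_linear L \<Longrightarrow> smooth f \<Longrightarrow> smooth (\<lambda>x. L (f x))"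
  and smooth_add: "smooth f \<Longrightarrow> smooth g \<Longrightarrow> smooth (\<lambda>x. f x + g x)"
  and smooth_bilinear: "bounded_bilinear B \<Longrightarrow> smooth p \<Longrightarrow> smooth q \<Longrightarrow> smooth (\<lambda>x. B (p x) (q x))"
  and smooth_compose_linear: "bounded_linear M \<Longrightarrow> smooth f \<Longrightarrow> smooth (\<lambda>x. f (M x))"
  by (auto simp: smooth_on_def Ck_on_const Ck_on_linear Ck_on_add Ck_on_bilinear Ck_on_compose_linear)

lemma smooth_compose_real:
  fixes f :: "R3 \<Rightarrow> real"
  assumes "\<And>k y. y \<in> S \<Longrightarrow> (hs k has_real_derivative hs (Suc k) y) (at y)" "\<And>x. f x \<in> S" "smooth f"
  shows "smooth (\<lambda>x. hs 0 (f x))"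
  using Ck_on_compose_real[of S hs f] assms by (auto simp: smooth_on_def)

lemma smooth_partial: "smooth f \<Longrightarrow> smooth (partial i f)"
  using Ck_on_Suc_UNIV[of _ f] by (simp add: smooth_on_def)

lemma smooth_differentiable: "smooth f \<Longrightarrow> f differentiable (at x)"
  using Ck_on_Suc_UNIV[of 0 f] by (simp add: smooth_on_def)

lemma smooth_continuous_on: "smooth f \<Longrightarrow> continuous_on S f"
  using continuous_on_subset[of UNIV f S] by (auto simp: smooth_on_def dest: spec[of _ 0])

lemma smooth_id: "smooth (\<lambda>x. x)"
proof -
  have "partial i (\<lambda>x. x) = (\<lambda>x. axis i 1)" for i :: 3
    by (rule ext) (simp add: partial_has_derivative[OF has_derivative_ident])
  then have "Ck_on k (\<lambda>x::R3. x) UNIV" for k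
    by (cases k) (simp_all add: Ck_on_const Ck_on_Suc_UNIV)
  then show ?thesis by (simp add: smooth_on_def)
qed

lemma smooth_cos: "smooth f \<Longrightarrow> smooth (\<lambda>x. cos (f x))"
  and smooth_sin: "smooth f \<Longrightarrow> smooth (\<lambda>x. sin (f x))"
  for f :: "R3 \<Rightarrow> real"
proof -
  \<comment> \<open>Differentiating a sine shifts its argument by a quarter period. The offset
    \<open>m\<close> starts the sequence at sine for 0 and at cosine for 1.\<close>
  define hs :: "nat \<Rightarrow> nat \<Rightarrow> real \<Rightarrow> real" where "hs m k y = sin (y + real (k + m) * pi / 2)" for m k y
  have d: "(hs m k has_real_derivative hs m (Suc k) y) (at y)" for m k y
  proof -
    have "y + real (Suc k + m) * pi / 2 = (y + real (k + m) * pi / 2) + pi / 2"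
      by (simp add: field_simps)
    then have "hs m (Suc k) y = sin ((y + real (k + m) * pi / 2) + pi / 2)"
      by (simp only: hs_def)
    also have "\<dots> = cos (y + real (k + m) * pi / 2)"
      by (simp only: sin_add[of _ "pi / 2"] sin_pi_half cos_pi_half mult_zero_right mult_1_right add_0)
    finally have "hs m (Suc k) y = cos (y + real (k + m) * pi / 2)" .
    then show ?thesis unfolding hs_def by (auto intro!: derivative_eq_intros)
  qed
  have 0: "hs 0 0 = sin"
    by (simp add: hs_def fun_eq_iff)
  have 1: "hs 1 0 = cos"
    by (simp add: hs_def fun_eq_iff sin_add)
  show "smooth f \<Longrightarrow> smooth (\<lambda>x. cos (f x))" "smooth f \<Longrightarrow> smooth (\<lambda>x. sin (f x))"
    using smooth_compose_real[of UNIV "hs 1" f, OF d] smooth_compose_real[of UNIV "hs 0" f, OF d] 0 1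
    by simp_all
qed

lemma smooth_inverse:
  fixes f :: "R3 \<Rightarrow> real"
  assumes "\<And>x. f x > 0" "smooth f"
  shows "smooth (\<lambda>x. inverse (f x))"
proof -
  \<comment> \<open>Closed form of the k-th derivative of the reciprocal.\<close>
  define hs :: "nat \<Rightarrow> real \<Rightarrow> real" where "hs k y = (-1)^k * fact k * inverse y ^ Suc k" for k y
  have d: "(hs k has_real_derivative hs (Suc k) y) (at y)" if "y \<in> {0<..}" for k y
  proof -
    have "(hs k has_real_derivative (-1)^k * fact k * ((1 + real k) * (- (inverse y ^ Suc (Suc 0)) * inverse y ^ k))) (at y)"
      unfolding hs_def using that by (intro DERIV_cmult DERIV_power_Suc DERIV_inverse) auto
    then show ?thesis by (simp add: hs_def algebra_simps)
  qed
  have "smooth (\<lambda>x. hs 0 (f x))"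
    by (rule smooth_compose_real[where S="{0<..}"]) (use d assms in auto)
  then show ?thesis by (simp add: hs_def)
qed

section \<open>A smooth radial cutoff\<close>

text \<open>With y = 1/x, the derivative of p(y) exp(-y) with respect to x is y^2 (p(y) - p'(y))
  exp(-y), and \<open>[:0, 0, 1:]\<close> is y^2. So \<open>flat_deriv k\<close> is the k-th
  derivative of the classical flat function exp(-1/x), extended by 0 to the left half line.\<close>

definition flat_poly :: "nat \<Rightarrow> real poly" where
  "flat_poly k = ((\<lambda>p. [:0, 0, 1:] * (p - pderiv p)) ^^ k) 1"

definition flat_deriv :: "nat \<Rightarrow> real \<Rightarrow> real" where
  "flat_deriv k x = (if x > 0 then poly (flat_poly k) (inverse x) * exp (- inverse x) else 0)"

abbreviation flat :: "real \<Rightarrow> real" where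
  "flat \<equiv> flat_deriv 0"

lemma tendsto_poly_exp: "((\<lambda>y::real. poly p y * exp (- y)) \<longlongrightarrow> 0) at_top"
proof -
  have "((\<lambda>y. \<Sum>i\<le>degree p. coeff p i * (y ^ i / exp y)) \<longlongrightarrow> (\<Sum>i\<le>degree p. coeff p i * 0)) at_top"
    by (intro tendsto_sum tendsto_mult tendsto_const tendsto_power_div_exp_0)
  then show ?thesis
    by (simp add: poly_altdef sum_distrib_right exp_minus divide_inverse mult.assoc)
qed

lemma flat_deriv_DERIV: "(flat_deriv k has_real_derivative flat_deriv (Suc k) x) (at x)"
proof -
  consider "x < 0" | "x > 0" | "x = 0" by linarith
  then show ?thesis
  proof cases
    case 1
    have "((\<lambda>x. 0) has_real_derivative 0) (at x)" by simp
    then have "(flat_deriv k has_real_derivative 0) (at x)"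
      by (rule has_field_derivative_transform_within_open[where S="{..<0}"])
        (use 1 in \<open>auto simp: flat_deriv_def\<close>)
    then show ?thesis using 1 by (simp add: flat_deriv_def)
  next
    case 2
    let ?p = "flat_poly k"
    have "((\<lambda>x. poly ?p (inverse x) * exp (- inverse x)) has_real_derivative
       poly (flat_poly (Suc k)) (inverse x) * exp (- inverse x)) (at x)"
      using 2 by (auto intro!: derivative_eq_intros DERIV_chain2[OF poly_DERIV]
        simp: flat_poly_def algebra_simps)
    then have "(flat_deriv k has_real_derivative poly (flat_poly (Suc k)) (inverse x) * exp (- inverse x)) (at x)"
      by (rule has_field_derivative_transform_within_open[where S="{0<..}"])
        (use 2 in \<open>auto simp: flat_deriv_def\<close>)
    then show ?thesis using 2 by (simp add: flat_deriv_def)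
  next
    case 3
    have "((\<lambda>y. (flat_deriv k y - flat_deriv k 0) / (y - 0)) \<longlongrightarrow> 0) (at_left 0)"
      by (rule tendsto_eventually) (auto simp: flat_deriv_def eventually_at_filter)
    moreover have "((\<lambda>y. (flat_deriv k y - flat_deriv k 0) / (y - 0)) \<longlongrightarrow> 0) (at_right 0)"
    proof (rule Lim_transform_eventually)
      \<comment> \<open>Dividing by the increment multiplies the polynomial in its reciprocal by the
        variable, hence \<open>pCons 0\<close>. The exponential still wins, so all derivatives of
        the flat function vanish at 0.\<close>
      show "((\<lambda>y::real. poly (pCons 0 (flat_poly k)) (inverse y) * exp (- inverse y)) \<longlongrightarrow> 0) (at_right 0)"
        by (rule filterlim_compose[OF tendsto_poly_exp filterlim_inverse_at_top_right])
      show "\<forall>\<^sub>F y in at_right 0. poly (pCons 0 (flat_poly k)) (inverse y) * exp (- inverse y)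
         = (flat_deriv k y - flat_deriv k 0) / (y - 0)"
        by (auto simp: flat_deriv_def eventually_at_filter field_simps)
    qed
    ultimately have "((\<lambda>y. (flat_deriv k y - flat_deriv k 0) / (y - 0)) \<longlongrightarrow> 0) (at 0)"
      by (simp add: filterlim_split_at)
    then show ?thesis using 3 by (simp add: has_field_derivative_iff flat_deriv_def)
  qed
qed

lemma flat_nonneg: "flat x \<ge> 0"
  and flat_pos: "x > 0 \<Longrightarrow> flat x > 0"
  and flat_zero: "x \<le> 0 \<Longrightarrow> flat x = 0"
  and flat_deriv_1_nonneg: "flat_deriv (Suc 0) x \<ge> 0"
  and flat_deriv_1_pos: "x > 0 \<Longrightarrow> flat_deriv (Suc 0) x > 0"
  by (auto simp: flat_deriv_def flat_poly_def)

lemma smooth_flat: "smooth f \<Longrightarrow> smooth (\<lambda>x. flat (f x))"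
  using smooth_compose_real[of UNIV flat_deriv f] flat_deriv_DERIV by auto

text \<open>Rises from 0 for arguments up to 1 to 1 for arguments from 4 on. These are the squares
  of the radii 1 and 2: \<open>cutoff\<close> inserts \<open>x \<bullet> x\<close>, which is smooth
  at the origin, unlike the norm.\<close>

definition step :: "real \<Rightarrow> real" where
  "step s = flat (s - 1) * inverse (flat (s - 1) + flat (4 - s))"

definition step_deriv :: "real \<Rightarrow> real" where
  "step_deriv s = (flat_deriv (Suc 0) (s - 1) * flat (4 - s) + flat (s - 1) * flat_deriv (Suc 0) (4 - s))
      / (flat (s - 1) + flat (4 - s))\<^sup>2"

definition cutoff :: "R3 \<Rightarrow> real" where
  "cutoff x = step (x \<bullet> x)"

lemma flat_sum_pos: "flat (s - 1) + flat (4 - s) > 0"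
  by (cases "s > 1") (simp_all add: add_pos_nonneg add_nonneg_pos flat_nonneg flat_pos)

lemma step_DERIV: "(step has_real_derivative step_deriv s) (at s)"
proof -
  have "((\<lambda>s. flat (s - 1)) has_real_derivative flat_deriv (Suc 0) (s - 1) * 1) (at s)"
    by (rule DERIV_chain2[OF flat_deriv_DERIV]) (auto intro!: derivative_eq_intros)
  moreover have "((\<lambda>s. flat (4 - s)) has_real_derivative flat_deriv (Suc 0) (4 - s) * (-1)) (at s)"
    by (rule DERIV_chain2[OF flat_deriv_DERIV]) (auto intro!: derivative_eq_intros)
  ultimately have "((\<lambda>s. flat (s - 1) / (flat (s - 1) + flat (4 - s))) has_real_derivative step_deriv s) (at s)"
    using flat_sum_pos[of s] 
    by (auto intro!: derivative_eq_intros simp: step_deriv_def field_simps power2_eq_square)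
  then show ?thesis unfolding step_def divide_inverse by (simp add: step_def[abs_def])
qed

lemma step_deriv_nonneg: "step_deriv s \<ge> 0"
  by (simp add: step_deriv_def flat_nonneg flat_deriv_1_nonneg)

text \<open>One point of strict increase makes the moment of the cutoff strictly positive; any
  argument strictly between 1 and 4 would serve.\<close>

lemma step_deriv_2_pos: "step_deriv 2 > 0"
  using flat_sum_pos[of 2]
  by (auto simp: step_deriv_def intro!: divide_pos_pos add_pos_pos mult_pos_pos flat_pos flat_deriv_1_pos)

lemma smooth_cutoff: "smooth cutoff"
proof -
  have q: "smooth (\<lambda>x::R3. x \<bullet> x)"
    by (rule smooth_bilinear[OF bounded_bilinear_inner smooth_id smooth_id])
  have 1: "smooth (\<lambda>x::R3. x \<bullet> x - 1)"
    using smooth_add[OF q smooth_const[of "-1"]] by simp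
  have 2: "smooth (\<lambda>x::R3. 4 - x \<bullet> x)"
    using smooth_add[OF smooth_const[of 4] smooth_linear[OF bounded_linear_minus[OF bounded_linear_ident] q]] by simp
  show ?thesis unfolding cutoff_def[abs_def] step_def
    by (intro smooth_bilinear[OF bounded_bilinear_mult] smooth_inverse flat_sum_pos smooth_add smooth_flat 1 2)
qed

lemma cutoff_eq_0: "norm x \<le> 1 \<Longrightarrow> cutoff x = 0"
  by (simp add: cutoff_def step_def flat_zero dot_square_norm power_le_one)

lemma cutoff_eq_1:
  assumes "norm x \<ge> 2" shows "cutoff x = 1"
proof -
  have "(norm x)\<^sup>2 \<ge> 2\<^sup>2" using assms by (rule power_mono) simp
  then show ?thesis using flat_sum_pos[of "x \<bullet> x"]
    by (simp add: cutoff_def step_def flat_zero dot_square_norm)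
qed

lemma partial_cutoff: "partial i cutoff x = step_deriv (x \<bullet> x) * (2 * x $ i)"
proof -
  have "((\<lambda>x::R3. x \<bullet> x) has_derivative (\<lambda>h. x \<bullet> h + h \<bullet> x)) (at x)"
    by (auto intro!: derivative_eq_intros)
  from has_derivative_compose[OF this step_DERIV[unfolded has_field_derivative_def]]
  have "(cutoff has_derivative (\<lambda>h. step_deriv (x \<bullet> x) * (x \<bullet> h + h \<bullet> x))) (at x)"
    by (simp add: cutoff_def[abs_def])
  from partial_has_derivative[OF this] show ?thesis
    by (simp add: inner_axis inner_axis')
qed

lemma partial_eq_0:
  assumes "open S" "x \<in> S" "\<And>y. y \<in> S \<Longrightarrow> f y = c"
  shows "partial i f x = 0"
proof -
  have "((\<lambda>y. c) has_derivative (\<lambda>h. 0)) (at x)" by simp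
  then have "(f has_derivative (\<lambda>h. 0)) (at x)"
    by (rule has_derivative_transform_within_open) (use assms in auto)
  from partial_has_derivative[OF this] show ?thesis .
qed

lemma partial_cutoff_eq_0: 
  assumes "norm x < 1 \<or> norm x > 2" shows "partial i cutoff x = 0"
  using assms
proof
  assume "norm x < 1"
  then show ?thesis by (intro partial_eq_0[where S="ball 0 1"]) (auto simp: cutoff_eq_0)
next
  assume "norm x > 2"
  then show ?thesis by (intro partial_eq_0[where S="- cball 0 2"]) (auto simp: cutoff_eq_1)
qed

section \<open>Integrals of derivatives with compact support, and the moment of the cutoff\<close>

lemma integrable_compact_support:
  fixes g :: "R3 \<Rightarrow> 'b::{banach, second_countable_topology}"
  assumes "continuous_on UNIV g" "\<And>x. norm x > r \<Longrightarrow> g x = 0"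
  shows "integrable lborel g"
proof -
  have "integrable lborel (\<lambda>x. indicator (cball 0 r) x *\<^sub>R g x)"
    by (rule borel_integrable_compact) (auto intro: continuous_on_subset[OF assms(1)])
  moreover have "(\<lambda>x. indicator (cball 0 r) x *\<^sub>R g x) = g"
    using assms(2) by (auto simp: fun_eq_iff indicator_def not_le)
  ultimately show ?thesis by simp
qed

text \<open>Difference quotients have integral zero by translation invariance, and they converge to
  the partial derivative under a common integrable bound.\<close>

lemma integral_partial_eq_0:
  fixes g :: "R3 \<Rightarrow> real"
  assumes d: "\<And>x. g differentiable (at x)" and c: "continuous_on UNIV (partial i g)"
    and z: "\<And>x. norm x > r \<Longrightarrow> g x = 0"
  shows "(\<integral>x. partial i g x \<partial>lborel) = 0"
proof -
  define e :: R3 where "e = axis i 1"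
  have e: "norm e = 1" by (simp add: e_def)
  have gc: "continuous_on UNIV g"
    using d differentiable_imp_continuous_within continuous_on_eq_continuous_within by blast
  have gi: "integrable lborel g" by (rule integrable_compact_support[OF gc z])
  have pz: "partial i g x = 0" if "norm x > r" for x
    using that by (intro partial_eq_0[where S="- cball 0 r"]) (auto simp: z)
  have line: "((\<lambda>t. g (x + t *\<^sub>R e)) has_real_derivative partial i g (x + t *\<^sub>R e)) (at t)" for x t
  proof -
    have "((\<lambda>t. x + t *\<^sub>R e) has_derivative (\<lambda>h. h *\<^sub>R e)) (at t)"
      by (auto intro!: derivative_eq_intros)
    from has_derivative_compose[OF this differentiable_has_derivative[OF d]]
    have "((\<lambda>t. g (x + t *\<^sub>R e)) has_derivative (\<lambda>h. frechet_derivative g (at (x + t *\<^sub>R e)) (h *\<^sub>R e))) (at t)" .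
    moreover have "frechet_derivative g (at y) (h *\<^sub>R e) = partial i g y * h" for y h
      using linear_frechet_derivative[OF d[of y]] by (simp add: partial_def e_def linear_scale)
    ultimately show ?thesis by (simp add: has_field_derivative_def)
  qed
  have "bounded (partial i g ` cball 0 r)"
    by (intro compact_imp_bounded compact_continuous_image continuous_on_subset[OF c]) auto
  then obtain M where M: "M > 0" "\<And>x. norm x \<le> r \<Longrightarrow> \<bar>partial i g x\<bar> \<le> M"
    unfolding bounded_pos by (force simp: image_iff)
  have M': "\<bar>partial i g x\<bar> \<le> M" for x
    using M pz[of x] by (cases "norm x \<le> r") auto
  define h where "h n = inverse (real (Suc n))" for n
  have h: "0 < h n" "h n \<le> 1" for n by (auto simp: h_def field_simps)
  define G where "G n x = (g (x + h n *\<^sub>R e) - g x) / h n" for n x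
  have trans: "integrable lborel (\<lambda>x. g (x + a))" "(\<integral>x. g (x + a) \<partial>lborel) = (\<integral>x. g x \<partial>lborel)" for a
  proof -
    have m: "g \<in> borel_measurable borel" using gc by (rule borel_measurable_continuous_onI)
    have "distr lborel borel (\<lambda>x. a + x) = lborel" by (simp add: lborel_distr_plus)
    then show "integrable lborel (\<lambda>x. g (x + a))" "(\<integral>x. g (x + a) \<partial>lborel) = (\<integral>x. g x \<partial>lborel)"
      using integrable_distr_eq[of "\<lambda>x. a + x" lborel borel g] integral_distr[of "\<lambda>x. a + x" lborel borel g] gi m
      by (simp_all add: add.commute)
  qed
  have "(\<lambda>n. \<integral>x. G n x \<partial>lborel) \<longlonglongrightarrow> (\<integral>x. partial i g x \<partial>lborel)"
  \<comment> \<open>The shift \<open>h n\<close> is at most 1, so the quotients vanish outside the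
    ball of radius \<open>r + 1\<close>; the mean value theorem bounds them by
    \<open>M\<close>.\<close>
  proof (rule integral_dominated_convergence[where w="\<lambda>x. indicator (cball 0 (r + 1)) x *\<^sub>R M"])
    show "partial i g \<in> borel_measurable lborel"
      using c by (simp add: borel_measurable_continuous_onI)
    show "G n \<in> borel_measurable lborel" for n
      unfolding G_def[abs_def]
      by (simp, rule borel_measurable_continuous_onI) (intro continuous_intros continuous_on_compose2[OF gc]; use h[of n] in auto)
    show "integrable lborel (\<lambda>x::R3. indicator (cball 0 (r + 1)) x *\<^sub>R M)"
      by (rule borel_integrable_compact) auto
    have "h \<longlonglongrightarrow> 0" unfolding h_def by (rule LIMSEQ_inverse_real_of_nat)
    then have "filterlim h (at 0) sequentially"
      using h(1) by (intro filterlim_atI) (auto simp: less_imp_neq[symmetric] less_imp_neq intro!: always_eventually dest: order.strict_implies_not_eq)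
    moreover have "((\<lambda>t. (g (x + t *\<^sub>R e) - g x) / t) \<longlongrightarrow> partial i g x) (at 0)" for x
      using line[of x 0] by (simp add: has_field_derivative_iff)
    ultimately show "AE x in lborel. (\<lambda>n. G n x) \<longlonglongrightarrow> partial i g x"
      unfolding G_def by (intro AE_I2) (rule filterlim_compose)
    show "AE x in lborel. norm (G n x) \<le> indicator (cball 0 (r + 1)) x *\<^sub>R M" for n
    proof (intro AE_I2)
      fix x
      have "\<exists>z. z > 0 \<and> z < h n \<and> g (x + h n *\<^sub>R e) - g (x + 0 *\<^sub>R e) = (h n - 0) * partial i g (x + z *\<^sub>R e)"
        by (rule MVT2[OF h(1)]) (rule line)
      then have b: "\<bar>G n x\<bar> \<le> M" using M' h(1)[of n] by (auto simp: G_def abs_mult)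
      have "G n x = 0" if "norm x > r + 1"
      proof -
        have "norm x \<le> norm (x + h n *\<^sub>R e) + norm (h n *\<^sub>R e)"
          using norm_triangle_ineq4[of "x + h n *\<^sub>R e" "h n *\<^sub>R e"] by simp
        then have "norm (x + h n *\<^sub>R e) > r" using that h[of n] e by simp
        then show ?thesis using z that by (simp add: G_def)
      qed
      then show "norm (G n x) \<le> indicator (cball 0 (r + 1)) x *\<^sub>R M"
        using b by (auto simp: indicator_def)
    qed
  qed
  moreover have "(\<integral>x. G n x \<partial>lborel) = 0" for n
    unfolding G_def using trans gi by simp
  ultimately show ?thesis by (simp add: LIMSEQ_const_iff)
qed

text \<open>The pairing of the Laplacian of the cutoff with the Newtonian potential 1/r. In polar
  coordinates its value is 4 pi, but only the sign matters below.\<close>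

definition newton_moment :: real where
  "newton_moment = (\<integral>x. (\<Sum>i\<in>UNIV. partial i (partial i cutoff) x) / norm x \<partial>lborel)"

lemma partial2_cutoff_eq_0:
  assumes "norm x < 1 \<or> norm x > 2" shows "partial j (partial i cutoff) x = 0"
  using assms
proof
  assume "norm x < 1"
  then show ?thesis by (intro partial_eq_0[where S="ball 0 1"]) (auto simp: partial_cutoff_eq_0)
next
  assume "norm x > 2"
  then show ?thesis by (intro partial_eq_0[where S="- cball 0 2"]) (auto simp: partial_cutoff_eq_0)
qed

lemma continuous_on_annulus_div:
  fixes f :: "R3 \<Rightarrow> real"
  assumes "continuous_on UNIV f" "\<And>x. norm x < 1 \<Longrightarrow> f x = 0"
  shows "continuous_on UNIV (\<lambda>x. f x / norm x ^ k)"
proof -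
  have "isCont (\<lambda>x. f x / norm x ^ k) x" for x
  proof (cases "x = 0")
    case True
    have "\<forall>\<^sub>F y in nhds x. f y / norm y ^ k = 0"
      using True assms(2) by (auto simp: eventually_nhds intro!: exI[of _ "ball 0 1"])
    then show ?thesis by (simp add: isCont_cong[of _ "\<lambda>_. 0"])
  next
    case False
    then show ?thesis using assms(1)
      by (intro continuous_intros) (auto simp: continuous_on_eq_continuous_at)
  qed
  then show ?thesis by (simp add: continuous_on_eq_continuous_at)
qed

lemma newton_moment_pos: "newton_moment > 0"
proof -
  \<comment> \<open>\<open>g i - q i\<close> is the i-th derivative of \<open>f i\<close>, which has
    compact support, so the integrals of \<open>g i\<close> and \<open>q i\<close> agree. Summed
    over i, the first is the moment, while the second contains only first derivatives of the cutoff
    and has a visible sign.\<close>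
  define f where "f i x = partial i cutoff x / norm x" for i x
  define g where "g i x = partial i (partial i cutoff) x / norm x" for i x
  define q where "q i x = partial i cutoff x * x $ i / norm x ^ 3" for i x
  have c1: "continuous_on UNIV (partial i cutoff)" and c2: "continuous_on UNIV (partial j (partial i cutoff))" for i j
    by (intro smooth_continuous_on smooth_partial smooth_cutoff)+
  have gc: "continuous_on UNIV (g i)" for i
    using continuous_on_annulus_div[OF c2[of i i], of 1] by (simp add: g_def[abs_def] partial2_cutoff_eq_0)
  have qc: "continuous_on UNIV (q i)" for i
    unfolding q_def[abs_def]
    by (rule continuous_on_annulus_div) (auto intro!: continuous_intros c1 simp: partial_cutoff_eq_0)
  have f: "f i differentiable (at x) \<and> partial i (f i) x = g i x - q i x" for i x
  proof (cases "x = 0")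
    case True
    have "((\<lambda>y. 0) has_derivative (\<lambda>h. 0)) (at x)" by simp
    then have "(f i has_derivative (\<lambda>h. 0)) (at x)"
      by (rule has_derivative_transform_within_open[where s="ball 0 1"])
        (use True in \<open>auto simp: f_def partial_cutoff_eq_0\<close>)
    then show ?thesis using partial_has_derivative[of "f i" "\<lambda>h. 0" x i] True
      by (auto simp: differentiable_def g_def q_def)
  next
    case False
    have d: "(partial i cutoff has_derivative frechet_derivative (partial i cutoff) (at x)) (at x)"
      by (intro differentiable_has_derivative smooth_differentiable smooth_partial smooth_cutoff)
    have "(f i has_derivative (\<lambda>h. - partial i cutoff x * (inverse (norm x) * (sgn x \<bullet> h) * inverse (norm x))
         + frechet_derivative (partial i cutoff) (at x) h / norm x)) (at x)"
      unfolding f_def[abs_def] using False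
      by (intro has_derivative_divide[OF d]) (simp_all add: has_derivative_norm inner_commute)
    from partial_has_derivative[OF this, of i] this show ?thesis
      by (auto simp: differentiable_def g_def q_def sgn_div_norm inner_axis partial_def[of i "partial i cutoff"]
          power3_eq_cube field_simps)
  qed
  have fp: "partial i (f i) = (\<lambda>x. g i x - q i x)" for i using f by auto
  have gi: "integrable lborel (g i)" for i
    by (rule integrable_compact_support[OF gc, of 2]) (simp add: g_def partial2_cutoff_eq_0)
  have qi: "integrable lborel (q i)" for i
    by (rule integrable_compact_support[OF qc, of 2]) (simp add: q_def partial_cutoff_eq_0)
  have "(\<integral>x. partial i (f i) x \<partial>lborel) = 0" for i
  proof (rule integral_partial_eq_0[where r=2])
    show "continuous_on UNIV (partial i (f i))" unfolding fp by (intro continuous_intros gc qc)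
  qed (use f in \<open>auto simp: f_def partial_cutoff_eq_0\<close>)
  then have gq: "(\<integral>x. g i x \<partial>lborel) = (\<integral>x. q i x \<partial>lborel)" for i
    using gi qi by (simp add: fp)
  have "newton_moment = (\<integral>x. (\<Sum>i\<in>UNIV. g i x) \<partial>lborel)"
    by (simp add: newton_moment_def g_def sum_divide_distrib)
  also have "\<dots> = (\<Sum>i\<in>UNIV. (\<integral>x. q i x \<partial>lborel))" using gi gq by simp
  also have "\<dots> = (\<integral>x. (\<Sum>i\<in>UNIV. q i x) \<partial>lborel)" using qi by simp
  finally have K: "newton_moment = (\<integral>x. (\<Sum>i\<in>UNIV. q i x) \<partial>lborel)" .
  let ?Q = "\<lambda>x. \<Sum>i\<in>UNIV. q i x"
  \<comment> \<open>The radial derivative of the cutoff, nonnegative because the cutoff increases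
    with the radius.\<close>
  have Q: "?Q x = 2 * step_deriv (x \<bullet> x) * (x \<bullet> x) / norm x ^ 3" for x
    by (simp add: q_def partial_cutoff sum_divide_distrib[symmetric] sum_distrib_left[symmetric]
        inner_vec_def[of x x] mult.assoc)
  have Qn: "?Q x \<ge> 0" for x unfolding Q by (simp add: step_deriv_nonneg)
  have Qi: "integrable lborel ?Q" using qi by simp
  have "newton_moment \<noteq> 0"
  proof
    assume "newton_moment = 0"
    then have "AE x in lborel. ?Q x = 0"
      using integral_nonneg_eq_0_iff_AE[OF Qi] Qn K by simp
    then have "AE x in lebesgue. ?Q x = 0" by (rule AE_completion)
    \<comment> \<open>A nonempty open set is not negligible, so a continuous integrand vanishing
      almost everywhere vanishes identically.\<close>
    moreover have "open {x. ?Q x \<noteq> 0}"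
      by (intro open_Collect_neq continuous_intros qc)
    ultimately have "{x. ?Q x \<noteq> 0} = {}"
      using open_not_negligible[of "{x. ?Q x \<noteq> 0}"]
      by (auto simp: AE_iff_null_sets negligible_iff_null_sets null_sets_completionI)
    \<comment> \<open>The length \<open>sqrt 2\<close> puts \<open>x \<bullet> x\<close> at 2, where
      \<open>step_deriv\<close> is known to be positive.\<close>
    then have "?Q (sqrt 2 *\<^sub>R axis 1 1) = 0" by blast
    then show False using step_deriv_2_pos unfolding Q by simp
  qed
  moreover have "newton_moment \<ge> 0" unfolding K by (rule integral_nonneg_AE) (use Qn in auto)
  ultimately show ?thesis by simp
qed

section \<open>Weak gradients of rotated maps\<close>

text \<open>Jacobians store the i-th partial derivative as column i. In this convention the product
  rule for a scalar q times a map n reads q D + \<open>outer\<close> of n and grad q.\<close>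

definition outer :: "R3 \<Rightarrow> R3 \<Rightarrow> real ^ 3 ^ 3" where
  "outer v w = (\<chi> i j. v $ i * w $ j)"

definition grad :: "(R3 \<Rightarrow> real) \<Rightarrow> R3 \<Rightarrow> R3" where
  "grad \<phi> x = (\<chi> i. partial i \<phi> x)"

lemma column_outer [simp]: "column i (outer v w) = w $ i *\<^sub>R v"
  by (simp add: column_def outer_def vec_eq_iff)

lemma column_add [simp]: "column i (A + B) = column i A + column i B"
  and column_diff [simp]: "column i (A - B) = column i A - column i B"
  and column_scaleR [simp]: "column i (c *\<^sub>R A) = c *\<^sub>R column i A"
  for A B :: "real ^ 3 ^ 3"
  by (simp_all add: column_def vec_eq_iff)

lemma column_matrix_mult [simp]: "column i (A ** B) = A *v column i B"
  for A B :: "real ^ 3 ^ 3"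
  by (simp add: column_def vec_eq_iff matrix_matrix_mult_def matrix_vector_mult_def)

lemma matrix_eq_columns: "(\<And>i. column i A = column i B) \<Longrightarrow> A = B"
  by (simp add: column_def vec_eq_iff)

lemma inner_matrix_columns: "A \<bullet> B = (\<Sum>i\<in>UNIV. column i A \<bullet> column i B)" for A B :: "real ^ 3 ^ 3"
  unfolding inner_vec_def column_def by (simp, rule sum.swap)

lemma norm_matrix_columns: "(norm A)\<^sup>2 = (\<Sum>i\<in>UNIV. (norm (column i A))\<^sup>2)" for A :: "real ^ 3 ^ 3"
  by (simp add: power2_norm_eq_inner inner_matrix_columns)

lemma norm_outer: "norm (outer v w) = norm v * norm w"
proof (rule power2_eq_imp_eq)
  have "(norm (outer v w))\<^sup>2 = (\<Sum>i\<in>UNIV. (w $ i)\<^sup>2) * (norm v)\<^sup>2"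
    by (simp add: norm_matrix_columns power_mult_distrib sum_distrib_right)
  also have "(\<Sum>i\<in>UNIV. (w $ i)\<^sup>2) = (norm w)\<^sup>2"
    unfolding power2_norm_eq_inner inner_vec_def by (simp add: power2_eq_square)
  finally show "(norm (outer v w))\<^sup>2 = (norm v * norm w)\<^sup>2" by (simp add: power_mult_distrib)
qed auto

lemma ball_lebesgue [simp]: "ball c r \<in> sets lebesgue" for c :: R3
  by (simp add: borel_open)

lemma matrix_linear: "linear f \<Longrightarrow> matrix f *v x = f x" for f :: "R3 \<Rightarrow> R3"
  by (simp add: matrix_works)

lemma norm_orthogonal_matrix_mult:
  fixes Q A :: "real ^ 3 ^ 3"
  assumes "\<And>v. norm (Q *v v) = norm v"
  shows "norm (Q ** A) = norm A"
  by (rule power2_eq_imp_eq[OF _ norm_ge_zero norm_ge_zero]) (simp only: norm_matrix_columns column_matrix_mult assms)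

lemma bounded_linear_outer_left: "bounded_linear (\<lambda>v. outer v w)"
  by (intro linear_conv_bounded_linear[THEN iffD1] linearI)
    (simp_all add: outer_def vec_eq_iff algebra_simps)

lemma bounded_linear_cross3: "bounded_linear (cross3 a)"
  using linear_cross3 linear_conv_bounded_linear by blast

lemma norm_cross3_le: "norm (cross3 a x) \<le> norm a * norm x"
proof -
  have "(norm (cross3 a x))\<^sup>2 \<le> (norm a * norm x)\<^sup>2"
    using norm_cross_dot[of a x] by (metis le_add_same_cancel1 zero_le_power2)
  then show ?thesis by (rule power2_le_imp_le) simp
qed

lemma sum_squares_le: "(norm (x + y))\<^sup>2 \<le> 2 * (norm x)\<^sup>2 + 2 * (norm y)\<^sup>2"
  for x y :: "'a::real_inner"
proof -
  have "(norm (x + y))\<^sup>2 + (norm (x - y))\<^sup>2 = 2 * (norm x)\<^sup>2 + 2 * (norm y)\<^sup>2"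
    by (simp add: power2_norm_eq_inner inner_add_left inner_add_right inner_diff_left inner_diff_right)
  then show ?thesis by (metis le_add_same_cancel1 zero_le_power2)
qed

section \<open>Local square integrability and test functions\<close>

definition locL2 :: "R3 set \<Rightarrow> (R3 \<Rightarrow> 'b::euclidean_space) \<Rightarrow> bool" where
  "locL2 S f \<longleftrightarrow> f \<in> borel_measurable (lebesgue_on S) \<and>
     (\<forall>r. (\<integral>\<^sup>+x. ennreal ((norm (f x))\<^sup>2) \<partial>lebesgue_on (S \<inter> ball 0 r)) < \<infinity>)"

lemma measurable_on_inter:
  "f \<in> borel_measurable (lebesgue_on S) \<Longrightarrow> S \<inter> B = T \<Longrightarrow> f \<in> borel_measurable (lebesgue_on T)"
  by (metis measurable_restrict_mono inf_le1)

lemma locL2_D: "locL2 S f \<Longrightarrow> f \<in> borel_measurable (lebesgue_on S)"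
  by (simp add: locL2_def)

text \<open>The constant may depend on the ball, which admits multiplication by continuous functions
  that are bounded only locally.\<close>

lemma locL2_bound:
  fixes f :: "R3 \<Rightarrow> 'b::euclidean_space" and g :: "R3 \<Rightarrow> 'c::euclidean_space"
  assumes f: "locL2 S f" and g: "g \<in> borel_measurable (lebesgue_on S)"
    and b: "\<And>r. \<exists>C\<ge>0. \<forall>x\<in>ball 0 r. (norm (g x))\<^sup>2 \<le> C * (norm (f x))\<^sup>2"
  shows "locL2 S g"
  unfolding locL2_def
proof (intro conjI allI g)
  fix r
  obtain C where C: "C \<ge> 0" "\<forall>x\<in>ball 0 r. (norm (g x))\<^sup>2 \<le> C * (norm (f x))\<^sup>2" using b by blast
  have "(\<integral>\<^sup>+x. ennreal ((norm (g x))\<^sup>2) \<partial>lebesgue_on (S \<inter> ball 0 r))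
     \<le> (\<integral>\<^sup>+x. ennreal C * ennreal ((norm (f x))\<^sup>2) \<partial>lebesgue_on (S \<inter> ball 0 r))"
    using C by (intro nn_integral_mono) (auto simp: ennreal_mult[symmetric] intro!: ennreal_leI)
  also have "\<dots> = ennreal C * (\<integral>\<^sup>+x. ennreal ((norm (f x))\<^sup>2) \<partial>lebesgue_on (S \<inter> ball 0 r))"
    using measurable_on_inter[OF locL2_D[OF f] refl, of "ball 0 r"] by (intro nn_integral_cmult) measurable
  also have "\<dots> < \<infinity>" using f by (auto simp: locL2_def ennreal_mult_less_top)
  finally show "(\<integral>\<^sup>+x. ennreal ((norm (g x))\<^sup>2) \<partial>lebesgue_on (S \<inter> ball 0 r)) < \<infinity>" .
qed

lemma measurable_linear:
  assumes "bounded_linear L" "f \<in> borel_measurable M"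
  shows "(\<lambda>x. L (f x)) \<in> borel_measurable M"
  using assms(2) borel_measurable_continuous_onI[OF linear_continuous_on[OF assms(1)]]
  by (rule measurable_compose)

lemma measurable_continuous_lebesgue_on:
  "continuous_on UNIV f \<Longrightarrow> f \<in> borel_measurable (lebesgue_on S)"
  for f :: "R3 \<Rightarrow> 'b::topological_space"
  by (intro measurable_restrict_space1 measurable_completion) (simp add: borel_measurable_continuous_onI)

lemma locL2_linear:
  assumes "bounded_linear L" "locL2 S f"
  shows "locL2 S (\<lambda>x. L (f x))"
proof (rule locL2_bound[OF assms(2)])
  show "(\<lambda>x. L (f x)) \<in> borel_measurable (lebesgue_on S)"
    using measurable_linear[OF assms(1) locL2_D[OF assms(2)]] .
  obtain K where K: "\<And>x. norm (L x) \<le> norm x * K" "K \<ge> 0"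
    using bounded_linear.nonneg_bounded[OF assms(1)] by blast
  have "(norm (L (f x)))\<^sup>2 \<le> K\<^sup>2 * (norm (f x))\<^sup>2" for x
    using power_mono[OF K(1)[of "f x"], of 2] by (simp add: power_mult_distrib mult.commute)
  then show "\<exists>C\<ge>0. \<forall>x\<in>ball 0 r. (norm (L (f x)))\<^sup>2 \<le> C * (norm (f x))\<^sup>2" for r
    by (intro exI[of _ "K\<^sup>2"]) auto
qed

lemma locL2_scale:
  fixes q :: "R3 \<Rightarrow> real"
  assumes q: "continuous_on UNIV q" and f: "locL2 S f"
  shows "locL2 S (\<lambda>x. q x *\<^sub>R f x)"
proof (rule locL2_bound[OF f])
  show "(\<lambda>x. q x *\<^sub>R f x) \<in> borel_measurable (lebesgue_on S)"
    using measurable_continuous_lebesgue_on[OF q] locL2_D[OF f] by (rule borel_measurable_scaleR)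
  fix r
  have "bounded (q ` cball 0 r)"
    by (intro compact_imp_bounded compact_continuous_image continuous_on_subset[OF q]) auto
  then obtain K where K: "\<And>x. norm x \<le> r \<Longrightarrow> \<bar>q x\<bar> \<le> K"
    unfolding bounded_iff by (metis image_eqI mem_cball_0 real_norm_def)
  have "(norm (q x *\<^sub>R f x))\<^sup>2 \<le> K\<^sup>2 * (norm (f x))\<^sup>2" if "norm x \<le> r" for x
    using power_mono[OF K[OF that], of 2] by (simp add: power_mult_distrib mult_right_mono)
  then show "\<exists>C\<ge>0. \<forall>x\<in>ball 0 r. (norm (q x *\<^sub>R f x))\<^sup>2 \<le> C * (norm (f x))\<^sup>2"
    by (intro exI[of _ "K\<^sup>2"]) auto
qed

lemma locL2_add:
  assumes "locL2 S f" "locL2 S g"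
  shows "locL2 S (\<lambda>x. f x + g x)"
  unfolding locL2_def
proof (intro conjI allI)
  show "(\<lambda>x. f x + g x) \<in> borel_measurable (lebesgue_on S)"
    using assms[THEN locL2_D] by (rule borel_measurable_add)
  fix r
  have m: "f \<in> borel_measurable (lebesgue_on (S \<inter> ball 0 r))" "g \<in> borel_measurable (lebesgue_on (S \<inter> ball 0 r))"
    using assms[THEN locL2_D] measurable_on_inter by blast+
  have "(\<integral>\<^sup>+x. ennreal ((norm (f x + g x))\<^sup>2) \<partial>lebesgue_on (S \<inter> ball 0 r))
     \<le> (\<integral>\<^sup>+x. 2 * ennreal ((norm (f x))\<^sup>2) + 2 * ennreal ((norm (g x))\<^sup>2) \<partial>lebesgue_on (S \<inter> ball 0 r))"
    by (intro nn_integral_mono) 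
     (use sum_squares_le in \<open>auto simp: ennreal_mult[symmetric] ennreal_plus[symmetric] 
       ennreal_numeral[symmetric] intro!: ennreal_leI simp del: ennreal_plus ennreal_numeral\<close>)
  also have "\<dots> = 2 * (\<integral>\<^sup>+x. ennreal ((norm (f x))\<^sup>2) \<partial>lebesgue_on (S \<inter> ball 0 r)) 
      + 2 * (\<integral>\<^sup>+x. ennreal ((norm (g x))\<^sup>2) \<partial>lebesgue_on (S \<inter> ball 0 r))"
    using m by (simp add: nn_integral_add nn_integral_cmult)
  also have "\<dots> < \<infinity>" using assms by (auto simp: locL2_def ennreal_mult_less_top)
  finally show "(\<integral>\<^sup>+x. ennreal ((norm (f x + g x))\<^sup>2) \<partial>lebesgue_on (S \<inter> ball 0 r)) < \<infinity>" .
qed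

lemma locL2_subset:
  assumes "locL2 S f" "T \<subseteq> S" "S \<in> sets lebesgue" "T \<in> sets lebesgue"
  shows "locL2 T f"
  unfolding locL2_def
proof (intro conjI allI)
  show "f \<in> borel_measurable (lebesgue_on T)"
    using locL2_D[OF assms(1)] assms(2) by (metis measurable_restrict_mono)
  fix r
  have "(\<integral>\<^sup>+x. ennreal ((norm (f x))\<^sup>2) \<partial>lebesgue_on (T \<inter> ball 0 r))
     \<le> (\<integral>\<^sup>+x. ennreal ((norm (f x))\<^sup>2) \<partial>lebesgue_on (S \<inter> ball 0 r))"
    using assms(2-4) by (subst (1 2) nn_integral_restrict_space) (auto simp: indicator_def intro!: nn_integral_mono)
  also have "\<dots> < \<infinity>" using assms(1) by (simp add: locL2_def)
  finally show "(\<integral>\<^sup>+x. ennreal ((norm (f x))\<^sup>2) \<partial>lebesgue_on (T \<inter> ball 0 r)) < \<infinity>" .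
qed

lemma emeasure_ball_lebesgue_on:
  fixes S :: "R3 set"
  assumes "S \<in> sets lebesgue" shows "emeasure (lebesgue_on S) (S \<inter> ball 0 r) < \<infinity>"
proof -
  have "emeasure (lebesgue_on S) (S \<inter> ball 0 r) = emeasure lebesgue (S \<inter> ball 0 r)"
    using assms by (subst emeasure_restrict_space) auto
  also have "\<dots> \<le> emeasure lebesgue (ball 0 r :: R3 set)" 
    using emeasure_mono[of "S \<inter> ball 0 r" "ball 0 r" lebesgue] by simp
  also have "\<dots> < \<infinity>" using emeasure_bounded_finite[of "ball 0 r :: R3 set"] by (simp add: less_top)
  finally show ?thesis .
qed

lemma locL2_integrable:
  fixes f :: "R3 \<Rightarrow> 'b::euclidean_space" and \<psi> :: "R3 \<Rightarrow> real"
  assumes S: "S \<in> sets lebesgue" and f: "locL2 S f" and c: "continuous_on UNIV \<psi>"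
    and z: "\<And>x. norm x \<ge> r \<Longrightarrow> \<psi> x = 0"
  shows "integrable (lebesgue_on S) (\<lambda>x. \<psi> x *\<^sub>R f x)"
proof (rule integrableI_bounded)
  show "(\<lambda>x. \<psi> x *\<^sub>R f x) \<in> borel_measurable (lebesgue_on S)"
    using measurable_continuous_lebesgue_on[OF c] locL2_D[OF f] by (rule borel_measurable_scaleR)
  have "bounded (\<psi> ` cball 0 r)"
    by (intro compact_imp_bounded compact_continuous_image continuous_on_subset[OF c]) auto
  then obtain K where K: "K > 0" "\<And>x. norm x \<le> r \<Longrightarrow> \<bar>\<psi> x\<bar> \<le> K"
    unfolding bounded_pos by (auto simp: image_iff)
  have B: "S \<inter> ball 0 r \<in> sets (lebesgue_on S)" using S by (simp add: sets_restrict_space_iff sets.Int)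
  have "ennreal (norm (\<psi> x *\<^sub>R f x)) \<le> ennreal K * (indicator (S \<inter> ball 0 r) x + ennreal ((norm (f x))\<^sup>2) * indicator (ball 0 r) x)"
    if "x \<in> S" for x
  proof (cases "norm x < r")
    case True
    \<comment> \<open>On a ball, which has finite measure, square integrability gives integrability
      through s \<le> 1 + s^2.\<close>
    have "2 * norm (f x) \<le> 1 + (norm (f x))\<^sup>2"
      using sum_squares_bound[of 1 "norm (f x)"] by simp
    then have "norm (f x) \<le> 1 + (norm (f x))\<^sup>2"
      using norm_ge_zero[of "f x"] by linarith
    then have "norm (\<psi> x *\<^sub>R f x) \<le> K * (1 + (norm (f x))\<^sup>2)"
      using K(2)[of x] True K(1) by (auto intro!: mult_mono)
    then have "ennreal (norm (\<psi> x *\<^sub>R f x)) \<le> ennreal (K * (1 + (norm (f x))\<^sup>2))"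
      by (rule ennreal_leI)
    also have "\<dots> = ennreal K * (1 + ennreal ((norm (f x))\<^sup>2))"
      using K(1) by (simp add: ennreal_mult)
    finally show ?thesis using True that by simp
  qed (use z in auto)
  then have "(\<integral>\<^sup>+x. ennreal (norm (\<psi> x *\<^sub>R f x)) \<partial>lebesgue_on S)
    \<le> (\<integral>\<^sup>+x. ennreal K * (indicator (S \<inter> ball 0 r) x + ennreal ((norm (f x))\<^sup>2) * indicator (ball 0 r) x) \<partial>lebesgue_on S)"
    by (intro nn_integral_mono) simp
  also have "\<dots> = ennreal K * (emeasure (lebesgue_on S) (S \<inter> ball 0 r) + (\<integral>\<^sup>+x. ennreal ((norm (f x))\<^sup>2) * indicator (ball 0 r) x \<partial>lebesgue_on S))"
  proof -
    have [measurable]: "f \<in> borel_measurable (lebesgue_on S)" by (rule locL2_D[OF f])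
    have [measurable]: "(\<lambda>x. indicator (ball 0 r) x :: ennreal) \<in> borel_measurable (lebesgue_on S)"
      by (intro measurable_restrict_space1 measurable_completion borel_measurable_indicator) simp
    show ?thesis using B by (simp add: nn_integral_cmult nn_integral_add)
  qed
  also have "(\<integral>\<^sup>+x. ennreal ((norm (f x))\<^sup>2) * indicator (ball 0 r) x \<partial>lebesgue_on S) =
     (\<integral>\<^sup>+x. ennreal ((norm (f x))\<^sup>2) \<partial>lebesgue_on (S \<inter> ball 0 r))"
    using S by (subst (1 2) nn_integral_restrict_space) (auto simp: indicator_def intro!: nn_integral_cong)
  also have "ennreal K * (emeasure (lebesgue_on S) (S \<inter> ball 0 r) + \<dots>) < \<infinity>"
    using f emeasure_ball_lebesgue_on[OF S] by (auto simp: locL2_def ennreal_mult_less_top)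
  finally show "(\<integral>\<^sup>+x. ennreal (norm (\<psi> x *\<^sub>R f x)) \<partial>lebesgue_on S) < \<infinity>" .
qed

lemma test_functionsD:
  assumes "\<psi> \<in> test_functions U"
  shows "smooth \<psi>" "\<exists>r. \<forall>x. norm x \<ge> r \<longrightarrow> \<psi> x = 0" "\<psi> x \<noteq> 0 \<Longrightarrow> x \<in> U"
proof -
  show "smooth \<psi>" using assms by (simp add: test_functions_def)
  have "bounded {x. \<psi> x \<noteq> 0}"
    using assms bounded_subset[OF compact_imp_bounded closure_subset] by (auto simp: test_functions_def)
  then obtain r where "\<And>x. \<psi> x \<noteq> 0 \<Longrightarrow> norm x \<le> r" by (auto simp: bounded_iff)
  then show "\<exists>r. \<forall>x. norm x \<ge> r \<longrightarrow> \<psi> x = 0"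
    by (intro exI[of _ "r + 1"]) (metis add_le_same_cancel1 not_one_le_zero order_trans)
  show "\<psi> x \<noteq> 0 \<Longrightarrow> x \<in> U"
    using assms closure_subset by (fastforce simp: test_functions_def)
qed

lemma test_functions_support:
  assumes "\<psi> \<in> test_functions U" "smooth f" "\<And>x. x \<notin> closure {x. \<psi> x \<noteq> 0} \<Longrightarrow> f x = 0"
  shows "f \<in> test_functions U"
proof -
  have "closure {x. f x \<noteq> 0} \<subseteq> closure {x. \<psi> x \<noteq> 0}"
    using assms(3) by (intro closure_minimal) auto
  moreover from this have "compact (closure {x. f x \<noteq> 0})"
    using assms(1) by (metis (no_types, lifting) closed_closure compact_Int_closed inf.absorb2 mem_Collect_eq test_functions_def)
  ultimately show ?thesis using assms by (auto simp: test_functions_def)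
qed

lemma test_functions_partial:
  assumes "\<psi> \<in> test_functions U" shows "partial i \<psi> \<in> test_functions U"
proof (rule test_functions_support[OF assms])
  show "smooth (partial i \<psi>)" using smooth_partial test_functionsD(1)[OF assms] .
  fix x assume "x \<notin> closure {x. \<psi> x \<noteq> 0}"
  then show "partial i \<psi> x = 0"
    by (intro partial_eq_0[where S="- closure {x. \<psi> x \<noteq> 0}" and c=0])
      (use closure_subset[of "{x. \<psi> x \<noteq> 0}"] in auto)
qed

lemma test_functions_mult:
  assumes "\<psi> \<in> test_functions U" "smooth q" shows "(\<lambda>x. \<psi> x * q x) \<in> test_functions U"
proof (rule test_functions_support[OF assms(1)])
  show "smooth (\<lambda>x. \<psi> x * q x)"
    by (rule smooth_bilinear[OF bounded_bilinear_mult test_functionsD(1)[OF assms(1)] assms(2)])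
qed (use closure_subset[of "{x. \<psi> x \<noteq> 0}"] in auto)

lemma test_integrable:
  fixes f :: "R3 \<Rightarrow> 'b::euclidean_space"
  assumes "\<psi> \<in> test_functions U" "S \<in> sets lebesgue" "locL2 S f"
  shows "integrable (lebesgue_on S) (\<lambda>x. \<psi> x *\<^sub>R f x)"
  using test_functionsD(2)[OF assms(1)] locL2_integrable[OF assms(2,3)]
    smooth_continuous_on[OF test_functionsD(1)[OF assms(1)]] by blast

text \<open>The weak identity for \<open>n\<close> is tested with the test function times
  \<open>q\<close>. The term in which the derivative falls on \<open>q\<close> moves to the other
  side and becomes the outer product.\<close>

lemma weak_gradient_scale:
  fixes q :: "R3 \<Rightarrow> real"
  assumes U: "U \<in> sets lebesgue" and n: "locL2 U n" and D: "locL2 U D"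
    and w: "has_weak_gradient U n D" and q: "smooth q"
  shows "has_weak_gradient U (\<lambda>x. q x *\<^sub>R n x) (\<lambda>x. q x *\<^sub>R D x + outer (n x) (grad q x))"
  unfolding has_weak_gradient_def
proof (intro ballI allI)
  fix \<psi> i assume t: "\<psi> \<in> test_functions U"
  have Di: "locL2 U (\<lambda>x. column i (D x))"
    by (rule locL2_linear[OF _ D]) (intro linear_conv_bounded_linear[THEN iffD1] linearI; simp)
  have p: "partial i (\<lambda>x. \<psi> x * q x) x = \<psi> x * partial i q x + partial i \<psi> x * q x" for x
    by (rule partial_bilinear[OF bounded_bilinear_mult]; rule smooth_differentiable)
      (use q test_functionsD(1)[OF t] in auto)
  have i1: "integrable (lebesgue_on U) (\<lambda>x. (\<psi> x * partial i q x) *\<^sub>R n x)"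
    by (rule test_integrable[OF test_functions_mult[OF t smooth_partial[OF q]] U n])
  have i2: "integrable (lebesgue_on U) (\<lambda>x. (partial i \<psi> x * q x) *\<^sub>R n x)"
    by (rule test_integrable[OF test_functions_mult[OF test_functions_partial[OF t] q] U n])
  have i3: "integrable (lebesgue_on U) (\<lambda>x. (\<psi> x * q x) *\<^sub>R column i (D x))"
    by (rule test_integrable[OF test_functions_mult[OF t q] U Di])
  have "(\<integral>x. partial i (\<lambda>x. \<psi> x * q x) x *\<^sub>R n x \<partial>lebesgue_on U)
      = - (\<integral>x. (\<psi> x * q x) *\<^sub>R column i (D x) \<partial>lebesgue_on U)"
    using w test_functions_mult[OF t q] unfolding has_weak_gradient_def by blast
  then show "(\<integral>x. partial i \<psi> x *\<^sub>R q x *\<^sub>R n x \<partial>lebesgue_on U) =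
     - (\<integral>x. \<psi> x *\<^sub>R column i (q x *\<^sub>R D x + outer (n x) (grad q x)) \<partial>lebesgue_on U)"
    using i1 i2 i3 by (simp add: p scaleR_add_left scaleR_add_right grad_def algebra_simps)
qed

lemma weak_gradient_linear:
  assumes U: "U \<in> sets lebesgue" and n: "locL2 U n" and D: "locL2 U D"
    and w: "has_weak_gradient U n D" and L: "linear L"
  shows "has_weak_gradient U (\<lambda>x. L (n x)) (\<lambda>x. matrix L ** D x)"
  unfolding has_weak_gradient_def
proof (intro ballI allI)
  fix \<psi> i assume t: "\<psi> \<in> test_functions U"
  have Di: "locL2 U (\<lambda>x. column i (D x))"
    by (rule locL2_linear[OF _ D]) (intro linear_conv_bounded_linear[THEN iffD1] linearI; simp)
  have b: "bounded_linear L" using L linear_conv_bounded_linear by blast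
  have "(\<integral>x. L (partial i \<psi> x *\<^sub>R n x) \<partial>lebesgue_on U) = L (\<integral>x. partial i \<psi> x *\<^sub>R n x \<partial>lebesgue_on U)"
    by (rule integral_bounded_linear[OF b test_integrable[OF test_functions_partial[OF t] U n]])
  also have "\<dots> = L (- (\<integral>x. \<psi> x *\<^sub>R column i (D x) \<partial>lebesgue_on U))"
    using w t unfolding has_weak_gradient_def by simp
  also have "\<dots> = - L (\<integral>x. \<psi> x *\<^sub>R column i (D x) \<partial>lebesgue_on U)"
    using L by (rule linear_neg)
  also have "L (\<integral>x. \<psi> x *\<^sub>R column i (D x) \<partial>lebesgue_on U) = (\<integral>x. L (\<psi> x *\<^sub>R column i (D x)) \<partial>lebesgue_on U)"
    by (rule integral_bounded_linear[OF b test_integrable[OF t U Di], symmetric])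
  finally show "(\<integral>x. partial i \<psi> x *\<^sub>R L (n x) \<partial>lebesgue_on U) =
     - (\<integral>x. \<psi> x *\<^sub>R column i (matrix L ** D x) \<partial>lebesgue_on U)"
    using L by (simp add: linear_scale matrix_works)
qed

lemma weak_gradient_add:
  assumes U: "U \<in> sets lebesgue" and n: "locL2 U n" and D: "locL2 U D"
    and n': "locL2 U n'" and D': "locL2 U D'"
    and w: "has_weak_gradient U n D" and w': "has_weak_gradient U n' D'" 
  shows "has_weak_gradient U (\<lambda>x. n x + n' x) (\<lambda>x. D x + D' x)"
  unfolding has_weak_gradient_def
proof (intro ballI allI)
  fix \<psi> i assume t: "\<psi> \<in> test_functions U"
  have c: "bounded_linear (\<lambda>A::real^3^3. column i A)"
    by (intro linear_conv_bounded_linear[THEN iffD1] linearI; simp)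
  show "(\<integral>x. partial i \<psi> x *\<^sub>R (n x + n' x) \<partial>lebesgue_on U) =
     - (\<integral>x. \<psi> x *\<^sub>R column i (D x + D' x) \<partial>lebesgue_on U)"
    using test_integrable[OF test_functions_partial[OF t] U n, of i] test_integrable[OF test_functions_partial[OF t] U n', of i]
      test_integrable[OF t U locL2_linear[OF c D]] test_integrable[OF t U locL2_linear[OF c D']]
      w w' t by (simp add: scaleR_add_right has_weak_gradient_def)
qed

lemma H1_loc_iff:
  assumes "-G \<in> sets lebesgue"
  shows "H1_loc G n D \<longleftrightarrow> locL2 (- G) n \<and> locL2 (- G) D \<and> has_weak_gradient (interior (- G)) n D"
proof -
  have "(\<integral>\<^sup>+x. ennreal ((norm (n x))\<^sup>2 + (norm (D x))\<^sup>2) \<partial>lebesgue_on (- G \<inter> ball 0 r)) =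
    (\<integral>\<^sup>+x. ennreal ((norm (n x))\<^sup>2) \<partial>lebesgue_on (- G \<inter> ball 0 r)) + 
    (\<integral>\<^sup>+x. ennreal ((norm (D x))\<^sup>2) \<partial>lebesgue_on (- G \<inter> ball 0 r))"
    if "n \<in> borel_measurable (lebesgue_on (- G))" "D \<in> borel_measurable (lebesgue_on (- G))" for r
  proof -
    have [measurable]: "n \<in> borel_measurable (lebesgue_on (- G \<inter> ball 0 r))" "D \<in> borel_measurable (lebesgue_on (- G \<inter> ball 0 r))"
      using that measurable_on_inter by blast+
    show ?thesis by (simp add: nn_integral_add)
  qed
  then show ?thesis by (auto simp: H1_loc_def locL2_def)
qed

text \<open>For \<open>c\<close> a partial derivative of the map, \<open>v\<close> its value and
  \<open>d\<close> the partial derivative of the angle, the right-hand side is what the product rule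
  yields for the three summands of \<open>rot\<close>. The identity collects it into one
  rotation.\<close>

lemma rot_column_aux:
  assumes "norm a = 1"
  shows "rot a s (c + d *\<^sub>R cross3 a v) = c + (sin s *\<^sub>R cross3 a c + (cos s * d) *\<^sub>R cross3 a v)
     + ((1 - cos s) *\<^sub>R cross3 a (cross3 a c) + (sin s * d) *\<^sub>R cross3 a (cross3 a v))"
  using cross3_rot(2)[OF assms, of s v] linear_rot[of a s]
  by (simp add: linear_add linear_scale rot_def[of a s c] algebra_simps)

lemma partial_sin: "smooth (\<theta> :: R3 \<Rightarrow> real) \<Longrightarrow> partial i (\<lambda>x. sin (\<theta> x)) x = cos (\<theta> x) * partial i \<theta> x"
  by (rule partial_compose_real[where h=sin]) (auto intro: smooth_differentiable DERIV_sin)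

lemma partial_1_minus_cos: "smooth (\<theta> :: R3 \<Rightarrow> real) \<Longrightarrow> partial i (\<lambda>x. 1 - cos (\<theta> x)) x = sin (\<theta> x) * partial i \<theta> x"
  by (rule partial_compose_real[where h="\<lambda>y. 1 - cos y"]) (auto intro!: smooth_differentiable derivative_eq_intros)

lemma smooth_1_minus_cos: "smooth \<theta> \<Longrightarrow> smooth (\<lambda>x. 1 - cos (\<theta> x))" for \<theta> :: "R3 \<Rightarrow> real"
  using smooth_add[OF smooth_const[of 1] smooth_linear[OF bounded_linear_minus[OF bounded_linear_ident] smooth_cos]]
  by simp

text \<open>Differentiating the angle contributes the cross product with \<open>a\<close>, which
  commutes with the rotation; so the rotation can be written in front of the whole gradient.\<close>

definition rot_gradient :: "R3 \<Rightarrow> (R3 \<Rightarrow> real) \<Rightarrow> (R3 \<Rightarrow> R3) \<Rightarrow> (R3 \<Rightarrow> real ^ 3 ^ 3) \<Rightarrow> R3 \<Rightarrow> real ^ 3 ^ 3" where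
  "rot_gradient a \<theta> n D x = matrix (rot a (\<theta> x)) ** (D x + outer (cross3 a (n x)) (grad \<theta> x))"

context
  fixes G :: "R3 set"
  assumes G: "open G"
begin

lemma sets_compl: "- G \<in> sets lebesgue" "interior (- G) \<in> sets lebesgue"
  using G by (auto simp: borel_open borel_closed closed_Compl)

lemma locL2_interior: "locL2 (- G) f \<Longrightarrow> locL2 (interior (- G)) f"
  by (rule locL2_subset[OF _ interior_subset sets_compl])

lemma H1_loc_scale:
  assumes h: "H1_loc G n D" and q: "smooth q"
  shows "H1_loc G (\<lambda>x. q x *\<^sub>R n x) (\<lambda>x. q x *\<^sub>R D x + outer (n x) (grad q x))"
proof -
  have n: "locL2 (- G) n" and D: "locL2 (- G) D" and w: "has_weak_gradient (interior (- G)) n D"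
    using h H1_loc_iff sets_compl by auto
  \<comment> \<open>As a sum of smooth scalars times fixed linear images of \<open>n\<close>, the
    outer product falls under the closure properties of \<open>locL2\<close>.\<close>
  have o: "outer (n x) (grad q x) = (\<Sum>i\<in>UNIV. partial i q x *\<^sub>R outer (n x) (axis i 1))" for x
    by (auto simp: outer_def grad_def vec_eq_iff axis_def if_distrib sum_3 mult.commute forall_3 cong: if_cong)
  have s: "locL2 (- G) (\<lambda>x. outer (n x) (grad q x))"
    unfolding o sum_3
    by (intro locL2_add locL2_scale locL2_linear[OF bounded_linear_outer_left n] smooth_continuous_on smooth_partial q)
  show ?thesis unfolding H1_loc_iff[OF sets_compl(1)]
    by (intro conjI locL2_add locL2_scale n D s smooth_continuous_on q
        weak_gradient_scale[OF sets_compl(2)] locL2_interior w)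
qed

lemma H1_loc_linear:
  assumes h: "H1_loc G n D" and L: "linear L"
  shows "H1_loc G (\<lambda>x. L (n x)) (\<lambda>x. matrix L ** D x)"
proof -
  have n: "locL2 (- G) n" and D: "locL2 (- G) D" and w: "has_weak_gradient (interior (- G)) n D"
    using h H1_loc_iff sets_compl by auto
  have "bounded_linear (\<lambda>A::real^3^3. matrix L ** A)"
    by (intro linear_conv_bounded_linear[THEN iffD1] linearI)
      (rule matrix_eq_columns, simp add: matrix_vector_right_distrib matrix_vector_mult_scaleR)+
  moreover have "bounded_linear L" using L linear_conv_bounded_linear by blast
  ultimately show ?thesis unfolding H1_loc_iff[OF sets_compl(1)]
    using locL2_linear[of L, OF _ n] locL2_linear[OF _ D]
      weak_gradient_linear[OF sets_compl(2) locL2_interior[OF n] locL2_interior[OF D] w L] by blast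
qed

lemma H1_loc_add:
  assumes "H1_loc G n D" "H1_loc G n' D'"
  shows "H1_loc G (\<lambda>x. n x + n' x) (\<lambda>x. D x + D' x)"
  using assms unfolding H1_loc_iff[OF sets_compl(1)]
  by (auto intro!: locL2_add weak_gradient_add sets_compl locL2_interior)

text \<open>Rodrigues' formula with a variable angle is a sum of linear images of \<open>n\<close>
  with smooth coefficients, so the weak gradient follows from sums, linear maps and the product
  rule.\<close>

lemma H1_loc_rot:
  assumes h: "H1_loc G n D" and a: "norm a = 1" and \<theta>: "smooth \<theta>"
  shows "H1_loc G (\<lambda>x. rot a (\<theta> x) (n x)) (rot_gradient a \<theta> n D)"
proof -
  let ?A = "matrix (cross3 a)"
  have lin: "linear (\<lambda>x. cross3 a (cross3 a x))"
    using linear_compose[OF linear_cross3 linear_cross3] by (simp add: o_def)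
  have "H1_loc G (\<lambda>x. n x + sin (\<theta> x) *\<^sub>R cross3 a (n x) + (1 - cos (\<theta> x)) *\<^sub>R cross3 a (cross3 a (n x)))
    (\<lambda>x. D x + (sin (\<theta> x) *\<^sub>R (?A ** D x) + outer (cross3 a (n x)) (grad (\<lambda>x. sin (\<theta> x)) x))
      + ((1 - cos (\<theta> x)) *\<^sub>R (matrix (\<lambda>x. cross3 a (cross3 a x)) ** D x)
         + outer (cross3 a (cross3 a (n x))) (grad (\<lambda>x. 1 - cos (\<theta> x)) x)))"
    by (intro H1_loc_add h H1_loc_scale H1_loc_linear linear_cross3 lin smooth_sin smooth_1_minus_cos \<theta>)
  moreover have "rot_gradient a \<theta> n D = (\<lambda>x. D x + (sin (\<theta> x) *\<^sub>R (?A ** D x) + outer (cross3 a (n x)) (grad (\<lambda>x. sin (\<theta> x)) x))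
      + ((1 - cos (\<theta> x)) *\<^sub>R (matrix (\<lambda>x. cross3 a (cross3 a x)) ** D x)
         + outer (cross3 a (cross3 a (n x))) (grad (\<lambda>x. 1 - cos (\<theta> x)) x)))"
    by (rule ext, rule matrix_eq_columns)
      (simp add: rot_gradient_def rot_column_aux[OF a] grad_def partial_sin[OF \<theta>] partial_1_minus_cos[OF \<theta>]
        matrix_linear[OF lin] matrix_linear[OF linear_cross3])
  ultimately show ?thesis by (simp only: rot_def)
qed

end

section \<open>Competitors\<close>

lemma column_jacobian: "column i (jacobian f (at x)) = partial i f x" for f :: "R3 \<Rightarrow> R3"
  by (simp add: column_def jacobian_def matrix_def partial_def vec_eq_iff)

lemma smooth_cross3: "smooth u \<Longrightarrow> smooth (\<lambda>x. cross3 a (u x))"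
  by (rule smooth_linear[OF bounded_linear_cross3])

lemma smooth_scaleR: "smooth q \<Longrightarrow> smooth u \<Longrightarrow> smooth (\<lambda>x. q x *\<^sub>R u x)"
  by (rule smooth_bilinear[OF bounded_bilinear_scaleR])

lemma smooth_rot:
  assumes "smooth \<theta>" "smooth u" shows "smooth (\<lambda>x. rot a (\<theta> x) (u x))"
  unfolding rot_def
  by (intro smooth_add smooth_scaleR smooth_sin smooth_1_minus_cos smooth_cross3 assms)

lemma partial_rot:
  assumes a: "norm a = 1" and \<theta>: "smooth \<theta>" and u: "smooth u"
  shows "partial i (\<lambda>x. rot a (\<theta> x) (u x)) x
    = rot a (\<theta> x) (partial i u x + partial i \<theta> x *\<^sub>R cross3 a (u x))"
proof -
  have lin: "partial i (\<lambda>x. cross3 a (u x)) x = cross3 a (partial i u x)" if "smooth u" for u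
    by (rule partial_linear[OF bounded_linear_cross3 smooth_differentiable[OF that]])
  have mul: "partial i (\<lambda>x. q x *\<^sub>R u x) x = q x *\<^sub>R partial i u x + partial i q x *\<^sub>R u x"
    if "smooth q" "smooth u" for q u
    by (rule partial_bilinear[OF bounded_bilinear_scaleR]) (use that smooth_differentiable in auto)
  have add: "partial i (\<lambda>x. p x + q x) x = partial i p x + partial i q x"
    if "smooth p" "smooth q" for p q :: "R3 \<Rightarrow> R3"
    by (rule partial_add) (use that smooth_differentiable in auto)
  show ?thesis unfolding rot_def[of a _ "u _"]
    by (simp add: add mul lin u \<theta> smooth_add smooth_scaleR smooth_sin smooth_1_minus_cos smooth_cross3
        rot_column_aux[OF a] partial_sin partial_1_minus_cos)
qed

text \<open>The classical counterpart of \<open>H1_loc_rot\<close>, for the smooth approximants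
  occurring in the definition of the trace. Both sides of the approximation then involve the same
  \<open>rot_gradient\<close>.\<close>

lemma jacobian_rot:
  assumes "norm a = 1" "smooth \<theta>" "smooth u"
  shows "jacobian (\<lambda>x. rot a (\<theta> x) (u x)) (at x) = rot_gradient a \<theta> u (\<lambda>x. jacobian u (at x)) x"
  by (rule matrix_eq_columns)
    (simp add: column_jacobian partial_rot[OF assms] rot_gradient_def grad_def)

lemma norm_rot_gradient: "norm a = 1 \<Longrightarrow> norm (rot_gradient a \<theta> n D x) = norm (D x + outer (cross3 a (n x)) (grad \<theta> x))"
  unfolding rot_gradient_def by (rule norm_orthogonal_matrix_mult) simp

text \<open>\<open>rot_gradient\<close> is linear in the pair of map and Jacobian, so the difference
  is the one formed from the differences, and the rotation disappears from the norm.\<close>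

lemma rot_gradient_diff:
  assumes "norm a = 1"
  shows "norm (rot_gradient a \<theta> u E x - rot_gradient a \<theta> n D x) = norm ((E x - D x) + outer (cross3 a (u x - n x)) (grad \<theta> x))"
proof -
  have "rot_gradient a \<theta> u E x - rot_gradient a \<theta> n D x = rot_gradient a \<theta> (\<lambda>x. u x - n x) (\<lambda>x. E x - D x) x"
    by (rule matrix_eq_columns)
      (simp add: rot_gradient_def Cross3.right_diff_distrib matrix_vector_mult_diff_distrib[symmetric] 
        linear_diff[OF linear_rot, symmetric] algebra_simps)
  then show ?thesis by (simp add: norm_rot_gradient[OF assms])
qed

text \<open>The approximants are rotated by the same angle field. Their distance to the map is
  unchanged, and the new term in the gradient error is controlled by that distance and the bound
  \<open>M\<close> on the gradient of the angle.\<close>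

lemma has_trace_rot:
  assumes G: "open G" and h: "has_trace G n g" and a: "norm a = 1" and \<theta>: "smooth \<theta>"
    and z: "\<And>x. x \<in> frontier G \<Longrightarrow> \<theta> x = 0" and M: "\<And>x. norm (grad \<theta> x) \<le> M"
  shows "has_trace G (\<lambda>x. rot a (\<theta> x) (n x)) g"
proof -
  from h obtain D u where D: "H1_loc G n D" and u: "\<And>k. smooth (u k)"
    and c: "\<And>r. (\<lambda>k. \<integral>\<^sup>+x. ennreal ((norm (u k x - n x))\<^sup>2 + (norm (jacobian (u k) (at x) - D x))\<^sup>2)
               \<partial>lebesgue_on (- G \<inter> ball 0 r)) \<longlonglongrightarrow> 0"
    and b: "(\<lambda>k. \<integral>\<^sup>+x. ennreal ((norm (u k x - g x))\<^sup>2) \<partial>surface_measure (frontier G)) \<longlonglongrightarrow> 0"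
    and g: "g \<in> H12 G"
    unfolding has_trace_def by blast
  define u' where "u' k x = rot a (\<theta> x) (u k x)" for k x
  define n' where "n' x = rot a (\<theta> x) (n x)" for x
  \<comment> \<open>The gradient error is at most 2 q^2 + 2 M^2 p^2 and the error of the map is p^2,
    with p and q the old errors; this constant dominates both coefficients.\<close>
  define C where "C = 2 + 2 * M\<^sup>2"
  have C: "C \<ge> 0" "C \<ge> 2" by (auto simp: C_def)
  have pt: "(norm (u' k x - n' x))\<^sup>2 + (norm (jacobian (u' k) (at x) - rot_gradient a \<theta> n D x))\<^sup>2
     \<le> C * ((norm (u k x - n x))\<^sup>2 + (norm (jacobian (u k) (at x) - D x))\<^sup>2)" for k x
  proof -
    let ?p = "norm (u k x - n x)" and ?q = "norm (jacobian (u k) (at x) - D x)"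
    have 1: "norm (u' k x - n' x) = ?p"
      using a by (simp add: u'_def n'_def linear_diff[OF linear_rot, symmetric])
    have "norm (outer (cross3 a (u k x - n x)) (grad \<theta> x)) \<le> ?p * M"
      unfolding norm_outer using norm_cross3_le[of a "u k x - n x"] M[of x] a
      by (intro mult_mono) auto
    then have "(norm (outer (cross3 a (u k x - n x)) (grad \<theta> x)))\<^sup>2 \<le> M\<^sup>2 * ?p\<^sup>2"
      using power_mono[of _ "?p * M" 2] by (fastforce simp: power_mult_distrib mult.commute)
    moreover have "(norm (jacobian (u' k) (at x) - rot_gradient a \<theta> n D x))\<^sup>2
      \<le> 2 * ?q\<^sup>2 + 2 * (norm (outer (cross3 a (u k x - n x)) (grad \<theta> x)))\<^sup>2"
      unfolding u'_def jacobian_rot[OF a \<theta> u] rot_gradient_diff[OF a] by (rule sum_squares_le)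
    ultimately have 2: "(norm (jacobian (u' k) (at x) - rot_gradient a \<theta> n D x))\<^sup>2 \<le> 2 * ?q\<^sup>2 + 2 * M\<^sup>2 * ?p\<^sup>2"
      by linarith
    have "0 \<le> 2 * (M\<^sup>2 * ?q\<^sup>2)" "0 \<le> ?p\<^sup>2" by simp_all
    with 1 2 show ?thesis unfolding C_def distrib_right distrib_left 1 by linarith
  qed
  have "(\<lambda>k. \<integral>\<^sup>+x. ennreal ((norm (u' k x - n' x))\<^sup>2 + (norm (jacobian (u' k) (at x) - rot_gradient a \<theta> n D x))\<^sup>2)
               \<partial>lebesgue_on (- G \<inter> ball 0 r)) \<longlonglongrightarrow> 0" for r
  proof (rule tendsto_sandwich[OF _ _ tendsto_const])
    let ?I = "\<lambda>k. \<integral>\<^sup>+x. ennreal ((norm (u k x - n x))\<^sup>2 + (norm (jacobian (u k) (at x) - D x))\<^sup>2)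
               \<partial>lebesgue_on (- G \<inter> ball 0 r)"
    have "(\<lambda>k. ennreal C * ?I k) \<longlonglongrightarrow> ennreal C * 0"
      by (intro ennreal_tendsto_cmult c) simp
    then show "(\<lambda>k. ennreal C * ?I k) \<longlonglongrightarrow> 0" by simp
    show "\<forall>\<^sub>F k in sequentially. (\<integral>\<^sup>+x. ennreal ((norm (u' k x - n' x))\<^sup>2 + (norm (jacobian (u' k) (at x) - rot_gradient a \<theta> n D x))\<^sup>2)
               \<partial>lebesgue_on (- G \<inter> ball 0 r)) \<le> ennreal C * ?I k"
    proof (intro always_eventually allI)
      fix k
      have [measurable]: "n \<in> borel_measurable (lebesgue_on (- G \<inter> ball 0 r))" "D \<in> borel_measurable (lebesgue_on (- G \<inter> ball 0 r))"
        using D measurable_on_inter unfolding H1_loc_def by blast+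
      have [measurable]: "u k \<in> borel_measurable (lebesgue_on (- G \<inter> ball 0 r))"
        by (intro measurable_continuous_lebesgue_on smooth_continuous_on u)
      have "jacobian (u k) (at x) = (\<Sum>i\<in>UNIV. outer (partial i (u k) x) (axis i 1))" for x
        by (rule matrix_eq_columns)
          (simp add: column_jacobian sum_3 axis_def, use exhaust_3 in blast)
      then have [measurable]: "(\<lambda>x. jacobian (u k) (at x)) \<in> borel_measurable (lebesgue_on (- G \<inter> ball 0 r))"
        by (simp, intro borel_measurable_sum measurable_linear[OF bounded_linear_outer_left]
            measurable_continuous_lebesgue_on smooth_continuous_on smooth_partial u)
      show "(\<integral>\<^sup>+x. ennreal ((norm (u' k x - n' x))\<^sup>2 + (norm (jacobian (u' k) (at x) - rot_gradient a \<theta> n D x))\<^sup>2)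
               \<partial>lebesgue_on (- G \<inter> ball 0 r)) \<le> ennreal C * ?I k"
      proof (subst nn_integral_cmult[symmetric], measurable, rule nn_integral_mono)
        fix x
        show "ennreal ((norm (u' k x - n' x))\<^sup>2 + (norm (jacobian (u' k) (at x) - rot_gradient a \<theta> n D x))\<^sup>2)
          \<le> ennreal C * ennreal ((norm (u k x - n x))\<^sup>2 + (norm (jacobian (u k) (at x) - D x))\<^sup>2)"
          using ennreal_leI[OF pt] C(1) by (metis ennreal_mult add_nonneg_nonneg zero_le_power2)
      qed
    qed
  qed simp
  moreover have "smooth (u' k)" for k unfolding u'_def by (rule smooth_rot[OF \<theta> u])
  \<comment> \<open>The angle is 0 on the frontier, so the approximants keep their boundary values
    there and \<open>g\<close> remains the trace.\<close>
  moreover have "(\<integral>\<^sup>+x. ennreal ((norm (u' k x - g x))\<^sup>2) \<partial>surface_measure (frontier G)) =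
      (\<integral>\<^sup>+x. ennreal ((norm (u k x - g x))\<^sup>2) \<partial>surface_measure (frontier G))" for k
    by (rule nn_integral_cong) (simp add: u'_def z surface_measure_def space_restrict_space)
  ultimately show ?thesis unfolding has_trace_def
    using H1_loc_rot[OF G D a \<theta>] g b unfolding n'_def
    by (intro conjI exI[of _ "rot_gradient a \<theta> n D"] exI[of _ u']) auto
qed

lemma H1_loc_sphere_rot:
  assumes "open G" "H1_loc_sphere G n D" "norm a = 1" "smooth \<theta>"
  shows "H1_loc_sphere G (\<lambda>x. rot a (\<theta> x) (n x)) (rot_gradient a \<theta> n D)"
  using assms H1_loc_rot by (auto simp: H1_loc_sphere_def)

text \<open>The third claim holds since the polynomial is the integral of a square; it permits
  undoing \<open>ennreal\<close> when energies are compared as real numbers.\<close>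

lemma nn_integral_energy:
  fixes D T :: "'x \<Rightarrow> 'b::euclidean_space"
  assumes m [measurable]: "D \<in> borel_measurable M" "T \<in> borel_measurable M"
    and D: "(\<integral>\<^sup>+x. ennreal ((norm (D x))\<^sup>2) \<partial>M) < \<infinity>" and T: "(\<integral>\<^sup>+x. ennreal ((norm (T x))\<^sup>2) \<partial>M) < \<infinity>"
  shows "(\<integral>\<^sup>+x. ennreal ((norm (D x + t *\<^sub>R T x))\<^sup>2) \<partial>M) =
     ennreal ((\<integral>x. (norm (D x))\<^sup>2 \<partial>M) + 2 * t * (\<integral>x. D x \<bullet> T x \<partial>M) + t\<^sup>2 * (\<integral>x. (norm (T x))\<^sup>2 \<partial>M))"
    and "integrable M (\<lambda>x. D x \<bullet> T x)"
    and "0 \<le> (\<integral>x. (norm (D x))\<^sup>2 \<partial>M) + 2 * t * (\<integral>x. D x \<bullet> T x \<partial>M) + t\<^sup>2 * (\<integral>x. (norm (T x))\<^sup>2 \<partial>M)"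
proof -
  have iD: "integrable M (\<lambda>x. (norm (D x))\<^sup>2)" using D by (intro integrableI_bounded) auto
  have iT: "integrable M (\<lambda>x. (norm (T x))\<^sup>2)" using T by (intro integrableI_bounded) auto
  show iDT: "integrable M (\<lambda>x. D x \<bullet> T x)"
  proof (rule Bochner_Integration.integrable_bound[OF Bochner_Integration.integrable_add[OF iD iT]])
    have "\<bar>D x \<bullet> T x\<bar> \<le> (norm (D x))\<^sup>2 + (norm (T x))\<^sup>2" for x
      using Cauchy_Schwarz_ineq2[of "D x" "T x"] sum_squares_bound[of "norm (D x)" "norm (T x)"]
        zero_le_power2[of "norm (D x)"] zero_le_power2[of "norm (T x)"] by linarith
    then show "AE x in M. norm (D x \<bullet> T x) \<le> norm ((norm (D x))\<^sup>2 + (norm (T x))\<^sup>2)" by simp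
  qed measurable
  have e: "(norm (D x + t *\<^sub>R T x))\<^sup>2 = (norm (D x))\<^sup>2 + 2 * t * (D x \<bullet> T x) + t\<^sup>2 * (norm (T x))\<^sup>2" for x
    unfolding power2_norm_eq_inner
    by (simp add: inner_add_left inner_add_right inner_commute[of "T x" "D x"] power2_eq_square[of t] algebra_simps)
  have "(\<integral>\<^sup>+x. ennreal ((norm (D x + t *\<^sub>R T x))\<^sup>2) \<partial>M) = ennreal (\<integral>x. (norm (D x + t *\<^sub>R T x))\<^sup>2 \<partial>M)"
  proof (rule nn_integral_eq_integral)
    show "integrable M (\<lambda>x. (norm (D x + t *\<^sub>R T x))\<^sup>2)" using iD iT iDT by (simp add: e)
  qed simp
  also have v: "(\<integral>x. (norm (D x + t *\<^sub>R T x))\<^sup>2 \<partial>M) = (\<integral>x. (norm (D x))\<^sup>2 \<partial>M) + 2 * t * (\<integral>x. D x \<bullet> T x \<partial>M) + t\<^sup>2 * (\<integral>x. (norm (T x))\<^sup>2 \<partial>M)"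
    using iD iT iDT by (simp add: e)
  finally show "(\<integral>\<^sup>+x. ennreal ((norm (D x + t *\<^sub>R T x))\<^sup>2) \<partial>M) =
     ennreal ((\<integral>x. (norm (D x))\<^sup>2 \<partial>M) + 2 * t * (\<integral>x. D x \<bullet> T x \<partial>M) + t\<^sup>2 * (\<integral>x. (norm (T x))\<^sup>2 \<partial>M))" .
  show "0 \<le> (\<integral>x. (norm (D x))\<^sup>2 \<partial>M) + 2 * t * (\<integral>x. D x \<bullet> T x \<partial>M) + t\<^sup>2 * (\<integral>x. (norm (T x))\<^sup>2 \<partial>M)"
    unfolding v[symmetric] by simp
qed

text \<open>Its inner product with the Jacobian is the gradient of the cutoff paired with the torque
  density. It is the first-order change of the gradient in the angle, up to the rotation in
  front.\<close>

definition torque :: "R3 \<Rightarrow> (R3 \<Rightarrow> R3) \<Rightarrow> (R3 \<Rightarrow> real) \<Rightarrow> R3 \<Rightarrow> real ^ 3 ^ 3" where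
  "torque a n \<phi> x = outer (cross3 a (n x)) (grad \<phi> x)"

lemma grad_cmult:
  assumes "smooth \<phi>" shows "grad (\<lambda>x. t * \<phi> x) x = t *\<^sub>R grad \<phi> x"
  by (simp add: grad_def vec_eq_iff partial_linear[OF bounded_linear_mult_right smooth_differentiable[OF assms]])

lemma outer_scaleR_right: "outer v (t *\<^sub>R w) = t *\<^sub>R outer v w"
  by (rule matrix_eq_columns) simp

lemma grad_bounded:
  assumes \<phi>: "smooth \<phi>" and z: "\<And>x. norm x > r \<Longrightarrow> grad \<phi> x = 0"
  shows "\<exists>M. \<forall>x. norm (grad \<phi> x) \<le> M"
proof -
  have "continuous_on UNIV (grad \<phi>)"
    unfolding grad_def[abs_def] by (intro continuous_on_vec_lambda smooth_continuous_on smooth_partial \<phi>)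
  then have "bounded (grad \<phi> ` cball 0 r)"
    by (intro compact_imp_bounded compact_continuous_image) (auto intro: continuous_on_subset)
  then obtain M where "\<And>x. norm x \<le> r \<Longrightarrow> norm (grad \<phi> x) \<le> M"
    unfolding bounded_iff by (metis image_eqI mem_cball_0)
  then have "norm (grad \<phi> x) \<le> max M 0" for x
    using z[of x] by (cases "norm x \<le> r") (auto simp: le_max_iff_disj)
  then show ?thesis by blast
qed

lemma torque_L2:
  assumes G: "open G" and h: "H1_loc G n D" and \<phi>: "smooth \<phi>" and z: "\<And>x. norm x \<ge> r \<Longrightarrow> grad \<phi> x = 0"
  shows "locL2 (- G) (torque a n \<phi>)" "(\<integral>\<^sup>+x. ennreal ((norm (torque a n \<phi> x))\<^sup>2) \<partial>lebesgue_on (- G)) < \<infinity>"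
proof -
  have n: "locL2 (- G) n"
    using h H1_loc_iff sets_compl[OF G] by auto
  have o: "torque a n \<phi> = (\<lambda>x. \<Sum>i\<in>UNIV. partial i \<phi> x *\<^sub>R outer (cross3 a (n x)) (axis i 1))"
    by (auto simp: torque_def fun_eq_iff outer_def grad_def vec_eq_iff axis_def sum_3 mult.commute forall_3)
  show l: "locL2 (- G) (torque a n \<phi>)"
    unfolding o sum_3
    by (intro locL2_add locL2_scale smooth_continuous_on smooth_partial \<phi>
        locL2_linear[OF bounded_linear_outer_left locL2_linear[OF bounded_linear_cross3 n]])
  have "(\<integral>\<^sup>+x. ennreal ((norm (torque a n \<phi> x))\<^sup>2) \<partial>lebesgue_on (- G)) =
     (\<integral>\<^sup>+x. ennreal ((norm (torque a n \<phi> x))\<^sup>2) \<partial>lebesgue_on (- G \<inter> ball 0 r))"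
    using sets_compl(1)[OF G] by (subst (1 2) nn_integral_restrict_space)
      (auto simp: indicator_def torque_def norm_outer z intro!: nn_integral_cong)
  also have "\<dots> < \<infinity>" using l by (simp add: locL2_def)
  finally show "(\<integral>\<^sup>+x. ennreal ((norm (torque a n \<phi> x))\<^sup>2) \<partial>lebesgue_on (- G)) < \<infinity>" .
qed

text \<open>Beyond the radius \<open>r\<close> the map and its limit are turned by the same angle,
  so their distance is unchanged. Inside, the distance is at most \<open>1 + norm n0\<close> on a
  region of finite measure.\<close>

lemma admissible_rot:
  assumes G: "open G" and h: "admissible G n0 n" and a: "norm a = 1" and \<phi>: "smooth \<phi>"
    and one: "\<And>x. norm x \<ge> r \<Longrightarrow> \<phi> x = 1" and z: "\<And>x. norm x \<ge> r \<Longrightarrow> grad \<phi> x = 0"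
  shows "admissible G (rot a t n0) (\<lambda>x. rot a (t * \<phi> x) (n x))"
proof -
  let ?\<theta> = "\<lambda>x. t * \<phi> x" and ?M = "lebesgue_on (- G)"
  have \<theta>: "smooth ?\<theta>" by (rule smooth_linear[OF bounded_linear_mult_right \<phi>])
  from h obtain D where D: "H1_loc_sphere G n D"
    and f: "(\<integral>\<^sup>+x. ennreal ((norm (n x - n0))\<^sup>2 / (1 + (norm x)\<^sup>2)) \<partial>?M) < \<infinity>"
      "(\<integral>\<^sup>+x. ennreal ((norm (D x))\<^sup>2) \<partial>?M) < \<infinity>"
    unfolding admissible_def by (auto simp: less_top)
  have D': "H1_loc G n D" and m [measurable]: "n \<in> borel_measurable ?M" "D \<in> borel_measurable ?M"
    and ae: "AE x in ?M. norm (n x) = 1"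
    using D by (auto simp: H1_loc_sphere_def H1_loc_def)
  have T: "locL2 (- G) (torque a n \<phi>)" "(\<integral>\<^sup>+x. ennreal ((norm (torque a n \<phi> x))\<^sup>2) \<partial>lebesgue_on (- G)) < \<infinity>"
    by (rule torque_L2[OF G D' \<phi>]; use z in blast)+
  have "(norm (rot_gradient a ?\<theta> n D x))\<^sup>2 = (norm (D x + t *\<^sub>R torque a n \<phi> x))\<^sup>2" for x
    by (simp add: norm_rot_gradient[OF a] torque_def grad_cmult[OF \<phi>] outer_scaleR_right)
  then have fin1: "(\<integral>\<^sup>+x. ennreal ((norm (rot_gradient a ?\<theta> n D x))\<^sup>2) \<partial>?M) < \<infinity>"
    using nn_integral_energy(1)[OF m(2) locL2_D[OF T(1)] f(2) T(2), of t]
    by simp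
  have "(\<integral>\<^sup>+x. ennreal ((norm (rot a (?\<theta> x) (n x) - rot a t n0))\<^sup>2 / (1 + (norm x)\<^sup>2)) \<partial>?M)
    \<le> (\<integral>\<^sup>+x. ennreal ((norm (n x - n0))\<^sup>2 / (1 + (norm x)\<^sup>2)) + ennreal ((1 + norm n0)\<^sup>2) * indicator (- G \<inter> ball 0 r) x \<partial>?M)"
  proof (rule nn_integral_mono_AE, use ae AE_space in eventually_elim)
    fix x assume n1: "norm (n x) = 1" and "x \<in> space ?M"
    then have xG: "x \<in> - G" by (simp add: space_restrict_space)
    show "ennreal ((norm (rot a (?\<theta> x) (n x) - rot a t n0))\<^sup>2 / (1 + (norm x)\<^sup>2))
      \<le> ennreal ((norm (n x - n0))\<^sup>2 / (1 + (norm x)\<^sup>2)) + ennreal ((1 + norm n0)\<^sup>2) * indicator (- G \<inter> ball 0 r) x"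
    proof (cases "norm x \<ge> r")
      case True
      then show ?thesis using one a by (simp add: linear_diff[OF linear_rot, symmetric] add_increasing2)
    next
      case False
      have "norm (rot a (?\<theta> x) (n x) - rot a t n0) \<le> 1 + norm n0"
        using norm_triangle_ineq4[of "rot a (?\<theta> x) (n x)" "rot a t n0"] a n1 by simp
      then have "(norm (rot a (?\<theta> x) (n x) - rot a t n0))\<^sup>2 \<le> (1 + norm n0)\<^sup>2"
        by (rule power_mono) simp
      also have "\<dots> \<le> (1 + norm n0)\<^sup>2 * (1 + (norm x)\<^sup>2)" by (simp add: algebra_simps)
      finally have "(norm (rot a (?\<theta> x) (n x) - rot a t n0))\<^sup>2 / (1 + (norm x)\<^sup>2) \<le> (1 + norm n0)\<^sup>2"
        by (simp add: divide_le_eq add_pos_nonneg)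
      then show ?thesis using False xG by (intro add_increasing) (auto intro: ennreal_leI)
    qed
  qed
  also have "\<dots> = (\<integral>\<^sup>+x. ennreal ((norm (n x - n0))\<^sup>2 / (1 + (norm x)\<^sup>2)) \<partial>?M) + ennreal ((1 + norm n0)\<^sup>2) * emeasure ?M (- G \<inter> ball 0 r)"
  proof -
    have [measurable]: "(\<lambda>x. (norm x)\<^sup>2) \<in> borel_measurable ?M"
      by (rule measurable_continuous_lebesgue_on) (intro continuous_intros)
    have "- G \<inter> ball 0 r \<in> sets ?M" using sets_compl(1)[OF G] by (simp add: sets_restrict_space_iff sets.Int)
    then show ?thesis by (simp add: nn_integral_add nn_integral_cmult)
  qed
  also have "\<dots> < \<infinity>" using f(1) emeasure_ball_lebesgue_on[OF sets_compl(1)[OF G]]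
    by (auto simp: ennreal_mult_less_top)
  finally show ?thesis using H1_loc_sphere_rot[OF G D a \<theta>] fin1
    unfolding admissible_def by (intro exI[of _ "rot_gradient a ?\<theta> n D"]) auto
qed

text \<open>The Jacobian is chosen before the cutoff, so that one and the same \<open>D\<close>
  serves the cutoffs of all scales in the later limit.\<close>

lemma Ehat_rot_le:
  assumes G: "open G" and h: "is_minimizer G F n0 n" and a: "norm a = 1"
  shows "\<exists>D. H1_loc_sphere G n D \<and> (\<integral>\<^sup>+x. ennreal ((norm (D x))\<^sup>2) \<partial>lebesgue_on (- G)) < \<infinity> \<and>
    (\<forall>\<phi> r. smooth \<phi> \<longrightarrow> (\<forall>x. norm x \<ge> r \<longrightarrow> \<phi> x = 1) \<longrightarrow> (\<forall>x. norm x \<ge> r \<longrightarrow> grad \<phi> x = 0) \<longrightarrow>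
       (\<forall>x\<in>frontier G. \<phi> x = 0) \<longrightarrow>
       (\<exists>C. \<forall>t. Ehat G F (rot a t n0) \<le> Ehat G F n0
          + 2 * t * (\<integral>x. D x \<bullet> torque a n \<phi> x \<partial>lebesgue_on (- G)) + t\<^sup>2 * C))"
proof -
  let ?M = "lebesgue_on (- G)"
  from h have adm: "admissible G n0 n" and "has_energy G F n (ennreal (Ehat G F n0))"
    by (auto simp: is_minimizer_def)
  then obtain D g where D: "H1_loc_sphere G n D" and tr: "has_trace G n g" and g: "g \<in> H12_sphere G"
    and e: "ennreal (Ehat G F n0) = (\<integral>\<^sup>+x. ennreal ((norm (D x))\<^sup>2) \<partial>?M) + F g"
    unfolding has_energy_def by blast
  have D': "H1_loc G n D" and m: "D \<in> borel_measurable ?M"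
    using D by (auto simp: H1_loc_sphere_def H1_loc_def)
  \<comment> \<open>The minimal energy is \<open>ennreal\<close> of a real number, so neither
    summand is infinite.\<close>
  have fin: "(\<integral>\<^sup>+x. ennreal ((norm (D x))\<^sup>2) \<partial>?M) < \<infinity>" "F g < \<infinity>"
    using e by (metis ennreal_less_top infinity_ennreal_def ennreal_add_eq_top less_top)+
  have 0: "(\<integral>\<^sup>+x. ennreal ((norm (D x))\<^sup>2) \<partial>?M) = ennreal (\<integral>x. (norm (D x))\<^sup>2 \<partial>?M)"
    using fin(1) m by (intro nn_integral_eq_integral integrableI_bounded) auto
  obtain f where f: "F g = ennreal f" "f \<ge> 0" using fin(2) by (cases "F g") auto
  have E0: "Ehat G F n0 = (\<integral>x. (norm (D x))\<^sup>2 \<partial>?M) + f"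
  proof -
    have "ennreal (Ehat G F n0) = ennreal ((\<integral>x. (norm (D x))\<^sup>2 \<partial>?M) + f)"
      using e f 0 by (simp add: ennreal_plus)
    then show ?thesis
      by (rule ennreal_inj[THEN iffD1, rotated 2]) (auto simp: Ehat_def f)
  qed
  {
    fix \<phi> r t
    assume \<phi>: "smooth \<phi>" and one: "\<forall>x. norm x \<ge> r \<longrightarrow> \<phi> x = 1" and z: "\<forall>x. norm x \<ge> r \<longrightarrow> grad \<phi> x = 0"
      and fr: "\<forall>x\<in>frontier G. \<phi> x = 0"
    have T: "locL2 (- G) (torque a n \<phi>)" "(\<integral>\<^sup>+x. ennreal ((norm (torque a n \<phi> x))\<^sup>2) \<partial>lebesgue_on (- G)) < \<infinity>"
    by (rule torque_L2[OF G D' \<phi>]; use z in blast)+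
    let ?\<theta> = "\<lambda>x. t * \<phi> x"
    let ?L = "(\<integral>x. D x \<bullet> torque a n \<phi> x \<partial>?M)" and ?C = "(\<integral>x. (norm (torque a n \<phi> x))\<^sup>2 \<partial>?M)"
    have \<theta>: "smooth ?\<theta>" by (rule smooth_linear[OF bounded_linear_mult_right \<phi>])
    have "\<exists>M. \<forall>x. norm (grad ?\<theta> x) \<le> M"
      by (rule grad_bounded[OF \<theta>, of r]) (use z grad_cmult[OF \<phi>] in auto)
    then obtain M where M: "\<And>x. norm (grad ?\<theta> x) \<le> M" by blast
    have tr': "has_trace G (\<lambda>x. rot a (?\<theta> x) (n x)) g"
      by (rule has_trace_rot[OF G tr a \<theta> _ M]) (use fr in auto)
    have adm': "admissible G (rot a t n0) (\<lambda>x. rot a (?\<theta> x) (n x))"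
      by (rule admissible_rot[OF G adm a \<phi>]) (use one z in auto)
    have "(norm (rot_gradient a ?\<theta> n D x))\<^sup>2 = (norm (D x + t *\<^sub>R torque a n \<phi> x))\<^sup>2" for x
      by (simp add: norm_rot_gradient[OF a] torque_def grad_cmult[OF \<phi>] outer_scaleR_right)
    then have en: "(\<integral>\<^sup>+x. ennreal ((norm (rot_gradient a ?\<theta> n D x))\<^sup>2) \<partial>?M)
       = ennreal ((\<integral>x. (norm (D x))\<^sup>2 \<partial>?M) + 2 * t * ?L + t\<^sup>2 * ?C)"
      using nn_integral_energy(1)[OF m locL2_D[OF T(1)] fin(1) T(2), of t]
      by simp
    have nonneg: "(\<integral>x. (norm (D x))\<^sup>2 \<partial>?M) + 2 * t * ?L + t\<^sup>2 * ?C \<ge> 0"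
      using nn_integral_energy(3)[OF m locL2_D[OF T(1)] fin(1) T(2), of t]
      by simp
    have "has_energy G F (\<lambda>x. rot a (?\<theta> x) (n x)) (ennreal (Ehat G F n0 + 2 * t * ?L + t\<^sup>2 * ?C))"
      unfolding has_energy_def
      using H1_loc_sphere_rot[OF G D a \<theta>] tr' g en f nonneg
      by (intro exI[of _ "rot_gradient a ?\<theta> n D"] exI[of _ g]) (simp add: E0 ennreal_plus[symmetric] algebra_simps del: ennreal_plus)
    then have "Inf {e. \<exists>n. admissible G (rot a t n0) n \<and> has_energy G F n e} \<le> ennreal (Ehat G F n0 + 2 * t * ?L + t\<^sup>2 * ?C)"
      using adm' by (intro Inf_lower) blast
    \<comment> \<open>\<open>enn2real\<close> sends infinity to 0 and is monotone only below it; the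
      competitor has finite energy.\<close>
    then have "enn2real (Inf {e. \<exists>n. admissible G (rot a t n0) n \<and> has_energy G F n e}) \<le> enn2real (ennreal (Ehat G F n0 + 2 * t * ?L + t\<^sup>2 * ?C))"
      by (rule enn2real_mono) simp
    then have "Ehat G F (rot a t n0) \<le> Ehat G F n0 + 2 * t * ?L + t\<^sup>2 * ?C"
      using nonneg f by (simp add: Ehat_def[of G F "rot a t n0"] E0)
  }
  then show ?thesis using D fin(1) by (intro exI[of _ D]) blast
qed

section \<open>Invariance under orthogonal maps\<close>

definition preserving :: "'a measure \<Rightarrow> ('a \<Rightarrow> 'a) \<Rightarrow> bool" where
  "preserving M T \<longleftrightarrow> T \<in> measurable M M \<and> distr M M T = M"

lemma preserving_restrict:
  assumes "preserving M T" "S \<in> sets M" "\<And>x. T x \<in> S \<longleftrightarrow> x \<in> S"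
  shows "preserving (restrict_space M S) T"
  unfolding preserving_def
proof
  have m: "T \<in> measurable M M" and d: "distr M M T = M" using assms(1) by (auto simp: preserving_def)
  show r: "T \<in> measurable (restrict_space M S) (restrict_space M S)"
    by (rule measurable_restrict_space3[OF m]) (use assms(3) in auto)
  have S: "S \<subseteq> space M" using sets.sets_into_space[OF assms(2)] .
  show "distr (restrict_space M S) (restrict_space M S) T = restrict_space M S"
  proof (rule measure_eqI)
    fix A assume "A \<in> sets (distr (restrict_space M S) (restrict_space M S) T)"
    then have A: "A \<in> sets (restrict_space M S)" by simp
    then have A': "A \<in> sets M" "A \<subseteq> S" using assms(2) by (auto simp: sets_restrict_space_iff)
    have "emeasure (distr (restrict_space M S) (restrict_space M S) T) A
        = emeasure (restrict_space M S) (T -` A \<inter> space (restrict_space M S))"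
      by (rule emeasure_distr[OF r A])
    also have "T -` A \<inter> space (restrict_space M S) = T -` A \<inter> space M"
      using A'(2) assms(3) S by (auto simp: space_restrict_space)
    also have "emeasure (restrict_space M S) (T -` A \<inter> space M) = emeasure M (T -` A \<inter> space M)"
      using A'(2) assms by (intro emeasure_restrict_space) auto
    also have "\<dots> = emeasure (distr M M T) A" by (rule emeasure_distr[OF m A'(1), symmetric])
    also have "\<dots> = emeasure M A" by (simp add: d)
    also have "\<dots> = emeasure (restrict_space M S) A"
      using A'(2) assms by (intro emeasure_restrict_space[symmetric]) auto
    finally show "emeasure (distr (restrict_space M S) (restrict_space M S) T) A = emeasure (restrict_space M S) A" .
  qed simp
qed

lemma AE_preserving: "preserving M T \<Longrightarrow> AE x in M. P x \<Longrightarrow> AE x in M. P (T x)"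
  unfolding preserving_def by (metis AE_distrD)

lemma measurable_preserving: "preserving M T \<Longrightarrow> f \<in> measurable M N \<Longrightarrow> (\<lambda>x. f (T x)) \<in> measurable M N"
  unfolding preserving_def by (metis measurable_compose)

lemma integral_preserving:
  fixes f :: "'a \<Rightarrow> 'b::{banach, second_countable_topology}"
  assumes "preserving M T" "f \<in> borel_measurable M"
  shows "(\<integral>x. f (T x) \<partial>M) = (\<integral>x. f x \<partial>M)"
  using assms integral_distr[of T M M f] by (simp add: preserving_def)

text \<open>No measurability of the integrand is required, because an invertible measure preserving
  map also permutes the simple functions below it. This matters for the Gagliardo seminorm, whose
  inner integral need not be measurable.\<close>

lemma nn_integral_preserving:
  assumes T: "preserving M T" and T': "preserving M T'"
    and inv: "\<And>x. T (T' x) = x" "\<And>x. T' (T x) = x"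
  shows "(\<integral>\<^sup>+x. f (T x) \<partial>M) = (\<integral>\<^sup>+x. f x \<partial>M)"
proof -
  have le: "(\<integral>\<^sup>+x. h x \<partial>M) \<le> (\<integral>\<^sup>+x. h (S x) \<partial>M)" if S: "preserving M S" for h S
    unfolding nn_integral_def[of M h]
  proof (rule SUP_least)
    fix g assume "g \<in> {g. simple_function M g \<and> g \<le> h}"
    then have g: "simple_function M g" "g \<le> h" by auto
    have "integral\<^sup>S M g = (\<integral>\<^sup>+x. g x \<partial>M)" using g(1) by (rule nn_integral_eq_simple_integral[symmetric])
    also have "\<dots> = (\<integral>\<^sup>+x. g x \<partial>distr M M S)" using S by (simp add: preserving_def)
    also have "\<dots> = (\<integral>\<^sup>+x. g (S x) \<partial>M)"
      using S g(1) by (intro nn_integral_distr) (auto simp: preserving_def borel_measurable_simple_function)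
    also have "\<dots> \<le> (\<integral>\<^sup>+x. h (S x) \<partial>M)" using g(2) by (intro nn_integral_mono) (auto simp: le_fun_def)
    finally show "integral\<^sup>S M g \<le> (\<integral>\<^sup>+x. h (S x) \<partial>M)" .
  qed
  show ?thesis using le[OF T, of f] le[OF T', of "\<lambda>x. f (T x)"] inv by (intro antisym) simp_all
qed

text \<open>Borel measures of this kind are determined by boxes. The preimage of a box under
  \<open>T\<close> is its image under the inverse, which has the same volume; the statement then
  passes to the completion.\<close>

lemma preserving_lebesgue:
  fixes T :: "R3 \<Rightarrow> R3"
  assumes T: "orthogonal_transformation T" and T': "orthogonal_transformation T'"
    and inv: "\<And>x. T (T' x) = x" "\<And>x. T' (T x) = x"
  shows "preserving lebesgue T"
proof -
  have c: "continuous_on UNIV T"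
    using T orthogonal_transformation_linear linear_conv_bounded_linear linear_continuous_on by blast
  then have [measurable]: "T \<in> borel_measurable borel" by (rule borel_measurable_continuous_onI)
  have b: "distr lborel lborel T = lborel"
  proof (rule lborel_eqI[symmetric])
    fix l u :: R3 assume le: "\<And>b. b \<in> Basis \<Longrightarrow> l \<bullet> b \<le> u \<bullet> b"
    have e: "T -` box l u = T' ` box l u" using inv by (auto simp: image_iff) (metis inv(2))
    have m: "T' ` box l u \<in> lmeasurable" and v: "measure lebesgue (T' ` box l u) = measure lebesgue (box l u)"
      by (rule measurable_orthogonal_image[OF T'] measure_orthogonal_image[OF T']; simp)+
    have "emeasure (distr lborel lborel T) (box l u) = emeasure lborel (T' ` box l u)"
      by (subst emeasure_distr) (auto simp: e[symmetric])
    also have "\<dots> = emeasure lebesgue (T' ` box l u)"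
      unfolding e[symmetric] by (simp add: measurable_sets_borel[of T borel])
    also have "\<dots> = ennreal (measure lebesgue (box l u))"
      using emeasure_eq_measure2[OF m] v by simp
    also have "\<dots> = emeasure lborel (box l u)"
      using emeasure_eq_ennreal_measure[of lborel "box l u"] emeasure_lborel_box_finite[of l u] by simp
    also have "\<dots> = (\<Prod>b\<in>Basis. (u - l) \<bullet> b)" using le by (rule emeasure_lborel_box)
    finally show "emeasure (distr lborel lborel T) (box l u) = (\<Prod>b\<in>Basis. (u - l) \<bullet> b)" .
  qed simp
  have d: "distr lebesgue lborel T = lborel" using b by (simp add: distr_completion)
  have m: "T \<in> lebesgue \<rightarrow>\<^sub>M lborel" by (rule measurable_completion) simp
  have "T \<in> lebesgue \<rightarrow>\<^sub>M lebesgue"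
    by (rule completion.measurable_completion2[OF m]) (simp add: d)
  moreover have "distr lebesgue lebesgue T = lebesgue"
    using completion.completion_distr_eq[OF m] by (simp add: d)
  ultimately show ?thesis by (simp add: preserving_def)
qed

text \<open>Isometries carry covers to covers with the same diameters. The inverse isometry later
  supplies the opposite inequality.\<close>

lemma hausdorff2_pre_image_le:
  assumes "\<And>x y. dist (T x) (T y) = dist x y"
  shows "hausdorff2_pre \<delta> (T ` A) \<le> hausdorff2_pre \<delta> A"
  unfolding hausdorff2_pre_def
proof (rule INF_greatest)
  fix C :: "nat \<Rightarrow> R3 set" assume C: "C \<in> {C. A \<subseteq> (\<Union>i. C i) \<and> (\<forall>i. bounded (C i) \<and> diameter (C i) \<le> \<delta>)}"
  have d: "diameter (T ` S) = diameter S" for S :: "R3 set"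
  proof -
    have "(\<lambda>(x, y). dist x y) ` (T ` S \<times> T ` S) = (\<lambda>(x, y). dist x y) ` (S \<times> S)"
      using assms by (force simp: image_iff)
    then show ?thesis by (simp add: diameter_def)
  qed
  have b: "bounded (T ` S)" if B: "bounded S" for S :: "R3 set"
  proof -
    obtain a e where "\<forall>y\<in>S. dist a y \<le> e" using B by (auto simp: bounded_def)
    then have "\<forall>y\<in>T ` S. dist (T a) y \<le> e" by (auto simp: assms)
    then show ?thesis unfolding bounded_def by blast
  qed
  show "(INF C\<in>{C. T ` A \<subseteq> (\<Union>i. C i) \<and> (\<forall>i. bounded (C i) \<and> diameter (C i) \<le> \<delta>)}.
        \<Sum>i. ennreal (pi / 4 * (diameter (C i))\<^sup>2)) \<le> (\<Sum>i. ennreal (pi / 4 * (diameter (C i))\<^sup>2))"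
  proof (rule INF_lower2[where i="\<lambda>i. T ` C i"])
    have "T ` A \<subseteq> (\<Union>i. T ` C i)" using C by blast
    then show "(\<lambda>i. T ` C i) \<in> {C. T ` A \<subseteq> (\<Union>i. C i) \<and> (\<forall>i. bounded (C i) \<and> diameter (C i) \<le> \<delta>)}"
      using C d b by simp
  qed (simp add: d)
qed

lemma hausdorff2_outer_image:
  assumes T: "\<And>x y. dist (T x) (T y) = dist x y" and T': "\<And>x y. dist (T' x) (T' y) = dist x y"
    and inv: "\<And>x. T' (T x) = x"
  shows "hausdorff2_outer (T ` A) = hausdorff2_outer A"
proof -
  have "T' ` T ` A = A" using inv by (auto simp: image_iff)
  then have "hausdorff2_pre \<delta> (T ` A) = hausdorff2_pre \<delta> A" for \<delta>
    using hausdorff2_pre_image_le[of T \<delta> A, OF T] hausdorff2_pre_image_le[of T' \<delta> "T ` A", OF T'] by (intro antisym) simp_all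
  then show ?thesis by (simp add: hausdorff2_outer_def)
qed

lemma sets_hausdorff2 [simp]: "sets hausdorff2 = sets borel"
  and space_hausdorff2 [simp]: "space hausdorff2 = UNIV"
proof -
  show "sets hausdorff2 = sets borel"
    unfolding hausdorff2_def using sets.sigma_sets_eq[of "borel :: R3 measure"]
    by (subst sets_measure_of) auto
  show "space hausdorff2 = UNIV"
    unfolding hausdorff2_def by (rule space_measure_of) auto
qed

lemma preserving_hausdorff2:
  assumes T: "\<And>x y. dist (T x) (T y) = dist x y" and T': "\<And>x y. dist (T' x) (T' y) = dist x y"
    and inv: "\<And>x. T (T' x) = x" "\<And>x. T' (T x) = x"
  shows "preserving hausdorff2 T"
  unfolding preserving_def
proof
  have "continuous_on UNIV T"
    using T by (auto simp: continuous_on_iff)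
  then have "T \<in> borel_measurable borel" by (rule borel_measurable_continuous_onI)
  then show m: "T \<in> measurable hausdorff2 hausdorff2"
    using measurable_cong_sets[OF sets_hausdorff2 sets_hausdorff2] by blast
  show "distr hausdorff2 hausdorff2 T = hausdorff2"
  proof (rule measure_eqI)
    fix A assume "A \<in> sets (distr hausdorff2 hausdorff2 T)"
    then have A: "A \<in> sets hausdorff2" by simp
    have "T -` A \<inter> space hausdorff2 = T' ` A" using inv by (auto simp: image_iff) (metis inv(2))
    moreover have "T -` A \<inter> space hausdorff2 \<in> sets hausdorff2" by (rule measurable_sets[OF m A])
    ultimately have B: "T' ` A \<in> sets borel" "emeasure (distr hausdorff2 hausdorff2 T) A = emeasure hausdorff2 (T' ` A)"
      using emeasure_distr[OF m A] by simp_all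
    \<comment> \<open>\<open>measure_of\<close> returns either the outer measure or the default 0.
      In both cases a set and its isometric image receive the same value.\<close>
    have "emeasure hausdorff2 B = (if measure_space UNIV (sigma_sets UNIV (sets borel)) hausdorff2_outer then hausdorff2_outer B else 0)"
      if "B \<in> sets borel" for B
      using that unfolding hausdorff2_def by (subst emeasure_measure_of_conv) auto
    then show "emeasure (distr hausdorff2 hausdorff2 T) A = emeasure hausdorff2 A"
      using A B hausdorff2_outer_image[of T' T A, OF T' T inv(1)] by simp
  qed simp
qed

section \<open>Conjugation of maps by an orthogonal matrix\<close>

context
  fixes R P :: "real ^ 3 ^ 3"
  assumes R: "orthogonal_matrix R" and P: "P = transpose R"
begin

lemma PR [simp]: "P *v (R *v x) = x" and RP [simp]: "R *v (P *v x) = x"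
  using R unfolding P orthogonal_matrix_def by (simp_all only: matrix_vector_mul_assoc matrix_vector_mul_lid)

lemma orthogonal_PR: "orthogonal_transformation ((*v) P)" "orthogonal_transformation ((*v) R)"
  using R by (simp_all add: P orthogonal_matrix_transpose orthogonal_transformation_matrix matrix_of_matrix_vector_mul del: transpose_matrix_vector)

lemma norm_PR [simp]: "norm (P *v x) = norm x" "norm (R *v x) = norm x"
  using orthogonal_PR by (simp_all add: orthogonal_transformation)

lemma dist_PR [simp]: "dist (P *v x) (P *v y) = dist x y" "dist (R *v x) (R *v y) = dist x y"
  by (simp_all add: dist_norm matrix_vector_mult_diff_distrib[symmetric])

lemma bounded_linear_PR: "bounded_linear ((*v) P)" "bounded_linear ((*v) R)"
  by (simp_all add: matrix_vector_mul_bounded_linear)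

lemma preserving_PR:
  "preserving lebesgue ((*v) P)" "preserving lebesgue ((*v) R)"
  "preserving hausdorff2 ((*v) P)" "preserving hausdorff2 ((*v) R)"
  by (rule preserving_lebesgue[where T'="(*v) R"] preserving_lebesgue[where T'="(*v) P"]
      preserving_hausdorff2[where T'="(*v) R"] preserving_hausdorff2[where T'="(*v) P"]; simp add: orthogonal_PR)+

definition conj_map :: "(R3 \<Rightarrow> R3) \<Rightarrow> R3 \<Rightarrow> R3" where
  "conj_map n x = R *v n (P *v x)"

text \<open>The chain rule for \<open>conj_map\<close>: the inner map contributes \<open>P\<close>
  on the right, the outer one \<open>R\<close> on the left.\<close>

definition conj_grad :: "(R3 \<Rightarrow> real ^ 3 ^ 3) \<Rightarrow> R3 \<Rightarrow> real ^ 3 ^ 3" where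
  "conj_grad D x = R ** D (P *v x) ** P"

text \<open>The Frobenius norm is invariant under transposition, which turns the factor
  \<open>P\<close> on the right into a factor \<open>R\<close> on the left, where orthogonality acts
  column by column.\<close>

lemma norm_conj_grad [simp]: "norm (conj_grad D x) = norm (D (P *v x))"
proof -
  have t: "norm (transpose A) = norm A" for A :: "real ^ 3 ^ 3"
    by (simp add: norm_eq_sqrt_inner inner_vec_def transpose_def) (rule sum.swap)
  have "norm (conj_grad D x) = norm (D (P *v x) ** P)"
    unfolding conj_grad_def matrix_mul_assoc[symmetric] by (rule norm_orthogonal_matrix_mult) simp
  also have "\<dots> = norm (R ** transpose (D (P *v x)))"
    using t[of "D (P *v x) ** P"] by (simp add: matrix_transpose_mul P)
  also have "\<dots> = norm (D (P *v x))"
    by (subst norm_orthogonal_matrix_mult) (simp_all add: t)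
  finally show ?thesis .
qed

lemma conj_grad_diff: "conj_grad D x - conj_grad E x = conj_grad (\<lambda>x. D x - E x) x"
  by (rule matrix_eq_columns) (simp add: conj_grad_def matrix_vector_mult_diff_distrib matrix_vector_mult_diff_rdistrib flip: matrix_vector_mul_assoc)

lemma column_conj_grad: "column i (conj_grad D x) = R *v (\<Sum>j\<in>UNIV. R $ i $ j *\<^sub>R column j (D (P *v x)))"
proof -
  have "D y *v column i P = (\<Sum>j\<in>UNIV. R $ i $ j *\<^sub>R column j (D y))" for y
    by (simp add: matrix_mult_sum P column_def transpose_def scalar_mult_eq_scaleR)
  then show ?thesis by (simp add: conj_grad_def flip: matrix_vector_mul_assoc)
qed

lemma invariant_image:
  assumes "\<And>x. P *v x \<in> S \<longleftrightarrow> x \<in> S" shows "(*v) P ` S = S"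
proof -
  have "x \<in> (*v) P ` S" if "x \<in> S" for x
    by (rule image_eqI[of _ _ "R *v x"]) (use assms[of "R *v x"] that in auto)
  then show ?thesis using assms by auto
qed

lemma inj_P: "inj ((*v) P)" by (rule inj_on_inverseI[of _ "(*v) R"]) simp

lemma invariant_interior:
  assumes "\<And>x. P *v x \<in> S \<longleftrightarrow> x \<in> S" shows "P *v x \<in> interior S \<longleftrightarrow> x \<in> interior S"
proof -
  have "(*v) P ` interior S = interior S"
    using interior_injective_linear_image[of "(*v) P" S] inj_P invariant_image[OF assms] by simp
  then show ?thesis using inj_image_mem_iff[OF inj_P, of x "interior S"] by simp
qed

lemma invariant_frontier:
  assumes "\<And>x. P *v x \<in> S \<longleftrightarrow> x \<in> S" shows "P *v x \<in> frontier S \<longleftrightarrow> x \<in> frontier S"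
proof -
  have "P *v x \<in> interior (- S) \<longleftrightarrow> x \<in> interior (- S)"
    by (rule invariant_interior) (use assms in auto)
  then show ?thesis
    using invariant_interior[OF assms] by (simp add: frontier_def closure_interior)
qed

lemma preserving_lebesgue_on:
  assumes "S \<in> sets lebesgue" "\<And>x. P *v x \<in> S \<longleftrightarrow> x \<in> S"
  shows "preserving (lebesgue_on S) ((*v) P)" "preserving (lebesgue_on S) ((*v) R)"
proof -
  have "R *v x \<in> S \<longleftrightarrow> x \<in> S" for x using assms(2)[of "R *v x"] by simp
  then show "preserving (lebesgue_on S) ((*v) P)" "preserving (lebesgue_on S) ((*v) R)"
    using preserving_restrict preserving_PR assms by blast+
qed

lemma preserving_surface:
  assumes "S \<in> sets borel" "\<And>x. P *v x \<in> S \<longleftrightarrow> x \<in> S"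
  shows "preserving (surface_measure S) ((*v) P)" "preserving (surface_measure S) ((*v) R)"
proof -
  have "R *v x \<in> S \<longleftrightarrow> x \<in> S" for x using assms(2)[of "R *v x"] by simp
  then show "preserving (surface_measure S) ((*v) P)" "preserving (surface_measure S) ((*v) R)"
    unfolding surface_measure_def using preserving_restrict preserving_PR assms sets_hausdorff2 by blast+
qed

lemma nn_integral_lebesgue_on_P:
  assumes "S \<in> sets lebesgue" "\<And>x. P *v x \<in> S \<longleftrightarrow> x \<in> S"
  shows "(\<integral>\<^sup>+x. f (P *v x) \<partial>lebesgue_on S) = (\<integral>\<^sup>+x. f x \<partial>lebesgue_on S)"
  by (rule nn_integral_preserving[OF preserving_lebesgue_on[OF assms]]) simp_all

lemma nn_integral_surface_P:
  assumes "S \<in> sets borel" "\<And>x. P *v x \<in> S \<longleftrightarrow> x \<in> S"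
  shows "(\<integral>\<^sup>+x. f (P *v x) \<partial>surface_measure S) = (\<integral>\<^sup>+x. f x \<partial>surface_measure S)"
  by (rule nn_integral_preserving[OF preserving_surface[OF assms]]) simp_all

lemma locL2_compose_P:
  assumes S: "S \<in> sets lebesgue" "\<And>x. P *v x \<in> S \<longleftrightarrow> x \<in> S" and f: "locL2 S f"
  shows "locL2 S (\<lambda>x. f (P *v x))"
  unfolding locL2_def
proof (intro conjI allI)
  show "(\<lambda>x. f (P *v x)) \<in> borel_measurable (lebesgue_on S)"
    by (rule measurable_preserving[OF preserving_lebesgue_on(1)[OF S] locL2_D[OF f]])
  fix r
  show "(\<integral>\<^sup>+x. ennreal ((norm (f (P *v x)))\<^sup>2) \<partial>lebesgue_on (S \<inter> ball 0 r)) < \<infinity>"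
    using nn_integral_lebesgue_on_P[of "S \<inter> ball 0 r" "\<lambda>x. ennreal ((norm (f x))\<^sup>2)"] S f
    by (simp add: locL2_def sets.Int)
qed

lemma test_functions_compose_R:
  assumes U: "\<And>x. P *v x \<in> U \<longleftrightarrow> x \<in> U" and \<psi>: "\<psi> \<in> test_functions U"
  shows "(\<lambda>x. \<psi> (R *v x)) \<in> test_functions U"
proof -
  have e: "{x. \<psi> (R *v x) \<noteq> 0} = (*v) P ` {x. \<psi> x \<noteq> 0}" 
  proof -
    have "x \<in> (*v) P ` {x. \<psi> x \<noteq> 0}" if "\<psi> (R *v x) \<noteq> 0" for x
      by (rule image_eqI[of _ _ "R *v x"]) (use that in auto)
    then show ?thesis by auto
  qed
  have c: "closure {x. \<psi> (R *v x) \<noteq> 0} = (*v) P ` closure {x. \<psi> x \<noteq> 0}"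
    unfolding e by (rule closure_injective_linear_image[symmetric]) (use inj_P in auto)
  have "smooth (\<lambda>x. \<psi> (R *v x))"
    using smooth_compose_linear[OF bounded_linear_PR(2)] test_functionsD(1)[OF \<psi>] .
  moreover have "compact ((*v) P ` closure {x. \<psi> x \<noteq> 0})"
    by (intro compact_continuous_image linear_continuous_on bounded_linear_PR) (use \<psi> in \<open>auto simp: test_functions_def\<close>)
  moreover have "(*v) P ` closure {x. \<psi> x \<noteq> 0} \<subseteq> U" using \<psi> U by (auto simp: test_functions_def)
  ultimately show ?thesis by (simp only: test_functions_def mem_Collect_eq c)
qed

text \<open>The identity for \<open>n\<close> is tested with the test function composed with
  \<open>R\<close>, and the variables are changed by \<open>P\<close>. Orthogonality recovers the
  original partial derivatives from those of the composition.\<close>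

lemma weak_gradient_conj:
  assumes U: "U \<in> sets lebesgue" "\<And>x. P *v x \<in> U \<longleftrightarrow> x \<in> U" and n: "locL2 U n" and D: "locL2 U D"
    and w: "has_weak_gradient U n D"
  shows "has_weak_gradient U (conj_map n) (conj_grad D)"
  unfolding has_weak_gradient_def
proof (intro ballI allI)
  fix \<psi> i assume \<psi>: "\<psi> \<in> test_functions U"
  define \<psi>' where "\<psi>' = (\<lambda>x. \<psi> (R *v x))"
  have t: "\<psi>' \<in> test_functions U" unfolding \<psi>'_def by (rule test_functions_compose_R[OF U(2) \<psi>])
  have c: "bounded_linear (\<lambda>A::real^3^3. column j A)" for j
    by (intro linear_conv_bounded_linear[THEN iffD1] linearI; simp)
  have i1: "integrable (lebesgue_on U) (\<lambda>x. partial j \<psi>' x *\<^sub>R n x)" for j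
    by (rule test_integrable[OF test_functions_partial[OF t] U(1) n])
  have i2: "integrable (lebesgue_on U) (\<lambda>x. \<psi>' x *\<^sub>R column j (D x))" for j
    by (rule test_integrable[OF t U(1) locL2_linear[OF c D]])
  have p': "partial j \<psi>' y = (\<Sum>k\<in>UNIV. R $ k $ j * partial k \<psi> (R *v y))" for j y
    unfolding \<psi>'_def
    by (subst partial_compose_linear(1)[OF bounded_linear_PR(2) smooth_differentiable[OF test_functionsD(1)[OF \<psi>]]])
      (simp add: matrix_vector_mult_basis column_def)
  have "(\<Sum>j\<in>UNIV. R $ i $ j * partial j \<psi>' y) = partial i \<psi> (R *v y)" for y
  proof -
    \<comment> \<open>The gradient of the composed test function is \<open>P *v v\<close>, so
      applying \<open>R\<close> returns \<open>v\<close>.\<close>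
    define v where "v = (\<chi> k. partial k \<psi> (R *v y))"
    have vk: "v $ k = partial k \<psi> (R *v y)" for k by (simp add: v_def)
    have "partial j \<psi>' y = (P *v v) $ j" for j
      unfolding p' vk[symmetric] by (simp add: P matrix_vector_mult_def transpose_def del: transpose_matrix_vector)
    then have "(\<Sum>j\<in>UNIV. R $ i $ j * partial j \<psi>' y) = (R *v (P *v v)) $ i"
      by (simp add: matrix_vector_mult_def[of R "P *v v"] del: RP)
    then show ?thesis by (simp add: vk)
  qed
  then have p: "partial i \<psi> (R *v y) *\<^sub>R (R *v n y) = R *v (\<Sum>j\<in>UNIV. R $ i $ j *\<^sub>R (partial j \<psi>' y *\<^sub>R n y))" for y
    by (simp add: scaleR_sum_left[symmetric] matrix_vector_mult_scaleR)
  have I1: "integrable (lebesgue_on U) (\<lambda>y. \<Sum>j\<in>UNIV. R $ i $ j *\<^sub>R (partial j \<psi>' y *\<^sub>R n y))"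
    by (intro Bochner_Integration.integrable_sum integrable_scaleR_right i1)
  have I2: "integrable (lebesgue_on U) (\<lambda>y. \<Sum>j\<in>UNIV. R $ i $ j *\<^sub>R (\<psi>' y *\<^sub>R column j (D y)))"
    by (intro Bochner_Integration.integrable_sum integrable_scaleR_right i2)
  have "(\<integral>x. partial i \<psi> x *\<^sub>R conj_map n x \<partial>lebesgue_on U)
     = (\<integral>x. (\<lambda>y. R *v (\<Sum>j\<in>UNIV. R $ i $ j *\<^sub>R (partial j \<psi>' y *\<^sub>R n y))) (P *v x) \<partial>lebesgue_on U)"
    by (simp add: conj_map_def p[symmetric] del: scaleR_scaleR)
  also have "\<dots> = (\<integral>y. R *v (\<Sum>j\<in>UNIV. R $ i $ j *\<^sub>R (partial j \<psi>' y *\<^sub>R n y)) \<partial>lebesgue_on U)"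
    by (rule integral_preserving[OF preserving_lebesgue_on(1)[OF U]])
      (intro measurable_linear[OF bounded_linear_PR(2)] borel_measurable_integrable I1)
  also have "\<dots> = R *v (\<Sum>j\<in>UNIV. R $ i $ j *\<^sub>R (\<integral>y. partial j \<psi>' y *\<^sub>R n y \<partial>lebesgue_on U))"
    using i1 by (simp add: integral_bounded_linear[OF bounded_linear_PR(2) I1] del: scaleR_scaleR)
  also have "\<dots> = R *v (\<Sum>j\<in>UNIV. R $ i $ j *\<^sub>R - (\<integral>y. \<psi>' y *\<^sub>R column j (D y) \<partial>lebesgue_on U))"
    using w t by (simp add: has_weak_gradient_def)
  also have "\<dots> = - (\<integral>y. R *v (\<Sum>j\<in>UNIV. R $ i $ j *\<^sub>R (\<psi>' y *\<^sub>R column j (D y))) \<partial>lebesgue_on U)"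
    using i2 by (simp add: integral_bounded_linear[OF bounded_linear_PR(2) I2] sum_negf linear_neg del: scaleR_scaleR)
  also have "(\<integral>y. R *v (\<Sum>j\<in>UNIV. R $ i $ j *\<^sub>R (\<psi>' y *\<^sub>R column j (D y))) \<partial>lebesgue_on U)
     = (\<integral>x. (\<lambda>y. R *v (\<Sum>j\<in>UNIV. R $ i $ j *\<^sub>R (\<psi>' y *\<^sub>R column j (D y)))) (P *v x) \<partial>lebesgue_on U)"
    by (rule integral_preserving[OF preserving_lebesgue_on(1)[OF U], symmetric])
      (intro measurable_linear[OF bounded_linear_PR(2)] borel_measurable_integrable I2)
  also have "\<dots> = (\<integral>x. \<psi> x *\<^sub>R column i (conj_grad D x) \<partial>lebesgue_on U)"
    unfolding column_conj_grad
    by (simp add: \<psi>'_def matrix_vector_mult_scaleR[symmetric] scaleR_sum_right mult.commute)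
  finally show "(\<integral>x. partial i \<psi> x *\<^sub>R conj_map n x \<partial>lebesgue_on U) = - (\<integral>x. \<psi> x *\<^sub>R column i (conj_grad D x) \<partial>lebesgue_on U)" .
qed

text \<open>The Gagliardo kernel depends only on distances, in the domain and in the target. The
  substitution is made in the inner integral for each fixed outer point and then in the outer
  one.\<close>

lemma H12_norm_sq_conj:
  assumes "\<And>x. P *v x \<in> G \<longleftrightarrow> x \<in> G"
  shows "H12_norm_sq G (conj_map f) = H12_norm_sq G f"
proof -
  let ?M = "surface_measure (frontier G)"
  note inv = nn_integral_surface_P[OF borel_closed[OF frontier_closed] invariant_frontier[OF assms]]
  have "norm (conj_map f x - conj_map f y) = norm (f (P *v x) - f (P *v y))" for x y
    by (simp add: conj_map_def matrix_vector_mult_diff_distrib[symmetric])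
  then have "(\<integral>\<^sup>+y. ennreal ((norm (conj_map f x - conj_map f y))\<^sup>2 / (dist x y) ^ 3) \<partial>?M)
    = (\<integral>\<^sup>+y. ennreal ((norm (f (P *v x) - f y))\<^sup>2 / (dist (P *v x) y) ^ 3) \<partial>?M)" for x
    using inv[of "\<lambda>y. ennreal ((norm (f (P *v x) - f y))\<^sup>2 / (dist (P *v x) y) ^ 3)"] by simp
  then show ?thesis
    using inv[of "\<lambda>x. ennreal ((norm (f x))\<^sup>2)"] 
      inv[of "\<lambda>x. \<integral>\<^sup>+y. ennreal ((norm (f x - f y))\<^sup>2 / (dist x y) ^ 3) \<partial>?M"]
    by (simp add: H12_norm_sq_def conj_map_def)
qed

lemma H12_conj:
  assumes "\<And>x. P *v x \<in> G \<longleftrightarrow> x \<in> G" "f \<in> H12 G"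
  shows "conj_map f \<in> H12 G"
proof -
  note pr = preserving_surface[OF borel_closed[OF frontier_closed] invariant_frontier[OF assms(1)]]
  have "conj_map f \<in> borel_measurable (surface_measure (frontier G))"
    unfolding conj_map_def[abs_def]
    by (intro measurable_linear[OF bounded_linear_PR(2)] measurable_preserving[OF pr(1)])
      (use assms(2) in \<open>simp add: H12_def\<close>)
  then show ?thesis using assms(2) H12_norm_sq_conj[OF assms(1)] by (simp add: H12_def)
qed

lemma H12_sphere_conj:
  assumes "\<And>x. P *v x \<in> G \<longleftrightarrow> x \<in> G" "f \<in> H12_sphere G"
  shows "conj_map f \<in> H12_sphere G"
  using assms(2) H12_conj[OF assms(1)]
    AE_preserving[OF preserving_surface(1)[OF borel_closed[OF frontier_closed] invariant_frontier[OF assms(1)]], of "\<lambda>x. norm (f x) = 1"]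
  by (auto simp: H12_sphere_def conj_map_def)

lemma H1_loc_conj:
  assumes G: "open G" "\<And>x. P *v x \<in> G \<longleftrightarrow> x \<in> G" and h: "H1_loc G n D"
  shows "H1_loc G (conj_map n) (conj_grad D)"
proof -
  have n: "locL2 (- G) n" and D: "locL2 (- G) D" and w: "has_weak_gradient (interior (- G)) n D"
    using h H1_loc_iff sets_compl[OF G(1)] by auto
  have G': "P *v x \<in> - G \<longleftrightarrow> x \<in> - G" for x using G(2) by simp
  have "bounded_linear (\<lambda>A. R ** A ** P)"
    by (intro linear_conv_bounded_linear[THEN iffD1] linearI; rule matrix_eq_columns)
      (simp_all add: matrix_vector_right_distrib matrix_vector_mult_scaleR matrix_vector_mult_add_rdistrib 
        scaleR_matrix_vector_assoc[symmetric] flip: matrix_vector_mul_assoc)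
  then have "locL2 (- G) (conj_grad D)" unfolding conj_grad_def[abs_def]
    by (rule locL2_linear) (rule locL2_compose_P[OF sets_compl(1)[OF G(1)] G' D])
  moreover have "locL2 (- G) (conj_map n)" unfolding conj_map_def[abs_def]
    by (rule locL2_linear[OF bounded_linear_PR(2)]) (rule locL2_compose_P[OF sets_compl(1)[OF G(1)] G' n])
  moreover have "has_weak_gradient (interior (- G)) (conj_map n) (conj_grad D)"
    by (rule weak_gradient_conj[OF sets_compl(2)[OF G(1)] invariant_interior[OF G'] 
      locL2_interior[OF G(1) n] locL2_interior[OF G(1) D] w])
  ultimately show ?thesis by (simp add: H1_loc_iff sets_compl G)
qed

lemma smooth_conj: "smooth u \<Longrightarrow> smooth (conj_map u)"
  unfolding conj_map_def[abs_def]
  by (rule smooth_linear[OF bounded_linear_PR(2) smooth_compose_linear[OF bounded_linear_PR(1)]])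

lemma jacobian_conj:
  assumes "smooth u"
  shows "jacobian (conj_map u) (at x) = conj_grad (\<lambda>x. jacobian u (at x)) x"
proof (rule matrix_eq_columns)
  fix i
  have d: "(\<lambda>x. u (P *v x)) differentiable (at x)"
    by (rule partial_compose_linear(2)[OF bounded_linear_PR(1) smooth_differentiable[OF assms]])
  have "partial i (conj_map u) x = R *v (partial i (\<lambda>x. u (P *v x)) x)"
    unfolding conj_map_def[abs_def] by (rule partial_linear[OF bounded_linear_PR(2) d])
  also have "partial i (\<lambda>x. u (P *v x)) x = (\<Sum>j\<in>UNIV. R $ i $ j *\<^sub>R partial j u (P *v x))"
    by (subst partial_compose_linear(1)[OF bounded_linear_PR(1) smooth_differentiable[OF assms]])
      (simp add: matrix_vector_mult_basis column_def P transpose_def)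
  finally show "column i (jacobian (conj_map u) (at x)) = column i (conj_grad (\<lambda>x. jacobian u (at x)) x)"
    by (simp add: column_jacobian column_conj_grad)
qed

text \<open>Conjugating the approximants as well leaves both error integrals exactly as they were,
  since the integrands are composed with a measure preserving map.\<close>

lemma has_trace_conj:
  assumes G: "open G" "\<And>x. P *v x \<in> G \<longleftrightarrow> x \<in> G" and h: "has_trace G n g"
  shows "has_trace G (conj_map n) (conj_map g)"
proof -
  from h obtain D u where D: "H1_loc G n D" and u: "\<And>k. smooth (u k)"
    and c: "\<And>r. (\<lambda>k. \<integral>\<^sup>+x. ennreal ((norm (u k x - n x))\<^sup>2 + (norm (jacobian (u k) (at x) - D x))\<^sup>2)
               \<partial>lebesgue_on (- G \<inter> ball 0 r)) \<longlonglongrightarrow> 0"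
    and b: "(\<lambda>k. \<integral>\<^sup>+x. ennreal ((norm (u k x - g x))\<^sup>2) \<partial>surface_measure (frontier G)) \<longlonglongrightarrow> 0"
    and g: "g \<in> H12 G"
    unfolding has_trace_def by blast
  have diff: "norm (conj_map p x - conj_map q x) = norm (p (P *v x) - q (P *v x))" for p q x
    by (simp add: conj_map_def matrix_vector_mult_diff_distrib[symmetric])
  have "(\<integral>\<^sup>+x. ennreal ((norm (conj_map (u k) x - conj_map n x))\<^sup>2 + (norm (jacobian (conj_map (u k)) (at x) - conj_grad D x))\<^sup>2)
               \<partial>lebesgue_on (- G \<inter> ball 0 r)) = 
     (\<integral>\<^sup>+x. ennreal ((norm (u k x - n x))\<^sup>2 + (norm (jacobian (u k) (at x) - D x))\<^sup>2)
               \<partial>lebesgue_on (- G \<inter> ball 0 r))" for k r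
    unfolding diff jacobian_conj[OF u] conj_grad_diff norm_conj_grad
    by (rule nn_integral_lebesgue_on_P) (use G sets_compl(1)[OF G(1)] in \<open>auto simp: sets.Int\<close>)
  moreover have "(\<integral>\<^sup>+x. ennreal ((norm (conj_map (u k) x - conj_map g x))\<^sup>2) \<partial>surface_measure (frontier G))
    = (\<integral>\<^sup>+x. ennreal ((norm (u k x - g x))\<^sup>2) \<partial>surface_measure (frontier G))" for k
    unfolding diff by (rule nn_integral_surface_P[OF borel_closed[OF frontier_closed] invariant_frontier[OF G(2)]])
  ultimately show ?thesis unfolding has_trace_def
    using H1_loc_conj[OF G D] H12_conj[OF G(2) g] c b smooth_conj[OF u]
    by (intro conjI exI[of _ "conj_grad D"] exI[of _ "\<lambda>k. conj_map (u k)"]) auto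
qed

lemma H1_loc_sphere_conj:
  assumes G: "open G" "\<And>x. P *v x \<in> G \<longleftrightarrow> x \<in> G" and h: "H1_loc_sphere G n D"
  shows "H1_loc_sphere G (conj_map n) (conj_grad D)"
proof -
  have "AE x in lebesgue_on (- G). norm (n (P *v x)) = 1"
    by (rule AE_preserving[OF preserving_lebesgue_on(1)[OF sets_compl(1)[OF G(1)]]]) (use h G in \<open>auto simp: H1_loc_sphere_def\<close>)
  then show ?thesis using h H1_loc_conj[OF G] by (auto simp: H1_loc_sphere_def conj_map_def)
qed

lemma dirichlet_conj:
  assumes G: "open G" "\<And>x. P *v x \<in> G \<longleftrightarrow> x \<in> G"
  shows "(\<integral>\<^sup>+x. ennreal ((norm (conj_grad D x))\<^sup>2) \<partial>lebesgue_on (- G)) = (\<integral>\<^sup>+x. ennreal ((norm (D x))\<^sup>2) \<partial>lebesgue_on (- G))"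
  unfolding norm_conj_grad by (rule nn_integral_lebesgue_on_P) (use G sets_compl(1)[OF G(1)] in auto)

lemma admissible_conj:
  assumes G: "open G" "\<And>x. P *v x \<in> G \<longleftrightarrow> x \<in> G" and h: "admissible G n0 n"
  shows "admissible G (R *v n0) (conj_map n)"
proof -
  from h obtain D where D: "H1_loc_sphere G n D" "(\<integral>\<^sup>+x. ennreal ((norm (n x - n0))\<^sup>2 / (1 + (norm x)\<^sup>2)) \<partial>lebesgue_on (- G)) +
     (\<integral>\<^sup>+x. ennreal ((norm (D x))\<^sup>2) \<partial>lebesgue_on (- G)) < \<infinity>" unfolding admissible_def by blast
  have "norm (conj_map n x - R *v n0) = norm (n (P *v x) - n0)" for x
    by (simp add: conj_map_def matrix_vector_mult_diff_distrib[symmetric])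
  then have "(\<integral>\<^sup>+x. ennreal ((norm (conj_map n x - R *v n0))\<^sup>2 / (1 + (norm x)\<^sup>2)) \<partial>lebesgue_on (- G))
    = (\<integral>\<^sup>+x. ennreal ((norm (n x - n0))\<^sup>2 / (1 + (norm x)\<^sup>2)) \<partial>lebesgue_on (- G))"
    using nn_integral_lebesgue_on_P[of "- G" "\<lambda>x. ennreal ((norm (n x - n0))\<^sup>2 / (1 + (norm x)\<^sup>2))"] G sets_compl(1)[OF G(1)] by simp
  then show ?thesis unfolding admissible_def
    using D H1_loc_sphere_conj[OF G D(1)] dirichlet_conj[OF G] by (intro exI[of _ "conj_grad D"]) simp
qed

lemma has_energy_conj:
  assumes G: "open G" "\<And>x. P *v x \<in> G \<longleftrightarrow> x \<in> G" and F: "\<And>g. g \<in> H12_sphere G \<Longrightarrow> F (conj_map g) = F g"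
    and h: "has_energy G F n e"
  shows "has_energy G F (conj_map n) e"
proof -
  from h obtain D g where D: "H1_loc_sphere G n D" "has_trace G n g" "g \<in> H12_sphere G"
     "e = (\<integral>\<^sup>+x. ennreal ((norm (D x))\<^sup>2) \<partial>lebesgue_on (- G)) + F g" unfolding has_energy_def by blast
  then show ?thesis unfolding has_energy_def
    using H1_loc_sphere_conj[OF G D(1)] has_trace_conj[OF G D(2)] H12_sphere_conj[OF G(2) D(3)] F[OF D(3)] dirichlet_conj[OF G]
    by (intro exI[of _ "conj_grad D"] exI[of _ "conj_map g"]) simp
qed

end

section \<open>Symmetries and the minimal energy\<close>

lemma energies_subset_Sym:
  assumes G: "open G" and R: "R \<in> Sym G F"
  shows "{e. \<exists>n. admissible G n0 n \<and> has_energy G F n e} \<subseteq> {e. \<exists>n. admissible G (R *v n0) n \<and> has_energy G F n e}"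
proof -
  have o: "orthogonal_matrix R" and img: "(\<lambda>x. R *v x) ` G = G"
    and F: "\<And>n. n \<in> H12_sphere G \<Longrightarrow> F (\<lambda>x. R *v n (matrix_inv R *v x)) = F n"
    using R by (auto simp: Sym_def)
  \<comment> \<open>\<open>matrix_inv\<close> is a choice of a two-sided inverse; uniqueness of
    inverses identifies it with the transpose.\<close>
  have i: "matrix_inv R = transpose R"
  proof -
    have "R ** transpose R = mat 1 \<and> transpose R ** R = mat 1" using o by (auto simp: orthogonal_matrix_def)
    moreover from this have "R ** matrix_inv R = mat 1 \<and> matrix_inv R ** R = mat 1"
      unfolding matrix_inv_def by (rule someI)
    ultimately show ?thesis by (metis matrix_mul_assoc matrix_mul_lid matrix_mul_rid)
  qed
  have G': "transpose R *v x \<in> G \<longleftrightarrow> x \<in> G" for x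
    using img RP[OF o refl] PR[OF o refl] by (metis image_iff)
  have "conj_map R (transpose R) n = (\<lambda>x. R *v n (matrix_inv R *v x))" for n
    by (simp add: fun_eq_iff conj_map_def[OF o refl] i)
  then have F': "F (conj_map R (transpose R) g) = F g" if "g \<in> H12_sphere G" for g
    using F[OF that] by simp
  show ?thesis
  proof -
    have "has_energy G F (conj_map R (transpose R) n) e" if "has_energy G F n e" for n e
      by (rule has_energy_conj[OF o refl G G' _ that]) (use F' in auto)
    then show ?thesis using admissible_conj[OF o refl G G'] by blast
  qed
qed

text \<open>Conjugation by a symmetry gives one inclusion between the sets of energies. The inverse
  symmetry, which is the transpose, gives the other, so the infima agree.\<close>

lemma Ehat_Sym:
  assumes "open G" "R \<in> Sym G F" "transpose R \<in> Sym G F"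
  shows "Ehat G F (R *v n0) = Ehat G F n0"
proof -
  have "transpose R *v (R *v n0) = n0"
    using assms(2) PR[OF _ refl] by (simp add: Sym_def)
  then show ?thesis
    using energies_subset_Sym[OF assms(1,2), of n0] energies_subset_Sym[OF assms(1,3), of "R *v n0"]
    by (simp add: Ehat_def)
qed

section \<open>The torque at infinity\<close>

definition cutoff_at :: "real \<Rightarrow> R3 \<Rightarrow> real" where
  "cutoff_at R x = cutoff (inverse R *\<^sub>R x)"

definition laplacian :: "(R3 \<Rightarrow> real) \<Rightarrow> R3 \<Rightarrow> real" where
  "laplacian \<phi> x = (\<Sum>i\<in>UNIV. partial i (partial i \<phi>) x)"

lemma partial_compose_scaleR:
  assumes "smooth f"
  shows "partial i (\<lambda>x. f (c *\<^sub>R x)) x = c *\<^sub>R partial i f (c *\<^sub>R x)"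
proof -
  have "partial i (\<lambda>x. f (c *\<^sub>R x)) x = (\<Sum>j\<in>UNIV. ((c *\<^sub>R axis i 1 :: R3) $ j) *\<^sub>R partial j f (c *\<^sub>R x))"
    by (rule partial_compose_linear(1)[OF bounded_linear_scaleR_right smooth_differentiable[OF assms]])
  also have "\<dots> = (\<Sum>j\<in>UNIV. if i = j then c *\<^sub>R partial j f (c *\<^sub>R x) else 0)"
    by (intro sum.cong) (auto simp: axis_def)
  finally show ?thesis by simp
qed

lemma smooth_cutoff_at: "smooth (cutoff_at R)"
  unfolding cutoff_at_def[abs_def] by (rule smooth_compose_linear[OF bounded_linear_scaleR_right smooth_cutoff])

lemma partial_cutoff_at: "partial i (cutoff_at R) = (\<lambda>x. inverse R * partial i cutoff (inverse R *\<^sub>R x))"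
  unfolding cutoff_at_def[abs_def] by (rule ext) (simp add: partial_compose_scaleR[OF smooth_cutoff])

lemma partial2_cutoff_at:
  "partial j (partial i (cutoff_at R)) x = inverse R * (inverse R * partial j (partial i cutoff) (inverse R *\<^sub>R x))"
proof -
  have "partial j (partial i (cutoff_at R)) x = inverse R * partial j (\<lambda>x. partial i cutoff (inverse R *\<^sub>R x)) x"
    unfolding partial_cutoff_at
    by (rule partial_linear[OF bounded_linear_mult_right])
      (rule smooth_differentiable[OF smooth_compose_linear[OF bounded_linear_scaleR_right smooth_partial[OF smooth_cutoff]]])
  then show ?thesis by (simp add: partial_compose_scaleR[OF smooth_partial[OF smooth_cutoff]])
qed

lemma laplacian_cutoff_at: "laplacian (cutoff_at R) x = (inverse R)\<^sup>2 * laplacian cutoff (inverse R *\<^sub>R x)"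
  by (simp add: laplacian_def partial2_cutoff_at sum_distrib_left power2_eq_square mult.assoc)

lemma grad_cutoff_at: "grad (cutoff_at R) x = inverse R *\<^sub>R grad cutoff (inverse R *\<^sub>R x)"
  by (simp add: grad_def partial_cutoff_at vec_eq_iff)

lemma norm_inverse_scaleR:
  fixes x :: R3
  assumes "R > 0"
  shows "norm (inverse R *\<^sub>R x) < c \<longleftrightarrow> norm x < c * R" "norm (inverse R *\<^sub>R x) > c \<longleftrightarrow> norm x > c * R"
    "norm (inverse R *\<^sub>R x) \<le> c \<longleftrightarrow> norm x \<le> c * R" "norm (inverse R *\<^sub>R x) \<ge> c \<longleftrightarrow> norm x \<ge> c * R"
  using assms by (simp_all add: field_simps)

lemma cutoff_at_support:
  assumes "R > 0"
  shows "norm x \<le> R \<Longrightarrow> cutoff_at R x = 0" "norm x \<ge> 2 * R \<Longrightarrow> cutoff_at R x = 1"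
    "norm x < R \<or> norm x > 2 * R \<Longrightarrow> partial i (cutoff_at R) x = 0"
    "norm x < R \<or> norm x > 2 * R \<Longrightarrow> grad (cutoff_at R) x = 0"
    "norm x < R \<or> norm x > 2 * R \<Longrightarrow> laplacian (cutoff_at R) x = 0"
proof -
  show "norm x \<le> R \<Longrightarrow> cutoff_at R x = 0" "norm x \<ge> 2 * R \<Longrightarrow> cutoff_at R x = 1"
    unfolding cutoff_at_def using norm_inverse_scaleR[OF assms, where x=x and c=1] norm_inverse_scaleR[OF assms, where x=x and c=2]
    by (auto intro!: cutoff_eq_0 cutoff_eq_1)
  have *: "norm (inverse R *\<^sub>R x) < 1 \<or> norm (inverse R *\<^sub>R x) > 2" if "norm x < R \<or> norm x > 2 * R"
    using norm_inverse_scaleR[OF assms, where x=x and c=1] norm_inverse_scaleR[OF assms, where x=x and c=2] that by auto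
  show p: "partial i (cutoff_at R) x = 0" if "norm x < R \<or> norm x > 2 * R" for i
    unfolding partial_cutoff_at using partial_cutoff_eq_0[OF *[OF that]] by simp
  show "norm x < R \<or> norm x > 2 * R \<Longrightarrow> grad (cutoff_at R) x = 0"
    using p by (simp add: grad_def vec_eq_iff)
  show "norm x < R \<or> norm x > 2 * R \<Longrightarrow> laplacian (cutoff_at R) x = 0"
    unfolding laplacian_cutoff_at using partial2_cutoff_eq_0[OF *] by (simp add: laplacian_def)
qed

lemma integral_scaleR:
  fixes f :: "R3 \<Rightarrow> real"
  assumes "R > 0" "f \<in> borel_measurable borel"
  shows "(\<integral>x. (inverse R) ^ 3 * f (inverse R *\<^sub>R x) \<partial>lborel) = (\<integral>x. f x \<partial>lborel)"
proof -
  have "lborel = density (distr lborel borel (\<lambda>x::R3. 0 + inverse R *\<^sub>R x)) (\<lambda>_. ennreal (\<bar>inverse R\<bar> ^ DIM(R3)))"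
    by (rule lborel_affine) (use assms in simp)
  then have "(\<integral>x. f x \<partial>lborel) = (\<integral>x. f x \<partial>density (distr lborel borel (\<lambda>x::R3. inverse R *\<^sub>R x)) (\<lambda>_. ennreal ((inverse R) ^ 3)))"
    using assms by simp
  also have "\<dots> = (\<integral>x. (inverse R) ^ 3 * f (inverse R *\<^sub>R x) \<partial>lborel)"
    using assms by (subst integral_density) (auto simp: integral_distr)
  finally show ?thesis by simp
qed

lemma continuous_laplacian: "smooth \<phi> \<Longrightarrow> continuous_on UNIV (laplacian \<phi>)"
  unfolding laplacian_def[abs_def] by (intro continuous_on_sum smooth_continuous_on smooth_partial)

lemma laplacian_cutoff_eq_0: "norm x < 1 \<or> norm x > 2 \<Longrightarrow> laplacian cutoff x = 0"
  by (simp add: laplacian_def partial2_cutoff_eq_0)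

text \<open>Bounds the error of replacing the rescaled deviation from \<open>n0\<close> by its limit
  \<open>v0\<close> under the Laplacian of the cutoff.\<close>

definition abs_newton_moment :: real where
  "abs_newton_moment = (\<integral>x. \<bar>laplacian cutoff x\<bar> / norm x \<partial>lborel)"

lemma continuous_cutoff_quotients:
  "continuous_on UNIV (\<lambda>x. laplacian cutoff x / norm x)" "continuous_on UNIV (\<lambda>x. \<bar>laplacian cutoff x\<bar> / norm x)"
  using continuous_on_annulus_div[of "laplacian cutoff" 1] continuous_on_annulus_div[of "\<lambda>x. \<bar>laplacian cutoff x\<bar>" 1]
    continuous_laplacian[OF smooth_cutoff]
  by (auto simp: laplacian_cutoff_eq_0 intro!: continuous_on_rabs)

text \<open>The Laplacian contributes two factors 1/R and the weight 1/r a third, which is exactly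
  the Jacobian of the dilation in three dimensions. The moments are therefore the same at every
  scale, while the error terms shrink.\<close>

lemma cutoff_at_moments:
  assumes R: "R > 0"
  shows "integrable lborel (\<lambda>x. laplacian (cutoff_at R) x / norm x)"
    "(\<integral>x. laplacian (cutoff_at R) x / norm x \<partial>lborel) = newton_moment"
    "integrable lborel (\<lambda>x. \<bar>laplacian (cutoff_at R) x\<bar> / norm x)"
    "(\<integral>x. \<bar>laplacian (cutoff_at R) x\<bar> / norm x \<partial>lborel) = abs_newton_moment"
proof -
  have e: "laplacian (cutoff_at R) x / norm x = (inverse R) ^ 3 * (laplacian cutoff (inverse R *\<^sub>R x) / norm (inverse R *\<^sub>R x))" for x
    using R by (simp add: laplacian_cutoff_at power2_eq_square power3_eq_cube field_simps)
  have e': "\<bar>laplacian (cutoff_at R) x\<bar> / norm x = (inverse R) ^ 3 * (\<bar>laplacian cutoff (inverse R *\<^sub>R x)\<bar> / norm (inverse R *\<^sub>R x))" for x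
    using R by (simp add: laplacian_cutoff_at abs_mult power2_eq_square power3_eq_cube field_simps)
  show "(\<integral>x. laplacian (cutoff_at R) x / norm x \<partial>lborel) = newton_moment"
    unfolding e by (subst integral_scaleR[OF R borel_measurable_continuous_onI[OF continuous_cutoff_quotients(1)]])
      (simp add: newton_moment_def laplacian_def)
  show "(\<integral>x. \<bar>laplacian (cutoff_at R) x\<bar> / norm x \<partial>lborel) = abs_newton_moment"
    unfolding e' by (subst integral_scaleR[OF R borel_measurable_continuous_onI[OF continuous_cutoff_quotients(2)]])
      (simp add: abs_newton_moment_def)
  have z: "laplacian cutoff (inverse R *\<^sub>R x) = 0" if "norm x > 2 * R" for x
    using laplacian_cutoff_eq_0[of "inverse R *\<^sub>R x"] norm_inverse_scaleR(2)[OF R, where x=x and c=2] that by blast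
  have c: "continuous_on UNIV (\<lambda>x. inverse R ^ 3 * f (inverse R *\<^sub>R x))" if "continuous_on UNIV f" for f :: "R3 \<Rightarrow> real"
    by (intro continuous_intros continuous_on_compose2[OF that]) auto
  show "integrable lborel (\<lambda>x. laplacian (cutoff_at R) x / norm x)"
    unfolding e by (rule integrable_compact_support[OF c[OF continuous_cutoff_quotients(1)], of "2 * R"])
      (use R z in auto)
  show "integrable lborel (\<lambda>x. \<bar>laplacian (cutoff_at R) x\<bar> / norm x)"
    unfolding e' by (rule integrable_compact_support[OF c[OF continuous_cutoff_quotients(2)], of "2 * R"])
      (use R z in auto)
qed

section \<open>Consequences of the far field\<close>

lemma has_far_fieldD:
  assumes "has_far_field n n0 v0" "\<epsilon> > 0"
  shows "\<exists>r. AE x in lebesgue. norm x \<ge> r \<longrightarrow> norm (norm x *\<^sub>R (n x - n0) - v0) < \<epsilon>"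
proof -
  have "eventually (\<lambda>x. dist (norm x *\<^sub>R (n x - n0)) v0 < \<epsilon>) (inf at_infinity (ae_filter lebesgue))"
    using assms by (auto simp: has_far_field_def tendsto_iff)
  then obtain P Q where P: "eventually P at_infinity" and Q: "eventually Q (ae_filter lebesgue)"
    and PQ: "\<And>x. P x \<Longrightarrow> Q x \<Longrightarrow> dist (norm x *\<^sub>R (n x - n0)) v0 < \<epsilon>"
    unfolding eventually_inf by blast
  obtain r where "\<And>x. norm x \<ge> r \<Longrightarrow> P x" using P by (auto simp: eventually_at_infinity)
  with Q PQ show ?thesis
    by (intro exI[of _ r]) (auto elim!: eventually_mono simp: dist_norm)
qed

lemma le_0_if_le_mult:
  fixes x c :: real
  assumes "\<And>\<epsilon>. 0 < \<epsilon> \<Longrightarrow> \<epsilon> < 1 \<Longrightarrow> x \<le> \<epsilon> * c"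
  shows "x \<le> 0"
proof -
  have "((\<lambda>\<epsilon>. \<epsilon> * c) \<longlongrightarrow> 0 * c) (at_right 0)" by (intro tendsto_intros)
  then have "x \<le> 0 * c"
    by (rule tendsto_lowerbound) (auto intro!: eventually_at_rightI[of 0 1] assms)
  then show ?thesis by simp
qed

text \<open>For unit vectors, d = n - n0 satisfies 2 (n0 \<bullet> d) = -(d \<bullet> d). Multiplied
  by r, the left side tends to twice the component of \<open>v0\<close> along \<open>n0\<close>, and
  the right side is of order 1/r.\<close>

lemma far_field_orthogonal:
  assumes G: "open G" "bounded G" and h: "H1_loc_sphere G n D" and ff: "has_far_field n n0 v0" and n0: "norm n0 = 1"
  shows "v0 \<bullet> n0 = 0"
proof -
  obtain r0 where r0: "G \<subseteq> ball 0 r0" using bounded_subset_ballD[OF G(2), of 0] by blast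
  have ae: "AE x in lebesgue. x \<notin> G \<longrightarrow> norm (n x) = 1"
    using h sets_compl(1)[OF G(1)] by (simp add: H1_loc_sphere_def AE_restrict_space_iff)
  have "\<bar>v0 \<bullet> n0\<bar> \<le> \<epsilon> * (1 + (norm v0 + 1)\<^sup>2)" if \<epsilon>: "0 < \<epsilon>" "\<epsilon> < 1" for \<epsilon>
  proof -
    obtain r where r: "AE x in lebesgue. norm x \<ge> r \<longrightarrow> norm (norm x *\<^sub>R (n x - n0) - v0) < \<epsilon>"
      using has_far_fieldD[OF ff \<epsilon>(1)] by blast
    \<comment> \<open>Beyond this radius the point lies outside the particle, the far field estimate
      applies, and 1/r is below \<open>\<epsilon>\<close>.\<close>
    define \<rho> where "\<rho> = max (max r r0) (1 / \<epsilon>)"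
    have "\<exists>x. norm x > \<rho> \<and> norm (n x) = 1 \<and> norm (norm x *\<^sub>R (n x - n0) - v0) < \<epsilon>"
    proof (rule ccontr)
      assume nex: "\<not> ?thesis"
      have "AE x in (lebesgue :: R3 measure). \<not> (norm x > \<rho>)"
        using ae r
      proof (eventually_elim)
        case (elim x)
        then show ?case using r0 nex by (force simp: \<rho>_def)
      qed
      \<comment> \<open>The exterior of a ball is open and nonempty, so it cannot be negligible and
        must contain a point where all the almost everywhere properties hold.\<close>
      then have "negligible {x::R3. norm x > \<rho>}"
        by (simp add: negligible_iff_null_sets AE_iff_null)
      moreover have "open {x::R3. norm x > \<rho>}" by (intro open_Collect_less continuous_intros)
      ultimately have "{x::R3. norm x > \<rho>} = {}" using open_not_negligible by blast
      moreover have "norm ((\<bar>\<rho>\<bar> + 1) *\<^sub>R axis 1 1 :: R3) > \<rho>" by simp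
      ultimately show False by blast
    qed
    then obtain x where x: "norm x > \<rho>" "norm (n x) = 1" "norm (norm x *\<^sub>R (n x - n0) - v0) < \<epsilon>" by blast
    define d e where "d = n x - n0" and "e = norm x *\<^sub>R d - v0"
    have x1: "norm x > 1 / \<epsilon>" using x(1) by (simp add: \<rho>_def)
    then have xpos: "norm x > 0" using \<epsilon> by (meson less_trans zero_less_divide_1_iff)
    have "n x \<bullet> n x = 1" "n0 \<bullet> n0 = 1" using x(2) n0 by (simp_all add: dot_square_norm)
    then have "2 * (n0 \<bullet> d) = - (d \<bullet> d)" by (simp add: d_def inner_diff_left inner_diff_right inner_commute)
    then have A: "norm x * (norm x * (2 * (n0 \<bullet> d))) = - ((norm x *\<^sub>R d) \<bullet> (norm x *\<^sub>R d))" by simp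
    have s: "norm x *\<^sub>R d = v0 + e" by (simp add: e_def)
    then have T: "norm x * (n0 \<bullet> d) = n0 \<bullet> v0 + n0 \<bullet> e"
      by (metis inner_add_right inner_scaleR_right)
    have "2 * norm x * (n0 \<bullet> v0 + n0 \<bullet> e) = norm x * (norm x * (2 * (n0 \<bullet> d)))"
      unfolding T[symmetric] by simp
    also have "\<dots> = - (norm (v0 + e))\<^sup>2"
      unfolding A s by (simp add: power2_norm_eq_inner)
    finally have "2 * norm x * (n0 \<bullet> v0 + n0 \<bullet> e) = - (norm (v0 + e))\<^sup>2" .
    then have "n0 \<bullet> v0 + n0 \<bullet> e = - ((norm (v0 + e))\<^sup>2 * (1 / (2 * norm x)))"
      using xpos by (simp add: field_simps)
    moreover have "\<bar>n0 \<bullet> e\<bar> \<le> \<epsilon>" using Cauchy_Schwarz_ineq2[of n0 e] n0 x(3) by (simp add: e_def d_def)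
    moreover have "(norm (v0 + e))\<^sup>2 * (1 / (2 * norm x)) \<le> (norm v0 + 1)\<^sup>2 * \<epsilon>"
    proof (rule mult_mono)
      show "(norm (v0 + e))\<^sup>2 \<le> (norm v0 + 1)\<^sup>2"
        using norm_triangle_ineq[of v0 e] x(3) \<epsilon> by (intro power_mono) (auto simp: e_def d_def)
      show "1 / (2 * norm x) \<le> \<epsilon>" using x1 xpos \<epsilon> by (simp add: field_simps)
    qed (use xpos in auto)
    moreover have "(norm (v0 + e))\<^sup>2 * (1 / (2 * norm x)) \<ge> 0" by simp
    ultimately have "\<bar>n0 \<bullet> v0\<bar> \<le> \<epsilon> + (norm v0 + 1)\<^sup>2 * \<epsilon>" by linarith
    then show ?thesis by (simp add: inner_commute distrib_left mult.commute)
  qed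
  then have "\<bar>v0 \<bullet> n0\<bar> \<le> 0" by (rule le_0_if_le_mult)
  then show ?thesis by simp
qed

text \<open>Weak derivatives are tested on the open interior of the complement, whereas energies are
  integrated over the closed complement, boundary included; this passes between the two.\<close>

lemma integral_interior:
  fixes f :: "R3 \<Rightarrow> 'b::{banach, second_countable_topology}"
  assumes "S \<in> sets lebesgue" "U \<in> sets lebesgue" "U \<subseteq> S" "\<And>x. x \<in> S \<Longrightarrow> x \<notin> U \<Longrightarrow> f x = 0"
  shows "(\<integral>x. f x \<partial>lebesgue_on U) = (\<integral>x. f x \<partial>lebesgue_on S)"
proof -
  have e: "(\<lambda>x. indicator U x *\<^sub>R f x) = (\<lambda>x. indicator S x *\<^sub>R f x)"
    using assms(3,4) by (auto simp: fun_eq_iff indicator_def)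
  show ?thesis
    using integral_restrict_space[of U lebesgue f] integral_restrict_space[of S lebesgue f] assms(1,2)
    unfolding e by simp
qed

text \<open>For a constant vector \<open>w\<close> the pairing is linear in the Jacobian, and the
  derivative can be moved onto the cutoff, which produces its Laplacian. Since \<open>w\<close> is
  orthogonal to \<open>n0\<close>, subtracting \<open>n0\<close> changes nothing.\<close>

lemma torque_flux:
  assumes G: "open G" "G \<subseteq> ball 0 r0" and h: "H1_loc G n D" and R: "R > r0" "R > 0"
    and w: "w \<bullet> n0 = 0"
  shows "(\<integral>x. D x \<bullet> outer w (grad (cutoff_at R) x) \<partial>lebesgue_on (- G))
     = - (\<integral>x. laplacian (cutoff_at R) x * ((n x - n0) \<bullet> w) \<partial>lebesgue_on (- G))"
    "integrable (lebesgue_on (- G)) (\<lambda>x. D x \<bullet> outer w (grad (cutoff_at R) x))"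
    "integrable (lebesgue_on (- G)) (\<lambda>x. laplacian (cutoff_at R) x * ((n x - n0) \<bullet> w))"
proof -
  let ?\<phi> = "cutoff_at R" and ?U = "interior (- G)" and ?M = "lebesgue_on (- G)"
  have n: "locL2 (- G) n" and D: "locL2 (- G) D" and wg: "has_weak_gradient (interior (- G)) n D"
    using h H1_loc_iff sets_compl[OF G(1)] by auto
  have sub: "{x. norm x \<ge> R} \<subseteq> ?U"
  proof -
    have "closure G \<subseteq> cball 0 r0" using G(2) by (intro closure_minimal) auto
    then show ?thesis using R by (auto simp: interior_closure)
  qed
  \<comment> \<open>The cutoff itself is not compactly supported, but its derivatives live in the
    annulus between R and 2R, away from the closure of the particle.\<close>
  have t: "partial i ?\<phi> \<in> test_functions ?U" for i
  proof -
    let ?K = "{x::R3. R \<le> norm x} \<inter> cball 0 (2 * R)"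
    have cl: "closed {x::R3. R \<le> norm x}" by (intro closed_Collect_le continuous_intros)
    then have K: "compact ?K" by (simp add: closed_Int_compact)
    have "closure {x. partial i ?\<phi> x \<noteq> 0} \<subseteq> ?K"
      using cutoff_at_support(3)[OF R(2), of _ i] K
      by (intro closure_minimal) (auto simp: compact_imp_closed not_less[symmetric])
    moreover from this have "compact (closure {x. partial i ?\<phi> x \<noteq> 0})"
      using K by (metis closed_closure compact_Int_closed inf.absorb_iff2)
    ultimately show ?thesis using sub smooth_partial[OF smooth_cutoff_at] by (auto simp: test_functions_def)
  qed
  have U: "?U \<in> sets lebesgue" "?U \<subseteq> - G" using sets_compl[OF G(1)] interior_subset by auto
  have c: "bounded_linear (\<lambda>A::real^3^3. column i A)" for i
    by (intro linear_conv_bounded_linear[THEN iffD1] linearI; simp)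
  have i1: "integrable ?M (\<lambda>x. partial i (partial i ?\<phi>) x *\<^sub>R n x)" for i
    by (rule test_integrable[OF test_functions_partial[OF t] sets_compl(1)[OF G(1)] n])
  have i2: "integrable ?M (\<lambda>x. partial i ?\<phi> x *\<^sub>R column i (D x))" for i
    by (rule test_integrable[OF t sets_compl(1)[OF G(1)] locL2_linear[OF c D]])
  have z: "partial i ?\<phi> x = 0" "partial i (partial i ?\<phi>) x = 0" if "x \<notin> ?U" for i x
    using test_functionsD(3)[OF t, of i x] test_functionsD(3)[OF test_functions_partial[OF t], of i i x] that by auto
  have wk: "(\<integral>x. partial i (partial i ?\<phi>) x *\<^sub>R n x \<partial>?M) = - (\<integral>x. partial i ?\<phi> x *\<^sub>R column i (D x) \<partial>?M)" for i
    using wg t[of i] integral_interior[OF sets_compl(1)[OF G(1)] U, of "\<lambda>x. partial i (partial i ?\<phi>) x *\<^sub>R n x"]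
      integral_interior[OF sets_compl(1)[OF G(1)] U, of "\<lambda>x. partial i ?\<phi> x *\<^sub>R column i (D x)"] z
    by (simp add: has_weak_gradient_def)
  have e1: "D x \<bullet> outer w (grad ?\<phi> x) = (\<Sum>i\<in>UNIV. (partial i ?\<phi> x *\<^sub>R column i (D x)) \<bullet> w)" for x
    by (simp add: inner_matrix_columns grad_def)
  have e2: "laplacian ?\<phi> x * ((n x - n0) \<bullet> w) = (\<Sum>i\<in>UNIV. (partial i (partial i ?\<phi>) x *\<^sub>R n x) \<bullet> w)" for x
  proof -
    have "(n x - n0) \<bullet> w = n x \<bullet> w" using w by (simp add: inner_diff_left inner_commute[of n0])
    then show ?thesis by (simp add: laplacian_def sum_distrib_right)
  qed
  show "integrable ?M (\<lambda>x. D x \<bullet> outer w (grad ?\<phi> x))"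
    unfolding e1 by (intro Bochner_Integration.integrable_sum integrable_inner_left i2)
  show "integrable ?M (\<lambda>x. laplacian ?\<phi> x * ((n x - n0) \<bullet> w))"
    unfolding e2 by (intro Bochner_Integration.integrable_sum integrable_inner_left i1)
  have "(\<integral>x. D x \<bullet> outer w (grad ?\<phi> x) \<partial>?M) = (\<Sum>i\<in>UNIV. (\<integral>x. partial i ?\<phi> x *\<^sub>R column i (D x) \<partial>?M) \<bullet> w)"
    unfolding e1 using i2 by (simp add: integrable_inner_left del: inner_scaleR_left)
  also have "\<dots> = - (\<Sum>i\<in>UNIV. (\<integral>x. partial i (partial i ?\<phi>) x *\<^sub>R n x \<partial>?M) \<bullet> w)"
    by (simp add: wk sum_negf)
  also have "(\<Sum>i\<in>UNIV. (\<integral>x. partial i (partial i ?\<phi>) x *\<^sub>R n x \<partial>?M) \<bullet> w) = (\<integral>x. laplacian ?\<phi> x * ((n x - n0) \<bullet> w) \<partial>?M)"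
    unfolding e2 using i1 by (simp add: integrable_inner_left del: inner_scaleR_left)
  finally show "(\<integral>x. D x \<bullet> outer w (grad ?\<phi> x) \<partial>?M) = - (\<integral>x. laplacian ?\<phi> x * ((n x - n0) \<bullet> w) \<partial>?M)" .
qed
text \<open>The torque splits into its part along the constant \<open>w\<close>, which leads to the
  integral of \<open>f\<close>, and the remainder \<open>g\<close>. Comparing \<open>f\<close> with
  \<open>v0 \<bullet> w\<close> times \<open>p\<close>, and absorbing \<open>g\<close> into the
  Dirichlet energy, both cost \<open>\<epsilon>\<close> times a constant independent of
  \<open>\<epsilon>\<close>, while the moment stays fixed.\<close>

lemma torque_limit:
  assumes G: "open G" "G \<subseteq> ball 0 r0" and h: "H1_loc_sphere G n D" and ff: "has_far_field n n0 v0"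
    and n0: "norm n0 = 1" and a: "norm a = 1"
    and E: "(\<integral>\<^sup>+x. ennreal ((norm (D x))\<^sup>2) \<partial>lebesgue_on (- G)) < \<infinity>"
    and L: "\<And>R. R > 0 \<Longrightarrow> R > r0 \<Longrightarrow> (\<integral>x. D x \<bullet> torque a n (cutoff_at R) x \<partial>lebesgue_on (- G)) = 0"
  shows "v0 \<bullet> cross3 a n0 = 0"
proof -
  let ?M = "lebesgue_on (- G)"
  define w where "w = cross3 a n0"
  have w: "w \<bullet> n0 = 0" "norm w \<le> 1"
    using norm_cross3_le[of a n0] a n0 by (simp_all add: w_def dot_cross_self)
  have h': "H1_loc G n D" and m [measurable]: "n \<in> borel_measurable ?M" "D \<in> borel_measurable ?M"
    using h by (auto simp: H1_loc_sphere_def H1_loc_def)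
  have S: "- G \<in> sets lebesgue" by (rule sets_compl(1)[OF G(1)])
  obtain M where M: "\<And>x. norm (grad cutoff x) \<le> M"
    using grad_bounded[OF smooth_cutoff, of 2] cutoff_at_support(4)[of 1] grad_cutoff_at[of 1] by auto
  define E0 where "E0 = (\<integral>x. (norm (D x))\<^sup>2 \<partial>?M)"
  have iE: "integrable ?M (\<lambda>x. (norm (D x))\<^sup>2)" using E by (intro integrableI_bounded) auto
  \<comment> \<open>\<open>B\<close> divided by the square of R bounds the matrix paired with the
    Jacobian in \<open>g\<close>. The constant \<open>V\<close> below, multiplied by the cube of R,
    is the volume of the ball of radius 2R.\<close>
  define B where "B = (norm v0 + 1) * M"
  define V where "V = measure lborel (cball (0::R3) 2)"
  have main: "\<bar>v0 \<bullet> w\<bar> * newton_moment \<le> \<epsilon> * (abs_newton_moment + E0 + B\<^sup>2 * V)" if \<epsilon>: "0 < \<epsilon>" "\<epsilon> < 1" for \<epsilon>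
  proof -
    obtain r where r: "AE x in lebesgue. norm x \<ge> r \<longrightarrow> norm (norm x *\<^sub>R (n x - n0) - v0) < \<epsilon>"
      using has_far_fieldD[OF ff \<epsilon>(1)] by blast
    \<comment> \<open>The last entry makes the final error \<open>1 / (\<epsilon> * R)\<close> at
      most \<open>\<epsilon>\<close>.\<close>
    define R where "R = max (max r (r0 + 1)) (1 / \<epsilon>\<^sup>2)"
    have R: "R > 0" "R > r0" "R \<ge> r" "R \<ge> 1 / \<epsilon>\<^sup>2" using \<epsilon> by (auto simp: R_def less_max_iff_disj)
    have ae: "AE x in ?M. norm x \<ge> r \<longrightarrow> norm (norm x *\<^sub>R (n x - n0) - v0) < \<epsilon>"
      using r S by (auto simp: AE_restrict_space_iff elim: eventually_mono)
    let ?\<phi> = "cutoff_at R"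
    define p where "p x = laplacian ?\<phi> x / norm x" for x
    define q where "q x = \<bar>laplacian ?\<phi> x\<bar> / norm x" for x
    define f where "f x = laplacian ?\<phi> x * ((n x - n0) \<bullet> w)" for x
    define g where "g x = D x \<bullet> outer (cross3 a (n x - n0)) (grad ?\<phi> x)" for x
    \<comment> \<open>The Laplacian of the cutoff vanishes on the particle because R exceeds
      \<open>r0\<close>, so the moments over the complement are those over the whole space.\<close>
    have small: "p x = 0" "q x = 0" if "x \<notin> - G" for x
      using that G(2) R cutoff_at_support(5)[OF R(1), of x] by (auto simp: p_def q_def)
    have ip: "integrable ?M p" "(\<integral>x. p x \<partial>?M) = newton_moment"
      and iq: "integrable ?M q" "(\<integral>x. q x \<partial>?M) = abs_newton_moment"
    proof -
      have c: "integrable ?M k \<and> (\<integral>x. k x \<partial>?M) = (\<integral>x. k x \<partial>lborel)"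
        if "integrable lborel k" "\<And>x. x \<notin> - G \<Longrightarrow> k x = 0" for k :: "R3 \<Rightarrow> real"
      proof -
        have e: "(\<lambda>x. indicator (- G) x *\<^sub>R k x) = k" using that(2) by (auto simp: indicator_def fun_eq_iff)
        have "integrable lebesgue k" using that(1) by (simp add: integrable_completion)
        moreover have "(\<integral>x. k x \<partial>lebesgue) = (\<integral>x. k x \<partial>lborel)"
          using that(1) by (intro integral_completion) auto
        ultimately show ?thesis using S e
          by (simp add: integrable_restrict_space integral_restrict_space)
      qed
      show "integrable ?M p" "(\<integral>x. p x \<partial>?M) = newton_moment"
        using c[of p] cutoff_at_moments(1,2)[OF R(1)] small by (auto simp: p_def[abs_def])
      show "integrable ?M q" "(\<integral>x. q x \<partial>?M) = abs_newton_moment"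
        using c[of q] cutoff_at_moments(3,4)[OF R(1)] small by (auto simp: q_def[abs_def])
    qed
    note fl = torque_flux[OF G h' R(2,1) w(1)]
    have if': "integrable ?M f" using fl(3) by (simp add: f_def[abs_def])
    have split: "D x \<bullet> torque a n ?\<phi> x = D x \<bullet> outer w (grad ?\<phi> x) + g x" for x
      by (simp add: torque_def g_def w_def inner_matrix_columns sum.distrib[symmetric] inner_add_right[symmetric]
          scaleR_add_right[symmetric] Cross3.right_diff_distrib del: inner_scaleR_right)
    have far: "norm (n x - n0) \<le> (norm v0 + 1) / R"
      if "norm x \<ge> R" "norm (norm x *\<^sub>R (n x - n0) - v0) < \<epsilon>" for x
    proof -
      have "norm (norm x *\<^sub>R (n x - n0)) \<le> norm v0 + 1"
        using norm_triangle_ineq[of "norm x *\<^sub>R (n x - n0) - v0" v0] that(2) \<epsilon>(2) by simp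
      then have "norm x * norm (n x - n0) \<le> norm v0 + 1" by simp
      moreover have "R * norm (n x - n0) \<le> norm x * norm (n x - n0)"
        using that(1) by (intro mult_right_mono) auto
      ultimately show ?thesis using R(1) by (simp add: field_simps)
    qed
    have gb: "AE x in ?M. \<bar>g x\<bar> \<le> \<epsilon> * (norm (D x))\<^sup>2 + (1 / \<epsilon>) * (B / R\<^sup>2)\<^sup>2 * indicator (cball 0 (2 * R)) x"
      using ae
    proof eventually_elim
      case (elim x)
      show ?case
      proof (cases "norm x < R \<or> norm x > 2 * R")
        case True
        then have "g x = 0" using cutoff_at_support(4)[OF R(1), of x] by (simp add: g_def outer_def zero_vec_def[symmetric])
        then show ?thesis using \<epsilon> by simp
      next
        case False
        have "norm (cross3 a (n x - n0)) \<le> (norm v0 + 1) / R"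
          using norm_cross3_le[of a "n x - n0"] far[of x] False elim R(3) a by auto
        moreover have "norm (grad ?\<phi> x) \<le> M / R"
          using M[of "inverse R *\<^sub>R x"] R(1) by (simp add: grad_cutoff_at field_simps)
        ultimately have "norm (outer (cross3 a (n x - n0)) (grad ?\<phi> x)) \<le> ((norm v0 + 1) / R) * (M / R)"
          unfolding norm_outer using R(1) by (intro mult_mono) auto
        also have "\<dots> = B / R\<^sup>2" by (simp add: B_def power2_eq_square)
        finally have "\<bar>g x\<bar> \<le> norm (D x) * (B / R\<^sup>2)"
          unfolding g_def by (intro order_trans[OF Cauchy_Schwarz_ineq2] mult_left_mono) auto
        also have "\<dots> \<le> \<epsilon> * (norm (D x))\<^sup>2 + (1 / \<epsilon>) * (B / R\<^sup>2)\<^sup>2"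
        proof -
          \<comment> \<open>Weighted Young inequality: the small weight goes to the Jacobian, whose
            energy is merely finite, and the large one to the remainder, which decays in R.
            Completing the square leaves a surplus of three quarters.\<close>
          have am: "s * t \<le> \<epsilon> * s\<^sup>2 + (1 / \<epsilon>) * t\<^sup>2" for s t :: real
          proof -
            have "0 \<le> (\<epsilon> * s - t / 2)\<^sup>2 / \<epsilon> + 3 / 4 * (t\<^sup>2 / \<epsilon>)" using \<epsilon> by simp
            also have "\<dots> = \<epsilon> * s\<^sup>2 + (1 / \<epsilon>) * t\<^sup>2 - s * t"
              using \<epsilon> by (simp add: power2_eq_square field_simps)
            finally show ?thesis by simp
          qed
          show ?thesis by (rule am)
        qed
        finally show ?thesis using False by (simp add: not_less)
      qed
    qed
    have cb: "integrable ?M (\<lambda>x. indicator (cball 0 (2 * R)) x :: real)"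
      "(\<integral>x. indicator (cball 0 (2 * R)) x \<partial>?M) \<le> V * R ^ 3"
    proof -
      have i: "integrable lebesgue (\<lambda>x::R3. indicator (- G) x *\<^sub>R (indicator (cball 0 (2 * R)) x :: real))"
      proof -
        have "emeasure lebesgue (- G \<inter> cball 0 (2 * R)) \<le> emeasure lebesgue (cball (0::R3) (2 * R))"
          by (rule emeasure_mono) simp_all
        also have "\<dots> < \<infinity>" using emeasure_bounded_finite[of "cball 0 (2 * R) :: R3 set"] by (simp add: less_top)
        finally have "integrable lebesgue (indicat_real (- G \<inter> cball 0 (2 * R)))"
          using S by (intro integrable_real_indicator sets.Int) simp_all
        then show ?thesis by (simp add: indicator_inter_arith[abs_def])
      qed
      show "integrable ?M (\<lambda>x. indicator (cball 0 (2 * R)) x :: real)"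
        using i S by (simp add: integrable_restrict_space)
      have "(\<integral>x. indicator (cball 0 (2 * R)) x \<partial>?M) = (\<integral>x. indicator (- G) x *\<^sub>R indicat_real (cball 0 (2 * R)) x \<partial>lebesgue)"
        by (rule integral_restrict_space) (use S in simp)
      also have "\<dots> \<le> (\<integral>x. indicat_real (cball (0::R3) (2 * R)) x \<partial>lebesgue)"
        using emeasure_bounded_finite[of "cball 0 (2 * R) :: R3 set"]
        by (intro integral_mono i integrable_real_indicator) (auto simp: less_top indicator_def)
      also have "\<dots> = measure lborel (cball (0::R3) (2 * R))" by simp
      also have "\<dots> = V * R ^ 3" using R(1) by (simp add: V_def content_cball power_mult_distrib)
      finally show "(\<integral>x. indicator (cball 0 (2 * R)) x \<partial>?M) \<le> V * R ^ 3" .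
    qed
    have ig: "integrable ?M g"
    proof -
      have T: "locL2 (- G) (torque a n ?\<phi>)" "(\<integral>\<^sup>+x. ennreal ((norm (torque a n ?\<phi> x))\<^sup>2) \<partial>?M) < \<infinity>"
        by (rule torque_L2[OF G(1) h' smooth_cutoff_at, where r="3 * R"];
            use R(1) cutoff_at_support(4)[OF R(1)] in force)+
      have "integrable ?M (\<lambda>x. D x \<bullet> torque a n ?\<phi> x - D x \<bullet> outer w (grad ?\<phi> x))"
        using nn_integral_energy(2)[OF m(2) locL2_D[OF T(1)] E T(2)] fl(2) by simp
      then show ?thesis by (simp add: split)
    qed
    have "0 = (\<integral>x. D x \<bullet> torque a n ?\<phi> x \<partial>?M)" using L[OF R(1,2)] by simp
    also have "\<dots> = - (\<integral>x. f x \<partial>?M) + (\<integral>x. g x \<partial>?M)"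
      unfolding split using fl(1,2) ig by (simp add: f_def)
    finally have fg: "(\<integral>x. f x \<partial>?M) = (\<integral>x. g x \<partial>?M)" by simp
    have "(v0 \<bullet> w) * newton_moment = (\<integral>x. (v0 \<bullet> w) * p x \<partial>?M)" using ip by simp
    also have "\<dots> = (\<integral>x. f x \<partial>?M) - (\<integral>x. f x - (v0 \<bullet> w) * p x \<partial>?M)" using ip(1) if' by simp
    finally have 1: "(v0 \<bullet> w) * newton_moment = (\<integral>x. g x \<partial>?M) - (\<integral>x. f x - (v0 \<bullet> w) * p x \<partial>?M)"
      using fg by simp
    have "norm (\<integral>x. f x - (v0 \<bullet> w) * p x \<partial>?M) \<le> (\<integral>x. \<epsilon> * q x \<partial>?M)"
    proof (rule order_trans[OF integral_norm_bound], rule integral_mono_AE)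
      show "integrable ?M (\<lambda>x. norm (f x - (v0 \<bullet> w) * p x))" using if' ip(1) by simp
      show "integrable ?M (\<lambda>x. \<epsilon> * q x)" using iq(1) by simp
      show "AE x in ?M. norm (f x - (v0 \<bullet> w) * p x) \<le> \<epsilon> * q x"
        using ae
      proof eventually_elim
        case (elim x)
        show ?case
        proof (cases "norm x < R")
          case True
          then show ?thesis using cutoff_at_support(5)[OF R(1), of x] by (simp add: f_def p_def q_def)
        next
          case False
          let ?e = "norm x *\<^sub>R (n x - n0) - v0"
          have x: "norm x > 0" using False R(1) by linarith
          have "f x - (v0 \<bullet> w) * p x = laplacian ?\<phi> x / norm x * (?e \<bullet> w)"
          proof -
            have "?e \<bullet> w = norm x * ((n x - n0) \<bullet> w) - v0 \<bullet> w"
              by (simp only: inner_diff_left[of "norm x *\<^sub>R (n x - n0)"] inner_scaleR_left)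
            then show ?thesis unfolding f_def p_def by (simp only:) (use x in \<open>simp add: field_simps\<close>)
          qed
          moreover have "\<bar>?e \<bullet> w\<bar> \<le> \<epsilon>"
          proof -
            have "\<bar>?e \<bullet> w\<bar> \<le> norm ?e * norm w" by (rule Cauchy_Schwarz_ineq2)
            also have "\<dots> \<le> \<epsilon> * 1" using elim False R(3) w(2) \<epsilon> by (intro mult_mono) auto
            finally show ?thesis by simp
          qed
          ultimately have "\<bar>f x - (v0 \<bullet> w) * p x\<bar> \<le> \<bar>laplacian ?\<phi> x\<bar> / norm x * \<epsilon>"
            by (simp add: abs_mult mult_left_mono divide_right_mono)
          then show ?thesis by (simp add: q_def mult.commute)
        qed
      qed
    qed
    then have 2: "\<bar>\<integral>x. f x - (v0 \<bullet> w) * p x \<partial>?M\<bar> \<le> \<epsilon> * abs_newton_moment" using iq by simp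
    have "norm (\<integral>x. g x \<partial>?M) \<le> (\<integral>x. \<epsilon> * (norm (D x))\<^sup>2 + (1 / \<epsilon>) * (B / R\<^sup>2)\<^sup>2 * indicator (cball 0 (2 * R)) x \<partial>?M)"
      using gb iE cb(1) ig
      by (intro order_trans[OF integral_norm_bound] integral_mono_AE) simp_all
    also have "\<dots> = \<epsilon> * E0 + (1 / \<epsilon>) * (B / R\<^sup>2)\<^sup>2 * (\<integral>x. indicator (cball 0 (2 * R)) x \<partial>?M)"
      using iE cb by (simp add: E0_def)
    also have "\<dots> \<le> \<epsilon> * E0 + (1 / \<epsilon>) * (B / R\<^sup>2)\<^sup>2 * (V * R ^ 3)"
      using cb(2) \<epsilon> by (intro add_left_mono mult_left_mono) auto
    also have "(1 / \<epsilon>) * (B / R\<^sup>2)\<^sup>2 * (V * R ^ 3) = (B\<^sup>2 * V) * (1 / (\<epsilon> * R))"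
      using R(1) \<epsilon> by (simp add: power2_eq_square power3_eq_cube field_simps)
    also have "\<dots> \<le> (B\<^sup>2 * V) * \<epsilon>"
    proof (rule mult_left_mono)
      have "1 \<le> R * \<epsilon>\<^sup>2" using R(4) \<epsilon> by (simp add: field_simps)
      then show "1 / (\<epsilon> * R) \<le> \<epsilon>" using \<epsilon> R(1) by (simp add: field_simps power2_eq_square)
    qed (simp add: V_def)
    finally have 3: "\<bar>\<integral>x. g x \<partial>?M\<bar> \<le> \<epsilon> * E0 + (B\<^sup>2 * V) * \<epsilon>" by simp
    have "\<bar>v0 \<bullet> w\<bar> * newton_moment = \<bar>(v0 \<bullet> w) * newton_moment\<bar>"
      using newton_moment_pos by (simp add: abs_mult)
    also have "\<dots> \<le> (\<epsilon> * E0 + (B\<^sup>2 * V) * \<epsilon>) + \<epsilon> * abs_newton_moment" using 1 2 3 by linarith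
    finally show ?thesis by (simp add: algebra_simps)
  qed
  then have "\<bar>v0 \<bullet> w\<bar> * newton_moment \<le> 0" by (rule le_0_if_le_mult)
  then show ?thesis using newton_moment_pos by (simp add: mult_le_0_iff w_def)
qed

section \<open>Vanishing components of the far field\<close>

lemma far_field_torque_eq_0:
  assumes G: "open G" "bounded G" and n0: "norm n0 = 1" and a: "norm a = 1"
    and h: "is_minimizer G F n0 n" and ff: "has_far_field n n0 v0"
    and d: "((\<lambda>t. (Ehat G F (rot a t n0) - Ehat G F n0) / t) \<longlongrightarrow> 0) (at 0)"
  shows "v0 \<bullet> cross3 a n0 = 0"
proof -
  obtain r0 where r0: "G \<subseteq> ball 0 r0" using bounded_subset_ballD[OF G(2), of 0] by blast
  let ?g = "\<lambda>t. Ehat G F (rot a t n0) - Ehat G F n0"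
  obtain D where D: "H1_loc_sphere G n D" "(\<integral>\<^sup>+x. ennreal ((norm (D x))\<^sup>2) \<partial>lebesgue_on (- G)) < \<infinity>"
    and up: "\<And>\<phi> r. smooth \<phi> \<Longrightarrow> (\<forall>x. norm x \<ge> r \<longrightarrow> \<phi> x = 1) \<Longrightarrow> (\<forall>x. norm x \<ge> r \<longrightarrow> grad \<phi> x = 0) \<Longrightarrow>
       (\<forall>x\<in>frontier G. \<phi> x = 0) \<Longrightarrow>
       (\<exists>C. \<forall>t. Ehat G F (rot a t n0) \<le> Ehat G F n0
          + 2 * t * (\<integral>x. D x \<bullet> torque a n \<phi> x \<partial>lebesgue_on (- G)) + t\<^sup>2 * C)"
    using Ehat_rot_le[OF G(1) h a] by blast
  show ?thesis
  proof (rule torque_limit[OF G(1) r0 D(1) ff n0 a D(2)])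
    fix R :: real assume R: "R > 0" "R > r0"
    let ?L = "\<integral>x. D x \<bullet> torque a n (cutoff_at R) x \<partial>lebesgue_on (- G)"
    have "closure G \<subseteq> cball 0 r0" using r0 by (intro closure_minimal) auto
    then have fr: "\<forall>x\<in>frontier G. cutoff_at R x = 0"
      using R cutoff_at_support(1)[OF R(1)] by (force simp: frontier_def)
    have "\<exists>C. \<forall>t. Ehat G F (rot a t n0) \<le> Ehat G F n0 + 2 * t * ?L + t\<^sup>2 * C"
      \<comment> \<open>The gradient of the cutoff is known to vanish strictly beyond 2R, while the
        condition on \<open>r\<close> is not strict; the radius 3R leaves room.\<close>
      by (rule up[where r="3 * R"])
        (use smooth_cutoff_at fr R(1) cutoff_at_support(2,4)[OF R(1)] in auto)
    then obtain C where C: "\<And>t. ?g t \<le> 2 * t * ?L + t\<^sup>2 * C" by (auto simp: algebra_simps)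
    have lim: "((\<lambda>t. 2 * ?L + t * C) \<longlongrightarrow> 2 * ?L + 0 * C) (at 0 within S)" for S
      by (intro tendsto_intros)
    have "0 \<le> 2 * ?L + 0 * C"
    proof (rule tendsto_le[OF _ lim])
      show "((\<lambda>t. ?g t / t) \<longlongrightarrow> 0) (at_right 0)" using d filterlim_at_split by blast
      show "\<forall>\<^sub>F t in at_right 0. ?g t / t \<le> 2 * ?L + t * C"
      proof (rule eventually_at_rightI[of 0 1])
        fix t :: real assume t: "t \<in> {0<..<1}"
        then show "?g t / t \<le> 2 * ?L + t * C"
          using C[of t] by (simp add: divide_le_eq power2_eq_square algebra_simps)
      qed simp
    qed simp
    \<comment> \<open>Division by a negative \<open>t\<close> reverses the upper bound, so the
      left-hand quotients supply the opposite sign.\<close>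
    moreover have "2 * ?L + 0 * C \<le> 0"
    proof (rule tendsto_le[OF _ _ lim])
      show "((\<lambda>t. ?g t / t) \<longlongrightarrow> 0) (at_left 0)" using d filterlim_at_split by blast
      show "\<forall>\<^sub>F t in at_left 0. 2 * ?L + t * C \<le> ?g t / t"
      proof (rule eventually_at_leftI[of "-1" 0])
        fix t :: real assume t: "t \<in> {-1<..<0}"
        then show "2 * ?L + t * C \<le> ?g t / t"
          using C[of t] by (simp add: le_divide_eq power2_eq_square algebra_simps)
      qed simp
    qed simp
    ultimately show "?L = 0" by simp
  qed
qed

lemma is_minimizer_H1_loc_sphere: "is_minimizer G F n0 n \<Longrightarrow> \<exists>D. H1_loc_sphere G n D"
  by (auto simp: is_minimizer_def admissible_def)

text \<open>If the far field did not vanish, the rotation about \<open>n0 \<times> v0\<close> would move \<open>n0\<close> in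
  the direction \<open>v0\<close>.\<close>

lemma far_field_eq_0:
  assumes G: "open G" "bounded G" and n0: "norm n0 = 1"
    and h: "is_minimizer G F n0 n" and ff: "has_far_field n n0 v0"
    and d: "\<And>a. norm a = 1 \<Longrightarrow> a \<bullet> n0 = 0 \<Longrightarrow> ((\<lambda>t. (Ehat G F (rot a t n0) - Ehat G F n0) / t) \<longlongrightarrow> 0) (at 0)"
  shows "v0 = 0"
proof (rule ccontr)
  assume v0: "v0 \<noteq> 0"
  have o: "v0 \<bullet> n0 = 0"
    using far_field_orthogonal[OF G _ ff n0] is_minimizer_H1_loc_sphere[OF h] by blast
  define b where "b = cross3 n0 v0"
  have "(norm b)\<^sup>2 = (norm v0)\<^sup>2"
    using norm_cross_dot[of n0 v0] o n0 by (simp add: b_def inner_commute)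
  then have nb: "norm b = norm v0" by (simp add: power2_eq_iff_nonneg)
  define a where "a = (1 / norm v0) *\<^sub>R b"
  have a: "norm a = 1" "a \<bullet> n0 = 0" using v0 nb by (simp_all add: a_def b_def dot_cross_self)
  have "n0 \<bullet> n0 = 1" using n0 by (simp add: dot_square_norm)
  then have "cross3 b n0 = v0"
    using o cross_skew[of b n0] by (simp add: b_def Lagrange inner_commute)
  then have "v0 \<bullet> cross3 a n0 = norm v0"
    using v0 by (simp add: a_def cross_mult_left dot_square_norm power2_eq_square)
  then show False
    using far_field_torque_eq_0[OF G n0 a(1) h ff d[OF a]] v0 by simp
qed

lemma SO3_transpose: "R \<in> SO3 \<Longrightarrow> transpose R \<in> SO3"
  by (simp add: SO3_def rotation_matrix_def orthogonal_matrix_transpose det_transpose)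

lemma SO3_axis_transpose:
  assumes "R \<in> SO3_axis u" shows "transpose R \<in> SO3_axis u"
proof -
  have "transpose R *v u = transpose R *v (R *v u)" using assms by (simp add: SO3_axis_def)
  also have "\<dots> = u" using assms PR[OF _ refl, of R u]
    by (simp add: SO3_axis_def SO3_def rotation_matrix_def del: transpose_matrix_vector)
  finally show ?thesis using assms SO3_transpose
    by (simp add: SO3_axis_def del: transpose_matrix_vector)
qed

lemma even_differentiable_imp:
  fixes g :: "real \<Rightarrow> real"
  assumes "g differentiable (at 0)" "\<And>t. g (- t) = g t"
  shows "((\<lambda>t. (g t - g 0) / t) \<longlongrightarrow> 0) (at 0)"
proof -
  obtain d where d: "(g has_real_derivative d) (at 0)"
    using assms(1) real_differentiable_def by blast
  have "((\<lambda>t. g (- t)) has_real_derivative d * (- 1)) (at 0)"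
    by (rule DERIV_chain2[where g=uminus]) (use d in \<open>auto intro!: derivative_eq_intros\<close>)
  then have "d * (- 1) = d" unfolding assms(2) using d by (rule DERIV_unique)
  then have "d = 0" by simp
  then show ?thesis using d by (simp add: has_field_derivative_iff)
qed

text \<open>Differentiability is given only within the sphere. The curve stays on the sphere, so the
  chain rule is applied relative to its range.\<close>

lemma Ehat_rot_differentiable:
  assumes "Ehat G F differentiable (at u within sphere 0 1)" "norm u = 1" "norm a = 1"
  shows "(\<lambda>t. Ehat G F (rot a t u)) differentiable (at 0)"
proof -
  have r: "((\<lambda>t. rot a t u) has_derivative (\<lambda>h. h *\<^sub>R cross3 a u)) (at 0)"
    unfolding rot_def by (auto intro!: derivative_eq_intros)
  obtain E' where "(Ehat G F has_derivative E') (at (rot a 0 u) within sphere 0 1)"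
    using assms(1) by (auto simp: differentiable_def)
  moreover have "range (\<lambda>t. rot a t u) \<subseteq> sphere 0 1" using assms(2,3) by auto
  ultimately have "(Ehat G F has_derivative E') (at (rot a 0 u) within range (\<lambda>t. rot a t u))"
    by (rule has_derivative_subset)
  from has_derivative_in_compose[OF r this]
  show ?thesis by (auto simp: differentiable_def)
qed

theorem corollary1p8:
  fixes G :: "(real ^ 3) set"
    and F :: "(real ^ 3 \<Rightarrow> real ^ 3) \<Rightarrow> ennreal"
  assumes "smooth_open_set G" and "bounded G"
    and "weakly_lsc G F"
    and "\<exists>g\<in>H12_sphere G. F g < \<infinity>"
  shows
    "(\<forall>u\<in>sphere 0 1. SO3_axis u \<subseteq> Sym G F \<longrightarrow>
        (AE n0 in surface_measure (sphere 0 1).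
           \<forall>n v0. is_minimizer G F n0 n \<and> has_far_field n n0 v0 \<longrightarrow> v0 \<bullet> cross3 u n0 = 0) \<and>
        (Ehat G F differentiable (at u within sphere 0 1) \<longrightarrow>
           (\<forall>n v0. is_minimizer G F u n \<and> has_far_field n u v0 \<longrightarrow> v0 = 0))) \<and>
     (SO3 \<subseteq> Sym G F \<longrightarrow>
        (\<forall>n0\<in>sphere 0 1. \<forall>n v0. is_minimizer G F n0 n \<and> has_far_field n n0 v0 \<longrightarrow> v0 = 0))"
proof (intro conjI ballI impI allI)
  have G: "open G" "bounded G" using assms by (auto simp: smooth_open_set_def)
  {
    fix u :: R3 assume u: "u \<in> sphere 0 1" and sym: "SO3_axis u \<subseteq> Sym G F"
    have inv: "Ehat G F (rot u t x) = Ehat G F x" for t x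
      using Ehat_Sym[OF G(1), of "matrix (rot u t)" F x] matrix_rot_in_SO3_axis[of u t] SO3_axis_transpose sym u
      by (auto simp: subset_iff)
    show "AE n0 in surface_measure (sphere 0 1).
       \<forall>n v0. is_minimizer G F n0 n \<and> has_far_field n n0 v0 \<longrightarrow> v0 \<bullet> cross3 u n0 = 0"
    \<comment> \<open>Invariance under rotations about \<open>u\<close> makes the difference
      quotients identically zero, so the conclusion holds at every point of the sphere.\<close>
    proof (rule AE_I2, intro allI impI)
      fix n0 n v0 assume "n0 \<in> space (surface_measure (sphere 0 1))"
        and "is_minimizer G F n0 n \<and> has_far_field n n0 v0"
      then show "v0 \<bullet> cross3 u n0 = 0"
        using far_field_torque_eq_0[OF G, of n0 u F n v0] u inv
        by (simp add: surface_measure_def space_restrict_space)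
    qed
    fix n v0
    assume diff: "Ehat G F differentiable (at u within sphere 0 1)"
      and h: "is_minimizer G F u n \<and> has_far_field n u v0"
    show "v0 = 0"
    proof (rule far_field_eq_0[OF G, of u F n])
      fix a :: R3 assume a: "norm a = 1" "a \<bullet> u = 0"
      \<comment> \<open>As \<open>a\<close> is orthogonal to \<open>u\<close>, the great circle is
        spanned by \<open>u\<close> and \<open>cross3 a u\<close>. The half turn about
        \<open>u\<close> fixes the first and negates the second, hence reverses the circle.\<close>
      have "rot u pi (rot a t u) = rot a (- t) u" for t
      proof -
        have "rot u pi (cross3 a u) = - cross3 a u"
          using u by (subst rot_perp) (simp_all add: dot_cross_self)
        then show ?thesis using linear_rot[of u pi]
          by (simp add: rot_perp[OF a] linear_add linear_scale)
      qed
      then have "Ehat G F (rot a (- t) u) = Ehat G F (rot a t u)" for t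
        using inv by metis
      then show "((\<lambda>t. (Ehat G F (rot a t u) - Ehat G F u) / t) \<longlongrightarrow> 0) (at 0)"
        using even_differentiable_imp[OF Ehat_rot_differentiable[OF diff _ a(1)]] u by simp
    qed (use u h in auto)
  }
  fix n0 :: R3 and n v0 assume sym: "SO3 \<subseteq> Sym G F" and n0: "n0 \<in> sphere 0 1"
    and h: "is_minimizer G F n0 n \<and> has_far_field n n0 v0"
  show "v0 = 0"
  proof (rule far_field_eq_0[OF G, of n0 F n])
    fix a :: R3 assume a: "norm a = 1"
    have "Ehat G F (rot a t n0) = Ehat G F n0" for t
      using Ehat_Sym[OF G(1), of "matrix (rot a t)" F n0] matrix_rot_in_SO3_axis[OF a, of t] SO3_transpose sym
      by (auto simp: SO3_axis_def subset_iff)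
    then show "((\<lambda>t. (Ehat G F (rot a t n0) - Ehat G F n0) / t) \<longlongrightarrow> 0) (at 0)" by simp
  qed (use n0 h in auto)
qed

end
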